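(* Let $\alpha:[0,1]\to[c,d]\subset(0,2)$, let $Y$ be the symmetric multistable Lévy motion with parameter $\alpha$, as defined in the context, and let $u\in U\subset(0,1)$, $U$ an open interval. 1. If $0<\alpha(u)<1$ and $\frac1{\alpha(u)}\ne\mathcal{H}^\alpha_u$, then almost surely $$\mathcal{H}_u=\min\Big(\frac1{\alpha(u)},\mathcal{H}_u^\alpha\Big),$$ where $\mathcal{H}^\alpha_u$ denotes the Hölder exponent of the function $\alpha$ at $u$. 2. If $1\le\alpha(u)<2$ and $\alpha$ is $C^1$, then almost surely $\mathcal{H}_u=\frac1{\alpha(u)}$. Here $\mathcal{H}_u$ denotes the pointwise Hölder exponent of $Y$ at $u$.
   Context: The pointwise Hölder exponent at $u$ of a function (or sample path) $Z$ is $\sup\{\gamma:\lim_{r\to0}\frac{|Z(u+r)-Z(u)|}{|r|^\gamma}=0\}$; $\mathcal{H}_u$ is this exponent for $Z=Y$ and $\mathcal{H}_u^\alpha$ for $Z=\alpha$. Symmetric multistable Lévy motion: let $(\Gamma_i)_{i\ge1}$ be the arrival times of a Poisson process with unit rate, $(V_i)_{i\ge1}$ i.i.d. uniform on $[0,1]$, and $(\gamma_i)_{i\ge1}$ i.i.d. with $P(\gamma_i=1)=P(\gamma_i=-1)=1/2$, the three sequences being independent. With $C_\eta=\big(\int_0^\infty x^{-\eta}\sin x\,dx\big)^{-1}$, set $X(t,u)=C_{\alpha(u)}^{1/\alpha(u)}\sum_{i=1}^\infty\gamma_i\Gamma_i^{-1/\alpha(u)}\mathbf{1}_{[0,t]}(V_i)$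 and $Y(t)=X(t,t)$. *)

theory Defs
  imports "HOL-Probability.Probability"
begin

(* The exponent ranges over all reals and the supremum is taken in ereal: it is \<infinity> for
   instance when f is constant near u. *)
definition pointwise_holder_exponent :: "(real \<Rightarrow> real) \<Rightarrow> real \<Rightarrow> ereal" where
  "pointwise_holder_exponent f u =
     Sup (ereal ` {\<gamma>. ((\<lambda>r. \<bar>f (u + r) - f u\<bar> / \<bar>r\<bar> powr \<gamma>) \<longlongrightarrow> 0) (at 0)})"

(* The gauge integral agrees with the improper Riemann integral; for \<eta> \<le> 1 the integrand is not
   Lebesgue integrable. *)
definition stable_const :: "real \<Rightarrow> real" where
  "stable_const \<eta> = inverse (integral {0..} (\<lambda>x. x powr (- \<eta>) * sin x))"

(* Sequences are indexed from 0: \<Gamma> i, V i and \<epsilon> i are the (i+1)-st terms. A unit-rate Poisson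
   process is described by its i.i.d. exponential interarrival times, of which \<Gamma> are the partial
   sums. *)
locale multistable_series = prob_space M for M :: "'a measure" +
  fixes \<Gamma> V \<epsilon> :: "nat \<Rightarrow> 'a \<Rightarrow> real"
  assumes interarrival_indep:
      "indep_vars (\<lambda>_. borel) (\<lambda>i \<omega>. case i of 0 \<Rightarrow> \<Gamma> 0 \<omega> | Suc j \<Rightarrow> \<Gamma> (Suc j) \<omega> - \<Gamma> j \<omega>) UNIV"
    and interarrival_exponential:
      "distributed M lborel (\<lambda>\<omega>. case i of 0 \<Rightarrow> \<Gamma> 0 \<omega> | Suc j \<Rightarrow> \<Gamma> (Suc j) \<omega> - \<Gamma> j \<omega>)
         (exponential_density 1)"
    and V_indep: "indep_vars (\<lambda>_. borel) V UNIV"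
    and V_uniform: "distr M lborel (V i) = uniform_measure lborel {0..1}"
    and sign_indep: "indep_vars (\<lambda>_. borel) \<epsilon> UNIV"
    and sign_pos: "prob {\<omega> \<in> space M. \<epsilon> i \<omega> = 1} = 1 / 2"
    and sign_neg: "prob {\<omega> \<in> space M. \<epsilon> i \<omega> = -1} = 1 / 2"
    and sequences_indep:
      "indep_vars (\<lambda>_. \<Pi>\<^sub>M i\<in>UNIV. borel) (\<lambda>k \<omega> i. ([\<Gamma>, V, \<epsilon>] ! k) i \<omega>) {0, 1, 2}"

definition multistable_field ::
  "(real \<Rightarrow> real) \<Rightarrow> (nat \<Rightarrow> 'a \<Rightarrow> real) \<Rightarrow> (nat \<Rightarrow> 'a \<Rightarrow> real) \<Rightarrow> (nat \<Rightarrow> 'a \<Rightarrow> real)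
     \<Rightarrow> real \<Rightarrow> real \<Rightarrow> 'a \<Rightarrow> real" where
  "multistable_field \<alpha> \<Gamma> V \<epsilon> t u \<omega> =
     stable_const (\<alpha> u) powr (1 / \<alpha> u) *
       (\<Sum>i. \<epsilon> i \<omega> * \<Gamma> i \<omega> powr (- 1 / \<alpha> u) * indicator {0..t} (V i \<omega>))"

definition multistable_levy_motion ::
  "(real \<Rightarrow> real) \<Rightarrow> (nat \<Rightarrow> 'a \<Rightarrow> real) \<Rightarrow> (nat \<Rightarrow> 'a \<Rightarrow> real) \<Rightarrow> (nat \<Rightarrow> 'a \<Rightarrow> real)
     \<Rightarrow> real \<Rightarrow> 'a \<Rightarrow> real" where
  "multistable_levy_motion \<alpha> \<Gamma> V \<epsilon> t \<omega> = multistable_field \<alpha> \<Gamma> V \<epsilon> t t \<omega>"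

end

theory Submission
  imports Defs
begin

text \<open>
  Let \<open>Z(t, \<theta>)\<close> be the series with terms \<open>\<epsilon>\<^sub>i \<Gamma>\<^sub>i\<^sup>-\<^sup>\<theta> 1{V\<^sub>i \<le> t}\<close>, so that \<open>Y(t)\<close> is
  \<open>Z(t, 1/\<alpha>(t))\<close> up to a factor that is a Lipschitz function of \<open>\<alpha>(t)\<close>.

  Given the \<open>V\<^sub>i\<close>, the sums of \<open>\<epsilon>\<^sub>i\<close> over those \<open>i < n\<close> with \<open>V\<^sub>i\<close> between \<open>u\<close> and \<open>t\<close> range over only
  \<open>O(n\<^sup>2)\<close> index sets as \<open>t\<close> varies. Hoeffding's inequality, the finiteness of the moments of
  \<open>|V\<^sub>i - u|\<close> of order above \<open>-1\<close> and the Borel-Cantelli lemma therefore bound these sums by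
  \<open>K n\<^sup>s |t - u|\<^sup>p\<close> for all \<open>n\<close> and \<open>t\<close> at once, whenever \<open>s > max p (1/2)\<close>. Since \<open>\<Gamma>\<^sub>n\<close> grows linearly,
  summation by parts turns this into \<open>Z(t, \<theta>) - Z(u, \<theta>) = O(|t - u|\<^sup>p)\<close> for every \<open>p < \<theta>\<close>, and
  shows that \<open>Z\<close> is Lipschitz in \<open>\<theta>\<close>. This gives the lower bound for the exponent of \<open>Y\<close>.

  For the upper bound \<open>1/\<alpha>(u)\<close>, infinitely many \<open>i\<close> have \<open>|V\<^sub>i - u| \<le> \<delta>/i\<close>, while the jump of
  \<open>Z(\<cdot>, \<theta>)\<close> at \<open>V\<^sub>i\<close> has size \<open>\<Gamma>\<^sub>i\<^sup>-\<^sup>\<theta>\<close>, which is at least a multiple of \<open>i\<^sup>-\<^sup>\<theta>\<close>. For the upper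
  bound by the exponent of \<open>\<alpha>\<close>, choose \<open>t\<^sub>n\<close> tending to \<open>u\<close> along which \<open>\<alpha>\<close> oscillates. By compactness the
  difference quotients of \<open>Y\<close> with respect to \<open>1/\<alpha>\<close> converge along a subsequence to a series with
  terms \<open>\<epsilon>\<^sub>i h(\<Gamma>\<^sub>i) 1{V\<^sub>i \<le> u}\<close>, where \<open>h\<close> is deterministic, and such a series almost surely
  does not vanish.
\<close>

subsection \<open>Summation by parts\<close>

text \<open>The exponent 1/\<alpha>(u) is only known to exceed 1/2, so the series need not converge
  absolutely; both cases of the theorem therefore rest on cancellation between signs. The threshold
  1/2 is the growth rate of sign sums, and \<alpha> < 2 provides it. Null sets may not depend on the
  uncountable parameters t and \<theta>. Probability is therefore confined to a few facts about one
  path (growth of the arrival times, partial sums of signs, distinct and recurring positions), and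
  the rest is analysis at a fixed \<omega>. Time and exponent are decoupled by freezing the exponent
  at u, at a cost of O(|\<alpha>(t) - \<alpha>(u)|). Nothing makes \<alpha> continuous at u: along
  the chosen times it may tend to a value other than \<alpha>(u), so difference quotients between
  distinct exponents occur in the limit beside derivatives. The times and the subsequence are chosen
  from \<alpha> alone, before \<omega>; this is what makes the limiting coefficients
  deterministic.\<close>

lemma powr_diff_weighted_le:
  fixes x y s \<sigma> :: real
  assumes "0 < x" "x \<le> y" "0 \<le> s" "s < \<sigma>"
  shows "x powr s * (x powr - \<sigma> - y powr - \<sigma>) \<le> \<sigma> / (\<sigma> - s) * (x powr (s - \<sigma>) - y powr (s - \<sigma>))"
proof -
  \<comment> \<open>The left side is the integral over [x, y] of
    \<open>x powr s * \<sigma> * z powr (- \<sigma> - 1)\<close>. Replacing \<open>x powr s\<close>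
    by \<open>z powr s\<close> enlarges it to \<open>c\<close> times the decrement of
    \<open>z powr (s - \<sigma>)\<close>.\<close>
  define c where "c = \<sigma> / (\<sigma> - s)"
  have c: "c * (\<sigma> - s) = \<sigma>" using assms by (simp add: c_def)
  define F where "F z = c * (x powr (s - \<sigma>) - z powr (s - \<sigma>)) - x powr s * (x powr - \<sigma> - z powr - \<sigma>)" for z
  have "F x \<le> F y"
  proof (rule DERIV_nonneg_imp_nondecreasing[OF assms(2)])
    fix z assume z: "x \<le> z" "z \<le> y"
    with assms have z0: "0 < z" by simp
    have "(F has_real_derivative (c * (\<sigma> - s) * z powr (s - \<sigma> - 1) - x powr s * (\<sigma> * z powr (- \<sigma> - 1)))) (at z)"
      unfolding F_def using z0
      by (auto intro!: derivative_eq_intros simp: algebra_simps)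
    then have "(F has_real_derivative (\<sigma> * z powr (s - \<sigma> - 1) - x powr s * (\<sigma> * z powr (- \<sigma> - 1)))) (at z)"
      unfolding c .
    moreover have "\<sigma> * z powr (s - \<sigma> - 1) = z powr s * (\<sigma> * z powr (- \<sigma> - 1))"
      using z0 by (simp add: powr_add[symmetric] algebra_simps)
    moreover have "x powr s * (\<sigma> * z powr (- \<sigma> - 1)) \<le> z powr s * (\<sigma> * z powr (- \<sigma> - 1))"
      using assms z by (intro mult_right_mono powr_mono2) auto
    ultimately show "\<exists>d. (F has_real_derivative d) (at z) \<and> 0 \<le> d" by force
  qed
  moreover have "F x = 0" by (simp add: F_def)
  ultimately show ?thesis by (simp add: F_def c_def)
qed

lemma summation_by_parts:
  fixes a b :: "nat \<Rightarrow> real"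
  shows "(\<Sum>i<n. a i * b i) = (\<Sum>i<n. a i) * b n + (\<Sum>i<n. (\<Sum>j<Suc i. a j) * (b i - b (Suc i)))"
  by (induction n) (simp_all add: algebra_simps)

text \<open>A deterministic stand-in for one path of arrival times: \<open>\<kappa>\<close> is the
  slope of a linear lower bound, \<open>s\<close> the growth exponent of the partial sums to be
  tested against it, and \<open>\<sigma>\<close> the decay exponent of the second factor.\<close>

locale abel_weights =
  fixes G :: "nat \<Rightarrow> real" and \<kappa> s \<sigma> :: real
  assumes mono_G: "G i \<le> G (Suc i)"
    and G_ge: "\<kappa> * Suc i \<le> G i"
    and \<kappa>_pos: "0 < \<kappa>"
    and s_nonneg: "0 \<le> s"
    and s_less: "s < \<sigma>"
begin

lemma G_pos: "0 < G i"
  using G_ge[of i] \<kappa>_pos by (smt (verit) mult_pos_pos of_nat_0_less_iff zero_less_Suc)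

lemma G_mono: "i \<le> j \<Longrightarrow> G i \<le> G j"
  using mono_G by (rule lift_Suc_mono_le)

lemma G_at_top: "filterlim G at_top sequentially"
proof (rule filterlim_at_top_mono)
  show "filterlim (\<lambda>i. \<kappa> * real (Suc i)) at_top sequentially"
    using \<kappa>_pos
    by (intro filterlim_tendsto_pos_mult_at_top[OF tendsto_const]
        filterlim_compose[OF filterlim_real_sequentially filterlim_Suc]) auto
  show "\<forall>\<^sub>F i in sequentially. \<kappa> * real (Suc i) \<le> G i"
    using G_ge by simp
qed

text \<open>The power is of \<open>Suc i\<close>, not \<open>i\<close>, because after summation by
  parts the factor at \<open>i\<close> is a sum of \<open>Suc i\<close> terms.\<close>

definition weight :: "nat \<Rightarrow> real" where
  "weight i = real (Suc i) powr s * (G i powr - \<sigma> - G (Suc i) powr - \<sigma>)"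

lemma powr_decreasing: "G (Suc i) powr - \<sigma> \<le> G i powr - \<sigma>"
  using mono_G G_pos s_less s_nonneg by (intro powr_mono2') auto

lemma weight_nonneg: "0 \<le> weight i"
  unfolding weight_def using powr_decreasing[of i] by simp

lemma Suc_powr_le: "real (Suc i) powr s \<le> \<kappa> powr - s * G i powr s"
proof -
  have "(\<kappa> * real (Suc i)) powr s \<le> G i powr s"
    using G_ge \<kappa>_pos s_nonneg by (intro powr_mono2) auto
  then have "\<kappa> powr - s * (\<kappa> * real (Suc i)) powr s \<le> \<kappa> powr - s * G i powr s"
    by (intro mult_left_mono) auto
  moreover have "\<kappa> powr - s * (\<kappa> * real (Suc i)) powr s = real (Suc i) powr s"
    using \<kappa>_pos by (simp add: powr_mult powr_minus)
  ultimately show ?thesis by simp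
qed

text \<open>The linear lower bound trades the power of the index for a power of \<open>G i\<close>.
  The weight is then at most a multiple of the decrement of \<open>G i powr (s - \<sigma>)\<close>,
  and these decrements telescope because \<open>s < \<sigma>\<close>.\<close>

lemma summable_weight: "summable weight"
proof (rule summable_comparison_test')
  have "(\<lambda>i. G i powr (s - \<sigma>)) \<longlonglongrightarrow> 0"
    using s_less by (intro tendsto_neg_powr G_at_top) auto
  from telescope_summable'[OF this]
  show "summable (\<lambda>i. \<kappa> powr - s * (\<sigma> / (\<sigma> - s)) * (G i powr (s - \<sigma>) - G (Suc i) powr (s - \<sigma>)))"
    by (intro summable_mult)
  fix i
  have "weight i \<le> (\<kappa> powr - s * G i powr s) * (G i powr - \<sigma> - G (Suc i) powr - \<sigma>)"
    unfolding weight_def using powr_decreasing[of i]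
    by (intro mult_right_mono Suc_powr_le) auto
  also have "\<dots> \<le> \<kappa> powr - s * (\<sigma> / (\<sigma> - s) * (G i powr (s - \<sigma>) - G (Suc i) powr (s - \<sigma>)))"
    unfolding mult.assoc using G_pos mono_G s_nonneg s_less
    by (intro mult_left_mono powr_diff_weighted_le) auto
  finally show "norm (weight i) \<le> \<kappa> powr - s * (\<sigma> / (\<sigma> - s)) * (G i powr (s - \<sigma>) - G (Suc i) powr (s - \<sigma>))"
    using weight_nonneg[of i] by (simp add: mult.assoc)
qed

lemma boundary_tendsto_0: "(\<lambda>n. real n powr s * G n powr - \<sigma>) \<longlonglongrightarrow> 0"
proof (rule tendsto_sandwich[OF _ _ tendsto_const])
  have "(\<lambda>n. G n powr (s - \<sigma>)) \<longlonglongrightarrow> 0"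
    using s_less by (intro tendsto_neg_powr G_at_top) auto
  from tendsto_mult[OF tendsto_const[of "\<kappa> powr - s"] this]
  show "(\<lambda>n. \<kappa> powr - s * G n powr (s - \<sigma>)) \<longlonglongrightarrow> 0" by simp
  have "real n powr s * G n powr - \<sigma> \<le> \<kappa> powr - s * G n powr (s - \<sigma>)" for n
  proof -
    have "real n powr s \<le> real (Suc n) powr s" using s_nonneg by (intro powr_mono2) auto
    also note Suc_powr_le[of n]
    finally have "real n powr s * G n powr - \<sigma> \<le> (\<kappa> powr - s * G n powr s) * G n powr - \<sigma>"
      by (intro mult_right_mono) auto
    also have "\<dots> = \<kappa> powr - s * G n powr (s - \<sigma>)"
      by (simp add: powr_add[symmetric])
    finally show ?thesis .
  qed
  then show "\<forall>\<^sub>F n in sequentially. real n powr s * G n powr - \<sigma> \<le> \<kappa> powr - s * G n powr (s - \<sigma>)"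
    by simp
qed simp

text \<open>Domination of values and of decrements by the model sequence
  \<open>G i powr - \<sigma>\<close> is all that Abel summation asks of the second factor. The
  condition is closed under pointwise limits and also covers difference quotients in the
  exponent.\<close>

definition slowly_varying :: "real \<Rightarrow> (nat \<Rightarrow> real) \<Rightarrow> bool" where
  "slowly_varying B b \<longleftrightarrow> (\<forall>i. \<bar>b i\<bar> \<le> B * G i powr - \<sigma>) \<and>
     (\<forall>i. \<bar>b i - b (Suc i)\<bar> \<le> B * (G i powr - \<sigma> - G (Suc i) powr - \<sigma>))"

lemma slowly_varying_powr: "slowly_varying 1 (\<lambda>i. G i powr - \<sigma>)"
  using powr_decreasing by (simp add: slowly_varying_def)

definition partial_sums_bounded :: "real \<Rightarrow> (nat \<Rightarrow> real) \<Rightarrow> bool" where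
  "partial_sums_bounded K a \<longleftrightarrow> (\<forall>n. \<bar>\<Sum>i<n. a i\<bar> \<le> K * real n powr s)"

lemma abel_term_le:
  assumes a: "partial_sums_bounded K a" and b: "slowly_varying B b"
  shows "\<bar>(\<Sum>j<Suc i. a j) * (b i - b (Suc i))\<bar> \<le> K * B * weight i"
proof -
  have "0 \<le> K * real (Suc i) powr s"
    using a abs_ge_zero order_trans unfolding partial_sums_bounded_def by blast
  then have "\<bar>\<Sum>j<Suc i. a j\<bar> * \<bar>b i - b (Suc i)\<bar>
      \<le> (K * real (Suc i) powr s) * (B * (G i powr - \<sigma> - G (Suc i) powr - \<sigma>))"
    using a b unfolding partial_sums_bounded_def slowly_varying_def
    by (intro mult_mono) (auto simp del: sum.lessThan_Suc of_nat_Suc)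
  then show ?thesis by (simp add: abs_mult weight_def mult_ac)
qed

text \<open>The given series may converge only conditionally, but its summed-by-parts form is
  dominated by \<open>weight\<close> and the boundary term tends to 0. The bound is linear in
  \<open>K\<close>, so a factor such as a power of the time increment can be carried by
  \<open>K\<close>.\<close>

lemma abel_sums:
  assumes a: "partial_sums_bounded K a" and b: "slowly_varying B b"
  shows "(\<lambda>i. a i * b i) sums (\<Sum>i. (\<Sum>j<Suc i. a j) * (b i - b (Suc i)))"
    and "\<bar>\<Sum>i. a i * b i\<bar> \<le> K * B * suminf weight"
proof -
  let ?c = "\<lambda>i. (\<Sum>j<Suc i. a j) * (b i - b (Suc i))"
  have sW: "summable (\<lambda>i. K * B * weight i)"
    by (intro summable_mult summable_weight)
  have sc: "summable ?c"
    by (rule summable_comparison_test'[OF sW]) (use abel_term_le[OF a b] in simp)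
  have "(\<lambda>n. (\<Sum>i<n. a i) * b n) \<longlonglongrightarrow> 0"
  proof (rule Lim_null_comparison)
    show "\<forall>\<^sub>F n in sequentially. norm ((\<Sum>i<n. a i) * b n) \<le> K * B * (real n powr s * G n powr - \<sigma>)"
    proof (rule always_eventually, rule allI)
      fix n
      have "0 \<le> K * real n powr s"
        using a abs_ge_zero order_trans unfolding partial_sums_bounded_def by blast
      then have "\<bar>\<Sum>i<n. a i\<bar> * \<bar>b n\<bar> \<le> (K * real n powr s) * (B * G n powr - \<sigma>)"
        using a b unfolding partial_sums_bounded_def slowly_varying_def
        by (intro mult_mono) auto
      then show "norm ((\<Sum>i<n. a i) * b n) \<le> K * B * (real n powr s * G n powr - \<sigma>)"
        by (simp add: abs_mult mult_ac)
    qed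
    show "(\<lambda>n. K * B * (real n powr s * G n powr - \<sigma>)) \<longlonglongrightarrow> 0"
      using tendsto_mult[OF tendsto_const[of "K * B"] boundary_tendsto_0] by simp
  qed
  from tendsto_add[OF this summable_LIMSEQ[OF sc]]
  show *: "(\<lambda>i. a i * b i) sums suminf ?c"
    by (simp add: sums_def summation_by_parts[of a b])
  have "\<bar>suminf ?c\<bar> \<le> (\<Sum>i. K * B * weight i)"
    using norm_suminf_le[OF _ sW, of ?c] abel_term_le[OF a b] by simp
  then show "\<bar>\<Sum>i. a i * b i\<bar> \<le> K * B * suminf weight"
    using sums_unique[OF *] by (simp add: suminf_mult[OF summable_weight])
qed

text \<open>The series itself has in general no summable majorant; dominated convergence is applied
  to its summed-by-parts form, which agrees with it along the filter and at the limit.\<close>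

lemma abel_tannery:
  fixes a b :: "nat \<Rightarrow> 'x \<Rightarrow> real"
  assumes "F \<noteq> bot"
    and a: "\<And>x. partial_sums_bounded K (\<lambda>i. a i x)"
    and b: "\<And>x. slowly_varying B (\<lambda>i. b i x)"
    and a_lim: "\<And>i. (a i \<longlongrightarrow> a' i) F"
    and b_lim: "\<And>i. (b i \<longlongrightarrow> b' i) F"
  shows "((\<lambda>x. \<Sum>i. a i x * b i x) \<longlongrightarrow> (\<Sum>i. a' i * b' i)) F"
proof -
  \<comment> \<open>Both bounds are inherited by the pointwise limits, so that the limit series may
    be summed by parts as well.\<close>
  have a': "partial_sums_bounded K a'"
    unfolding partial_sums_bounded_def
  proof
    fix n
    have "((\<lambda>x. \<bar>\<Sum>i<n. a i x\<bar>) \<longlongrightarrow> \<bar>\<Sum>i<n. a' i\<bar>) F"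
      by (intro tendsto_intros a_lim)
    then show "\<bar>\<Sum>i<n. a' i\<bar> \<le> K * real n powr s"
      using \<open>F \<noteq> bot\<close> a unfolding partial_sums_bounded_def
      by (intro tendsto_upperbound) auto
  qed
  have b': "slowly_varying B b'"
    unfolding slowly_varying_def
  proof (intro conjI allI)
    fix i
    have "((\<lambda>x. \<bar>b i x\<bar>) \<longlongrightarrow> \<bar>b' i\<bar>) F" by (intro tendsto_intros b_lim)
    then show "\<bar>b' i\<bar> \<le> B * G i powr - \<sigma>"
      using \<open>F \<noteq> bot\<close> b unfolding slowly_varying_def by (intro tendsto_upperbound) auto
    have "((\<lambda>x. \<bar>b i x - b (Suc i) x\<bar>) \<longlongrightarrow> \<bar>b' i - b' (Suc i)\<bar>) F" by (intro tendsto_intros b_lim)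
    then show "\<bar>b' i - b' (Suc i)\<bar> \<le> B * (G i powr - \<sigma> - G (Suc i) powr - \<sigma>)"
      using \<open>F \<noteq> bot\<close> b unfolding slowly_varying_def by (intro tendsto_upperbound) auto
  qed
  have "((\<lambda>x. \<Sum>i. (\<Sum>j<Suc i. a j x) * (b i x - b (Suc i) x)) \<longlongrightarrow> (\<Sum>i. (\<Sum>j<Suc i. a' j) * (b' i - b' (Suc i)))) F"
  proof (rule tannerys_theorem[THEN conjunct2, THEN conjunct2])
    show "summable (\<lambda>i. K * B * weight i)" by (intro summable_mult summable_weight)
    show "\<forall>\<^sub>F (i, x) in sequentially \<times>\<^sub>F F. norm ((\<Sum>j<Suc i. a j x) * (b i x - b (Suc i) x)) \<le> K * B * weight i"
      using abel_term_le[OF a b] by (intro always_eventually) auto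
  qed (intro tendsto_intros a_lim b_lim | fact)+
  then show ?thesis
    using sums_unique[OF abel_sums(1)[OF a b]] sums_unique[OF abel_sums(1)[OF a' b']] by simp
qed

end

text \<open>\<open>B * (\<sigma> * x powr (- \<sigma> - 1))\<close> is minus the derivative of
  \<open>B * x powr - \<sigma>\<close>. Hence both \<open>g\<close> and \<open>- g\<close> become
  nondecreasing once \<open>B * x powr - \<sigma>\<close> is subtracted.\<close>

lemma powr_decrement_dominates:
  fixes g g' :: "real \<Rightarrow> real"
  assumes "\<And>x. x0 \<le> x \<Longrightarrow> (g has_real_derivative g' x) (at x)"
    and "\<And>x. x0 \<le> x \<Longrightarrow> \<bar>g' x\<bar> \<le> B * (\<sigma> * x powr (- \<sigma> - 1))"
    and "0 < x0" "x0 \<le> x" "x \<le> y"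
  shows "\<bar>g x - g y\<bar> \<le> B * (x powr - \<sigma> - y powr - \<sigma>)"
proof -
  have der: "((\<lambda>z. c * g z - B * z powr - \<sigma>) has_real_derivative (c * g' z + B * (\<sigma> * z powr (- \<sigma> - 1)))) (at z)"
    if "x \<le> z" for z c
    using that assms by (auto intro!: derivative_eq_intros)
  have "c * g x - B * x powr - \<sigma> \<le> c * g y - B * y powr - \<sigma>" if c: "c = 1 \<or> c = -1" for c
  proof (rule DERIV_nonneg_imp_nondecreasing[OF assms(5)])
    fix z assume z: "x \<le> z" "z \<le> y"
    have "0 \<le> c * g' z + B * (\<sigma> * z powr (- \<sigma> - 1))"
      using assms(2)[of z] c z assms(4) by auto
    then show "\<exists>d. ((\<lambda>z. c * g z - B * z powr - \<sigma>) has_real_derivative d) (at z) \<and> 0 \<le> d"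
      using der[OF z(1)] by blast
  qed
  from this[of 1] this[of "-1"] show ?thesis by (simp add: algebra_simps abs_le_iff)
qed

subsection \<open>The normalising constant\<close>

text \<open>Up to the factor \<eta>, the integrand left after integrating the sine integral by parts
  with 1 - cos x as primitive of the sine. It is of order \<open>x powr (1 - \<eta>)\<close> at 0
  and O(\<open>x powr (- \<eta> - 1)\<close>) at infinity, hence integrable for 0 < \<eta> <
  2.\<close>

definition cos_kernel :: "real \<Rightarrow> real \<Rightarrow> real" where
  "cos_kernel \<eta> x = (1 - cos x) * x powr (- \<eta> - 1)"

lemma one_minus_cos_le_square: "1 - cos x \<le> x\<^sup>2" for x :: real
proof -
  have "1 - cos x = 2 * sin (x / 2) ^ 2" using cos_double_sin[of "x / 2"] by simp
  moreover have "sin (x / 2) ^ 2 \<le> (x / 2) ^ 2"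
    using abs_sin_x_le_abs_x[of "x / 2"] by (metis abs_le_square_iff)
  ultimately show ?thesis by (simp add: power_divide) (smt (verit) zero_le_power2)
qed

lemma abs_ln_le_powr:
  fixes x \<delta> :: real
  assumes "0 < x" "0 < \<delta>"
  shows "\<bar>ln x\<bar> \<le> (if x \<le> 1 then x powr - \<delta> else x powr \<delta>) / \<delta>"
proof (cases "x \<le> 1")
  case True
  then have "ln (1 / x) \<le> (1 / x) powr \<delta> / \<delta>"
    using assms by (intro ln_powr_bound) auto
  then show ?thesis using True assms by (simp add: ln_div powr_minus_divide powr_divide)
qed (use assms ln_powr_bound[of x \<delta>] in auto)

text \<open>The two exponents are independent because a majorant uniform over an interval of \<eta>
  takes the first from the largest \<eta> and the second from the smallest.\<close>

definition cos_kernel_bound :: "real \<Rightarrow> real \<Rightarrow> real \<Rightarrow> real" where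
  "cos_kernel_bound p q x = (if x \<le> 1 then x powr p else 2 * x powr q)"

lemma cos_kernel_bound_integrable:
  assumes "-1 < p" "q < -1"
  shows "cos_kernel_bound p q integrable_on {0..}"
proof -
  have 1: "cos_kernel_bound p q integrable_on {0..1}"
    by (rule integrable_eq[OF integrable_on_powr_from_0[of p 1]]) (use assms in \<open>auto simp: cos_kernel_bound_def\<close>)
  have "(\<lambda>x. 2 * x powr q) integrable_on {1..}"
    using has_integral_powr_to_inf[of q 1] assms by (intro integrable_on_mult_right) (auto simp: integrable_on_def)
  then have 2: "cos_kernel_bound p q integrable_on {1..}"
    by (rule integrable_spike_finite[of "{1}", rotated 2]) (auto simp: cos_kernel_bound_def)
  have "{0..1} \<inter> {1..} = {1::real}" "{0..1} \<union> {1..} = {0::real..}" by auto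
  then show ?thesis
    using integrable_Un[OF _ 1 2] by simp
qed

lemma cos_kernel_nonneg: "0 \<le> cos_kernel \<eta> x"
  unfolding cos_kernel_def by simp

lemma cos_kernel_le:
  fixes x r :: real
  assumes "0 < x"
  shows "(1 - cos x) * x powr r \<le> (if x \<le> 1 then x powr (r + 2) else 2 * x powr r)"
proof (cases "x \<le> 1")
  case True
  have "(1 - cos x) * x powr r \<le> x\<^sup>2 * x powr r"
    by (intro mult_right_mono one_minus_cos_le_square) auto
  also have "\<dots> = x powr (r + 2)"
    using assms by (simp add: powr_add flip: powr_numeral)
  finally show ?thesis using True by simp
next
  case False
  have "1 - cos x \<le> 2" by (smt (verit) cos_ge_minus_one)
  then show ?thesis using False by (simp add: mult_right_mono)
qed

lemma cos_kernel_integrable: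
  assumes "0 < \<eta>" "\<eta> < 2"
  shows "cos_kernel \<eta> integrable_on {0..}"
proof -
  have "cos_kernel \<eta> absolutely_integrable_on {0..}"
  proof (rule measurable_bounded_by_integrable_imp_absolutely_integrable)
    show "cos_kernel_bound (1 - \<eta>) (- \<eta> - 1) integrable_on {0..}"
      using assms by (intro cos_kernel_bound_integrable) auto
    have "cos_kernel \<eta> \<in> borel_measurable borel" unfolding cos_kernel_def by measurable
    then show "cos_kernel \<eta> \<in> borel_measurable (lebesgue_on {0..})"
      by (intro measurable_restrict_space1 measurable_completion) simp
    fix x :: real assume "x \<in> {0..}"
    then show "norm (cos_kernel \<eta> x) \<le> cos_kernel_bound (1 - \<eta>) (- \<eta> - 1) x"
      using cos_kernel_le[of x "- \<eta> - 1"] cos_kernel_nonneg[of \<eta> x]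
      by (cases "x = 0") (auto simp: cos_kernel_bound_def cos_kernel_def)
  qed simp
  then show ?thesis by (rule set_lebesgue_integral_eq_integral(1))
qed

definition cos_integral :: "real \<Rightarrow> real" where
  "cos_integral \<eta> = integral {0..} (cos_kernel \<eta>)"

text \<open>Only [1, 2] is kept, where cos x is at most cos 1 and the power is at least 2 to the -3.
  The bound is free of \<eta>, which keeps the integral in a range where the logarithm is
  Lipschitz.\<close>

lemma cos_integral_ge:
  assumes "0 < \<eta>" "\<eta> < 2"
  shows "(1 - cos 1) / 8 \<le> cos_integral \<eta>"
proof -
  have int: "cos_kernel \<eta> integrable_on {0..}" using assms by (rule cos_kernel_integrable)
  have sub: "cos_kernel \<eta> integrable_on {1..2}"
    using integrable_on_subcbox[of "cos_kernel \<eta>" "{0..}" 1 2] int by auto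
  have "integral {1..2::real} (\<lambda>x. (1 - cos 1) / 8) \<le> integral {1..2} (cos_kernel \<eta>)"
  proof (rule integral_le[OF _ sub])
    fix x :: real assume x: "x \<in> {1..2}"
    have "cos x \<le> cos 1" using x pi_gt3 by (intro cos_monotone_0_pi_le) auto
    moreover have "1 / 8 \<le> x powr (- \<eta> - 1)"
    proof -
      have "1 / 8 = (2::real) powr - 3" by (simp add: powr_minus)
      also have "\<dots> \<le> 2 powr (- \<eta> - 1)" using assms by (intro powr_mono) auto
      also have "\<dots> \<le> x powr (- \<eta> - 1)" using assms x by (intro powr_mono2') auto
      finally show ?thesis .
    qed
    ultimately have "(1 - cos 1) * (1 / 8) \<le> (1 - cos x) * x powr (- \<eta> - 1)"
      by (intro mult_mono) auto
    then show "(1 - cos 1) / 8 \<le> cos_kernel \<eta> x" by (simp add: cos_kernel_def)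
  qed auto
  also have "\<dots> \<le> integral {0..} (cos_kernel \<eta>)"
    by (rule integral_subset_le[OF _ sub int]) (auto intro: cos_kernel_nonneg)
  finally show ?thesis by (simp add: cos_integral_def)
qed

lemma one_minus_cos_1_pos: "0 < 1 - cos (1::real)"
  using cos_monotone_0_pi[of 0 1] pi_gt3 by simp

text \<open>
  Integrating by parts turns the conditionally convergent sine integral into an absolutely convergent
  one with a nonnegative integrand, which makes positivity and regularity in \<open>\<eta>\<close> accessible.
\<close>
lemma sine_integral:
  assumes "0 < \<eta>" "\<eta> < 2"
  shows "((\<lambda>x. x powr - \<eta> * sin x) has_integral \<eta> * cos_integral \<eta>) {0..}"
proof -
  define F where "F x = (1 - cos x) * x powr - \<eta>" for x :: real
  \<comment> \<open>\<open>F\<close> is a primitive of \<open>k\<close> that vanishes at 0 and at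
    infinity, so \<open>k\<close> has integral 0 and the two integrands have the same
    integral.\<close>
  define k where "k x = x powr - \<eta> * sin x - \<eta> * cos_kernel \<eta> x" for x :: real
  have F0: "F 0 = 0" by (simp add: F_def)
  have cont: "continuous_on {0..} F"
    unfolding continuous_on_eq_continuous_within
  proof
    fix x :: real assume "x \<in> {0..}"
    show "continuous (at x within {0..}) F"
    proof (cases "x = 0")
      case True
      have "continuous_on {0..} (\<lambda>x::real. x powr (2 - \<eta>))"
        using assms by (intro continuous_on_powr') (auto intro!: continuous_intros)
      then have "((\<lambda>x::real. x powr (2 - \<eta>)) \<longlongrightarrow> 0) (at 0 within {0..})"
        unfolding continuous_on_def by (rule bspec[where x=0, THEN tendsto_eq_rhs]) auto
      then have "(F \<longlongrightarrow> 0) (at 0 within {0..})"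
      proof (rule Lim_null_comparison[rotated])
        have "norm (F y) \<le> y powr (2 - \<eta>)" if "0 < y" for y
        proof -
          have "F y \<le> y\<^sup>2 * y powr - \<eta>"
            unfolding F_def by (intro mult_right_mono one_minus_cos_le_square) auto
          also have "\<dots> = y powr (2 - \<eta>)"
            using that by (simp add: powr_add[symmetric] flip: powr_numeral)
          finally show ?thesis by (simp add: F_def abs_mult)
        qed
        then show "\<forall>\<^sub>F y in at 0 within {0..}. norm (F y) \<le> y powr (2 - \<eta>)"
          by (auto simp: eventually_at_filter intro!: always_eventually)
      qed
      then show ?thesis using True F0 by (simp add: continuous_within)
    next
      case False
      then have "isCont F x" unfolding F_def by (intro continuous_intros) auto
      then show ?thesis by (simp add: continuous_at_imp_continuous_at_within)
    qed
  qed
  have FTC: "(k has_integral (F b - F a)) {a..b}" if "0 \<le> a" "a \<le> b" for a b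
  proof (rule fundamental_theorem_of_calculus_interior[OF that(2)])
    show "continuous_on {a..b} F" using cont by (rule continuous_on_subset) (use that in auto)
    fix x assume x: "x \<in> {a<..<b}"
    have "(F has_real_derivative k x) (at x)"
      unfolding F_def k_def cos_kernel_def using x that
      by (auto intro!: derivative_eq_intros simp: algebra_simps)
    then show "(F has_vector_derivative k x) (at x)"
      by (simp add: has_real_derivative_iff_has_vector_derivative)
  qed
  have lim: "(F \<longlongrightarrow> 0) at_top"
  proof (rule Lim_null_comparison)
    have "norm (F y) \<le> 2 * y powr - \<eta>" for y
      unfolding F_def using cos_ge_minus_one[of y] by (auto simp: abs_mult intro!: mult_right_mono)
    then show "\<forall>\<^sub>F y in at_top. norm (F y) \<le> 2 * y powr - \<eta>" by simp
    show "((\<lambda>y. 2 * y powr - \<eta>) \<longlongrightarrow> 0) at_top"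
      using assms tendsto_mult[OF tendsto_const tendsto_neg_powr[of "- \<eta>", OF _ filterlim_ident], of 2] by simp
  qed
  have "(k has_integral 0) {0..}"
    unfolding has_integral_alt'
  proof (intro conjI allI impI)
    fix a b :: real
    have eq: "{0..} \<inter> cbox a b = {max 0 a..b}" by auto
    have "k integrable_on {max 0 a..b}"
      using FTC[of "max 0 a" b] by (cases "max 0 a \<le> b") (auto simp: integrable_on_def)
    then show "(\<lambda>x. if x \<in> {0..} then k x else 0) integrable_on cbox a b"
      using has_integral_restrict_Int[of "{0..}" k _ "cbox a b"] unfolding integrable_on_def eq by auto
  next
    fix e :: real assume "0 < e"
    have "\<forall>\<^sub>F y in at_top. norm (F y) < e" using tendstoD[OF lim \<open>0 < e\<close>] by (simp add: dist_norm)
    then obtain N where N: "\<And>y. N \<le> y \<Longrightarrow> norm (F y) < e"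
      unfolding eventually_at_top_linorder by blast
    show "\<exists>B>0. \<forall>a b. ball 0 B \<subseteq> cbox a b \<longrightarrow> norm (integral (cbox a b) (\<lambda>x. if x \<in> {0..} then k x else 0) - 0) < e"
    proof (intro exI[of _ "max 1 N"] conjI allI impI)
      fix a b :: real assume "ball 0 (max 1 N) \<subseteq> cbox a b"
      then have "{- max 1 N<..<max 1 N} \<subseteq> {a..b}" by (simp add: ball_eq_greaterThanLessThan)
      then have "closure {- max 1 N<..<max 1 N} \<subseteq> {a..b}" by (rule closure_minimal) simp
      then have *: "a \<le> 0" "N \<le> b" "0 \<le> b" by (auto simp: closure_greaterThanLessThan)
      then have eq: "{0..} \<inter> cbox a b = {0..b}" by auto
      have "((\<lambda>x. if x \<in> {0..} then k x else 0) has_integral F b) (cbox a b)"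
        using FTC[of 0 b] * F0 by (simp only: has_integral_restrict_Int eq) simp
      then show "norm (integral (cbox a b) (\<lambda>x. if x \<in> {0..} then k x else 0) - 0) < e"
        using N[OF *(2)] by (simp add: integral_unique)
    qed simp
  qed
  moreover have "((\<lambda>x. \<eta> * cos_kernel \<eta> x) has_integral \<eta> * cos_integral \<eta>) {0..}"
    unfolding cos_integral_def using cos_kernel_integrable[OF assms]
    by (intro has_integral_mult_right integrable_integral)
  ultimately have "((\<lambda>x. k x + \<eta> * cos_kernel \<eta> x) has_integral 0 + \<eta> * cos_integral \<eta>) {0..}"
    by (rule has_integral_add)
  then show ?thesis by (simp add: k_def)
qed

lemma stable_const_eq:
  assumes "0 < \<eta>" "\<eta> < 2"
  shows "stable_const \<eta> = inverse (\<eta> * cos_integral \<eta>)"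
  unfolding stable_const_def integral_unique[OF sine_integral[OF assms]] ..

text \<open>The mean value theorem in \<eta> is applied under the integral sign. It brings in a
  factor ln x, which small powers of x absorb on either side of 1.\<close>

lemma cos_integral_lipschitz:
  assumes "0 < c" "d < 2"
  shows "\<exists>L. L-lipschitz_on {c..d} cos_integral"
proof -
  \<comment> \<open>Half the room that {c..d} leaves inside (0, 2): after a shift by
    \<open>\<delta>\<close> the exponent near 0 still exceeds -1 and the one at infinity is still
    below -1.\<close>
  define \<delta> where "\<delta> = min c (2 - d) / 2"
  define B where "B x = cos_kernel_bound (1 - d - \<delta>) (- c - 1 + \<delta>) x / \<delta>" for x
  show ?thesis
  proof (cases "c \<le> d")
    case True
    have "0 < \<delta>" "2 * \<delta> \<le> c" "2 * \<delta> \<le> 2 - d" using True assms by (auto simp: \<delta>_def)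
    with assms have \<delta>: "0 < \<delta>" "\<delta> < c" "d + \<delta> < 2" by simp_all
    have intB: "B integrable_on {0..}"
      unfolding B_def using \<delta> by (intro integrable_on_divide cos_kernel_bound_integrable) auto
    have key: "\<bar>cos_kernel \<eta> x - cos_kernel \<eta>' x\<bar> \<le> \<bar>\<eta> - \<eta>'\<bar> * B x"
      if \<eta>: "c \<le> \<eta>" "\<eta> \<le> \<eta>'" "\<eta>' \<le> d" and x: "0 \<le> x" for \<eta> \<eta>' x
    proof (cases "x = 0")
      case False
      with x have x0: "0 < x" by simp
      have "\<exists>z. z \<in> {\<eta>..\<eta>'} \<and> cos_kernel \<eta>' x - cos_kernel \<eta> x = (\<eta>' - \<eta>) * (- ln x * cos_kernel z x)"
      proof (cases "\<eta> = \<eta>'")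
        case False
        then have "\<eta> < \<eta>'" using \<eta> by simp
        have "\<exists>z. z > \<eta> \<and> z < \<eta>' \<and> cos_kernel \<eta>' x - cos_kernel \<eta> x = (\<eta>' - \<eta>) * (- ln x * cos_kernel z x)"
          by (rule MVT2[OF \<open>\<eta> < \<eta>'\<close>]) (use x0 in \<open>auto simp: cos_kernel_def intro!: derivative_eq_intros\<close>)
        then show ?thesis by (metis atLeastAtMost_iff less_imp_le)
      qed auto
      then obtain z where z: "z \<in> {\<eta>..\<eta>'}" "cos_kernel \<eta>' x - cos_kernel \<eta> x = (\<eta>' - \<eta>) * (- ln x * cos_kernel z x)"
        by blast
      have "\<bar>ln x\<bar> * cos_kernel z x \<le> B x"
      proof (cases "x \<le> 1")
        case True
        have "\<bar>ln x\<bar> * cos_kernel z x \<le> (x powr - \<delta> / \<delta>) * x powr (- z - 1 + 2)"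
          using abs_ln_le_powr[OF x0 \<delta>(1)] cos_kernel_le[OF x0, of "- z - 1"] True \<delta>
          by (intro mult_mono) (auto simp: cos_kernel_def)
        also have "\<dots> = x powr (1 - z - \<delta>) / \<delta>"
          using x0 by (simp add: powr_add[symmetric] algebra_simps)
        also have "\<dots> \<le> x powr (1 - d - \<delta>) / \<delta>"
          using True x0 z \<eta> \<delta> by (intro divide_right_mono powr_mono') auto
        finally show ?thesis using True by (simp add: B_def cos_kernel_bound_def)
      next
        case False
        have "\<bar>ln x\<bar> * cos_kernel z x \<le> (x powr \<delta> / \<delta>) * (2 * x powr (- z - 1))"
          using abs_ln_le_powr[OF x0 \<delta>(1)] cos_kernel_le[OF x0, of "- z - 1"] False \<delta>
          by (intro mult_mono) (auto simp: cos_kernel_def)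
        also have "\<dots> = 2 * x powr (- z - 1 + \<delta>) / \<delta>"
          using x0 by (simp add: powr_add[symmetric] algebra_simps)
        also have "\<dots> \<le> 2 * x powr (- c - 1 + \<delta>) / \<delta>"
          using False x0 z \<eta> \<delta> by (intro divide_right_mono mult_left_mono powr_mono) auto
        finally show ?thesis using False by (simp add: B_def cos_kernel_bound_def)
      qed
      then have "\<bar>\<eta>' - \<eta>\<bar> * (\<bar>ln x\<bar> * cos_kernel z x) \<le> \<bar>\<eta>' - \<eta>\<bar> * B x"
        by (intro mult_left_mono) auto
      then show ?thesis
        using z(2) cos_kernel_nonneg[of z x]
        by (simp add: abs_mult abs_minus_commute[of "cos_kernel \<eta> x"] abs_minus_commute[of \<eta>])
    qed (simp add: cos_kernel_def B_def cos_kernel_bound_def)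
    have main: "\<bar>cos_integral \<eta> - cos_integral \<eta>'\<bar> \<le> integral {0..} B * \<bar>\<eta> - \<eta>'\<bar>"
      if \<eta>: "c \<le> \<eta>" "\<eta> \<le> \<eta>'" "\<eta>' \<le> d" for \<eta> \<eta>'
    proof -
      have int: "cos_kernel \<eta> integrable_on {0..}" "cos_kernel \<eta>' integrable_on {0..}"
        using \<eta> assms by (auto intro: cos_kernel_integrable)
      have "norm (integral {0..} (\<lambda>x. cos_kernel \<eta> x - cos_kernel \<eta>' x)) \<le> integral {0..} (\<lambda>x. \<bar>\<eta> - \<eta>'\<bar> * B x)"
        using key[OF \<eta>] int intB
        by (intro integral_norm_bound_integral integrable_diff integrable_on_mult_right) auto
      then show ?thesis
        using int by (simp add: cos_integral_def integral_diff mult.commute)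
    qed
    have "0 \<le> integral {0..} B"
      by (rule integral_nonneg[OF intB]) (use \<delta> in \<open>auto simp: B_def cos_kernel_bound_def\<close>)
    then have "(integral {0..} B)-lipschitz_on {c..d} cos_integral"
    proof (rule lipschitz_onI[rotated])
      fix x y assume "x \<in> {c..d}" "y \<in> {c..d}"
      then show "dist (cos_integral x) (cos_integral y) \<le> integral {0..} B * dist x y"
        using main[of x y] main[of y x] by (cases "x \<le> y") (auto simp: dist_real_def abs_minus_commute)
    qed
    then show ?thesis ..
  qed (auto intro!: exI[of _ 0])
qed

lemma lipschitz_on_Icc_bounded:
  fixes f :: "real \<Rightarrow> real"
  assumes "\<exists>L. L-lipschitz_on {c..d} f"
  obtains A where "\<And>x. x \<in> {c..d} \<Longrightarrow> \<bar>f x\<bar> \<le> A"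
proof -
  have "bounded (f ` {c..d})"
    using assms lipschitz_on_continuous_on compact_continuous_image compact_imp_bounded compact_Icc by metis
  then obtain A where "\<forall>x\<in>{c..d}. \<bar>f x\<bar> \<le> A"
    unfolding bounded_iff by auto
  then show thesis using that by blast
qed

lemma lipschitz_on_mult_real:
  fixes f g :: "real \<Rightarrow> real"
  assumes "\<exists>L. L-lipschitz_on {c..d} f" "\<exists>L. L-lipschitz_on {c..d} g"
  shows "\<exists>L. L-lipschitz_on {c..d} (\<lambda>x. f x * g x)"
proof -
  obtain L1 L2 where L: "L1-lipschitz_on {c..d} f" "L2-lipschitz_on {c..d} g" using assms by blast
  obtain A B where AB: "\<And>x. x \<in> {c..d} \<Longrightarrow> \<bar>f x\<bar> \<le> A" "\<And>x. x \<in> {c..d} \<Longrightarrow> \<bar>g x\<bar> \<le> B"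
    using assms by (metis lipschitz_on_Icc_bounded)
  have "(\<bar>A\<bar> * L2 + \<bar>B\<bar> * L1)-lipschitz_on {c..d} (\<lambda>x. f x * g x)"
  proof (rule lipschitz_onI)
    fix x y assume xy: "x \<in> {c..d}" "y \<in> {c..d}"
    have "f x * g x - f y * g y = f x * (g x - g y) + g y * (f x - f y)" by (simp add: algebra_simps)
    then have "\<bar>f x * g x - f y * g y\<bar> \<le> \<bar>f x\<bar> * \<bar>g x - g y\<bar> + \<bar>g y\<bar> * \<bar>f x - f y\<bar>"
      by (metis abs_mult abs_triangle_ineq)
    also have "\<dots> \<le> \<bar>A\<bar> * (L2 * \<bar>x - y\<bar>) + \<bar>B\<bar> * (L1 * \<bar>x - y\<bar>)"
      using AB[OF xy(1)] AB[OF xy(2)] lipschitz_onD[OF L(1) xy] lipschitz_onD[OF L(2) xy]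
      by (intro add_mono mult_mono) (auto simp: dist_real_def)
    finally show "dist (f x * g x) (f y * g y) \<le> (\<bar>A\<bar> * L2 + \<bar>B\<bar> * L1) * dist x y"
      by (simp add: dist_real_def algebra_simps)
  qed (use L[THEN lipschitz_on_nonneg] in simp)
  then show ?thesis ..
qed

lemma lipschitz_on_C1_compose:
  fixes f g g' :: "real \<Rightarrow> real"
  assumes "\<exists>L. L-lipschitz_on {c..d} f" "f ` {c..d} \<subseteq> {m..M}"
    and "\<And>x. x \<in> {m..M} \<Longrightarrow> (g has_real_derivative g' x) (at x)" "continuous_on {m..M} g'"
  shows "\<exists>L. L-lipschitz_on {c..d} (\<lambda>x. g (f x))"
proof -
  obtain L1 where L: "L1-lipschitz_on {c..d} f" using assms by blast
  have "bounded (g' ` {m..M})"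
    using assms(4) compact_continuous_image compact_imp_bounded compact_Icc by metis
  then obtain A where A: "\<bar>g' x\<bar> \<le> A" if "x \<in> {m..M}" for x
    unfolding bounded_iff by (metis imageI real_norm_def)
  have "\<bar>A\<bar>-lipschitz_on {m..M} g"
  proof (rule bounded_derivative_imp_lipschitz)
    show "(g has_derivative (\<lambda>h. g' x * h)) (at x within {m..M})" if "x \<in> {m..M}" for x
      using assms(3)[OF that] by (simp add: has_field_derivative_def has_derivative_at_withinI)
    show "onorm (\<lambda>h. g' x * h) \<le> \<bar>A\<bar>" if "x \<in> {m..M}" for x
      using A[OF that] by (intro onorm_le) (auto simp: abs_mult intro!: mult_right_mono)
  qed auto
  then have "\<bar>A\<bar>-lipschitz_on (f ` {c..d}) g" using assms(2) by (rule lipschitz_on_subset)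
  from lipschitz_on_compose2[OF L this] show ?thesis by blast
qed

lemma stable_const_pos:
  assumes "0 < \<eta>" "\<eta> < 2"
  shows "0 < stable_const \<eta>"
  using cos_integral_ge[OF assms] one_minus_cos_1_pos assms by (simp add: stable_const_eq)

text \<open>The function is the exponential of (- ln \<eta> - ln
  (\<open>cos_integral \<eta>\<close>)) / \<eta>. Sums, products and smooth images of Lipschitz
  functions on a compact interval are Lipschitz, and the uniform lower bound of
  \<open>cos_integral\<close> makes the logarithm admissible.\<close>

lemma stable_const_powr_lipschitz:
  assumes "0 < c" "d < 2"
  shows "\<exists>L. L-lipschitz_on {c..d} (\<lambda>\<eta>. stable_const \<eta> powr (1 / \<eta>))"
proof -
  define m where "m = (1 - cos (1::real)) / 8"
  have m: "0 < m" using one_minus_cos_1_pos by (simp add: m_def)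
  have "\<exists>L. L-lipschitz_on {c..d} cos_integral" using assms by (rule cos_integral_lipschitz)
  then obtain A where A: "\<And>x. x \<in> {c..d} \<Longrightarrow> \<bar>cos_integral x\<bar> \<le> A"
    by (metis lipschitz_on_Icc_bounded)
  have lnJ: "\<exists>L. L-lipschitz_on {c..d} (\<lambda>x. - ln (cos_integral x))"
  proof (rule lipschitz_on_C1_compose[where g = "\<lambda>y. - ln y" and g' = "\<lambda>y. - inverse y" and m = m and M = A])
    show "cos_integral ` {c..d} \<subseteq> {m..A}"
      using A cos_integral_ge assms unfolding m_def by force
  qed (use m assms cos_integral_lipschitz in \<open>auto intro!: derivative_eq_intros continuous_intros simp: inverse_eq_divide\<close>)
  have id: "\<exists>L. L-lipschitz_on {c..d} (\<lambda>x::real. x)" by (auto intro: lipschitz_intros)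
  have lnid: "\<exists>L. L-lipschitz_on {c..d} (\<lambda>x. - ln x)"
    by (rule lipschitz_on_C1_compose[OF id, where g = "\<lambda>y. - ln y" and g' = "\<lambda>y. - inverse y" and m = c and M = d])
       (use assms in \<open>auto intro!: derivative_eq_intros continuous_intros simp: inverse_eq_divide\<close>)
  have inv: "\<exists>L. L-lipschitz_on {c..d} (\<lambda>x. inverse x)"
    by (rule lipschitz_on_C1_compose[OF id, where g = inverse and g' = "\<lambda>y. - (inverse y * inverse y)" and m = c and M = d])
       (use assms in \<open>auto intro!: derivative_eq_intros continuous_intros simp: power2_eq_square\<close>)
  define \<phi> where "\<phi> x = inverse x * (- ln x + - ln (cos_integral x))" for x
  obtain L1 L2 where "L1-lipschitz_on {c..d} (\<lambda>x. - ln x)" "L2-lipschitz_on {c..d} (\<lambda>x. - ln (cos_integral x))"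
    using lnJ lnid by blast
  from lipschitz_on_add[OF this] have \<phi>: "\<exists>L. L-lipschitz_on {c..d} \<phi>"
    unfolding \<phi>_def by (intro lipschitz_on_mult_real[OF inv]) blast
  then obtain P where P: "\<And>x. x \<in> {c..d} \<Longrightarrow> \<bar>\<phi> x\<bar> \<le> P"
    by (metis lipschitz_on_Icc_bounded)
  have "\<exists>L. L-lipschitz_on {c..d} (\<lambda>x. exp (\<phi> x))"
    by (rule lipschitz_on_C1_compose[OF \<phi>, where g = exp and g' = exp and m = "- P" and M = P])
       (use P in \<open>fastforce intro!: derivative_eq_intros continuous_intros\<close>)+
  moreover have "exp (\<phi> x) = stable_const x powr (1 / x)" if "x \<in> {c..d}" for x
  proof -
    have x: "0 < x" "x < 2" using that assms by auto
    have J: "0 < cos_integral x" using cos_integral_ge[OF x] m by (simp add: m_def)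
    show ?thesis
      using x J stable_const_pos[OF x]
      by (simp add: powr_def \<phi>_def stable_const_eq ln_mult ln_inverse divide_inverse algebra_simps)
  qed
  ultimately show ?thesis
    using lipschitz_on_transform by (metis (no_types, lifting))
qed

subsection \<open>Difference quotients of powers\<close>

text \<open>The divided difference in the exponent z of \<open>x powr - z\<close>. Its diagonal
  value is the derivative, so sequences of exponents tending to \<open>\<tau>\<close> and to other
  limits can be treated together.\<close>

definition powr_quotient :: "real \<Rightarrow> real \<Rightarrow> real \<Rightarrow> real" where
  "powr_quotient \<theta> \<tau> x =
     (if \<theta> = \<tau> then - (x powr - \<tau> * ln x) else (x powr - \<theta> - x powr - \<tau>) / (\<theta> - \<tau>))"

lemma difference_quotient_eq_deriv:
  fixes f :: "real \<Rightarrow> real"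
  assumes "\<theta> \<in> {a..b}" "\<tau> \<in> {a..b}" "\<theta> \<noteq> \<tau>"
    and "\<And>z. z \<in> {a..b} \<Longrightarrow> (f has_real_derivative f' z) (at z)"
  shows "\<exists>z\<in>{a..b}. (f \<theta> - f \<tau>) / (\<theta> - \<tau>) = f' z"
proof (cases "\<theta> < \<tau>")
  case True
  have "\<exists>z. \<theta> < z \<and> z < \<tau> \<and> f \<tau> - f \<theta> = (\<tau> - \<theta>) * f' z"
    using True assms by (intro MVT2) auto
  then obtain z where "\<theta> < z" "z < \<tau>" "f \<tau> - f \<theta> = (\<tau> - \<theta>) * f' z" by blast
  then show ?thesis using assms True by (intro bexI[of _ z]) (auto simp: field_simps)
next
  case False
  then have "\<tau> < \<theta>" using assms by simp
  have "\<exists>z. \<tau> < z \<and> z < \<theta> \<and> f \<theta> - f \<tau> = (\<theta> - \<tau>) * f' z"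
    using \<open>\<tau> < \<theta>\<close> assms by (intro MVT2) auto
  then obtain z where "\<tau> < z" "z < \<theta>" "f \<theta> - f \<tau> = (\<theta> - \<tau>) * f' z" by blast
  then show ?thesis using assms \<open>\<tau> < \<theta>\<close> by (intro bexI[of _ z]) (auto simp: field_simps)
qed

text \<open>The gap between \<open>\<sigma>\<close> and \<open>a\<close> pays for the logarithm: for
  z in {a..b} both z - \<delta> and z + \<delta> still lie between \<sigma> and b + \<delta>, and
  |ln x| is bounded by powers of order \<delta>.\<close>

lemma powr_uniform_bounds:
  fixes x0 a b \<sigma> :: real
  assumes "0 < x0" "\<sigma> < a"
  obtains B where "0 \<le> B" "\<And>z x. z \<in> {a..b} \<Longrightarrow> x0 \<le> x \<Longrightarrow> x powr - z \<le> B * x powr - \<sigma>"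
    "\<And>z x. z \<in> {a..b} \<Longrightarrow> x0 \<le> x \<Longrightarrow> x powr - z * \<bar>ln x\<bar> \<le> B * x powr - \<sigma>"
proof -
  define \<delta> where "\<delta> = a - \<sigma>"
  have \<delta>: "0 < \<delta>" using assms by (simp add: \<delta>_def)
  \<comment> \<open>For x at least 1 a nonpositive power is at most 1. Below 1 the worst case is the
    largest exponent at the smallest argument \<open>x0\<close>.\<close>
  define A where "A = max 1 (x0 powr - (b + \<delta> - \<sigma>))"
  have 1: "x powr - z \<le> A * x powr - \<sigma>" if z: "\<sigma> \<le> z" "z \<le> b + \<delta>" and x: "x0 \<le> x" for z x
  proof -
    have x': "0 < x" using x assms by simp
    have "x powr - (z - \<sigma>) \<le> A"
    proof (cases "1 \<le> x")
      case True
      have "x powr - (z - \<sigma>) \<le> x powr 0" using True z by (intro powr_mono) auto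
      then show ?thesis using x' by (auto simp: A_def)
    next
      case False
      have "x powr - (z - \<sigma>) \<le> x powr - (b + \<delta> - \<sigma>)" using False x' z by (intro powr_mono') auto
      also have "\<dots> \<le> x0 powr - (b + \<delta> - \<sigma>)" using x assms z by (intro powr_mono2') auto
      finally show ?thesis by (simp add: A_def)
    qed
    then have "x powr - (z - \<sigma>) * x powr - \<sigma> \<le> A * x powr - \<sigma>" by (intro mult_right_mono) auto
    then show ?thesis by (simp add: powr_add[symmetric])
  qed
  have 2: "x powr - z * \<bar>ln x\<bar> \<le> 2 * A / \<delta> * x powr - \<sigma>" if z: "z \<in> {a..b}" and x: "x0 \<le> x" for z x
  proof -
    have x': "0 < x" using x assms by simp
    have "\<bar>ln x\<bar> \<le> (if x \<le> 1 then x powr - \<delta> else x powr \<delta>) / \<delta>" using x' \<delta> by (rule abs_ln_le_powr)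
    also have "\<dots> \<le> (x powr - \<delta> + x powr \<delta>) / \<delta>" using \<delta> by (intro divide_right_mono) auto
    finally have "x powr - z * \<bar>ln x\<bar> \<le> x powr - z * ((x powr - \<delta> + x powr \<delta>) / \<delta>)" by (intro mult_left_mono) auto
    also have "\<dots> = (x powr - (z + \<delta>) + x powr - (z - \<delta>)) / \<delta>"
      by (simp add: distrib_left powr_add[symmetric] algebra_simps)
    also have "\<dots> \<le> (A * x powr - \<sigma> + A * x powr - \<sigma>) / \<delta>"
      using z x \<delta> by (intro divide_right_mono add_mono 1) (auto simp: \<delta>_def)
    finally show ?thesis by simp
  qed
  define B where "B = max A (2 * A / \<delta>)"
  have B: "A \<le> B" "2 * A / \<delta> \<le> B" "0 \<le> B" by (auto simp: A_def B_def)
  show thesis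
  proof (rule that[OF B(3)])
    fix z x assume z: "z \<in> {a..b}" and x: "x0 \<le> x"
    have "x powr - z \<le> A * x powr - \<sigma>" using z x \<delta> by (intro 1) (auto simp: \<delta>_def)
    also have "\<dots> \<le> B * x powr - \<sigma>" using B(1) by (rule mult_right_mono) simp
    finally show "x powr - z \<le> B * x powr - \<sigma>" .
    have "2 * A / \<delta> * x powr - \<sigma> \<le> B * x powr - \<sigma>" using B(2) by (rule mult_right_mono) simp
    with 2[OF z x] show "x powr - z * \<bar>ln x\<bar> \<le> B * x powr - \<sigma>" by linarith
  qed
qed

text \<open>By the mean value theorem in the exponent, the quotient and its derivative in x are
  values of exponent-derivatives at an intermediate point; these are bounded uniformly, whether or
  not the two exponents coincide.\<close>

lemma powr_quotient_bounds:
  fixes x0 a b \<sigma> :: real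
  assumes "0 < x0" "0 < \<sigma>" "\<sigma> < a"
  obtains B where "0 \<le> B"
    "\<And>\<theta> \<tau> x. \<theta> \<in> {a..b} \<Longrightarrow> \<tau> \<in> {a..b} \<Longrightarrow> x0 \<le> x \<Longrightarrow> \<bar>powr_quotient \<theta> \<tau> x\<bar> \<le> B * x powr - \<sigma>"
    "\<And>\<theta> \<tau> x y. \<theta> \<in> {a..b} \<Longrightarrow> \<tau> \<in> {a..b} \<Longrightarrow> x0 \<le> x \<Longrightarrow> x \<le> y \<Longrightarrow>
       \<bar>powr_quotient \<theta> \<tau> x - powr_quotient \<theta> \<tau> y\<bar> \<le> B * (x powr - \<sigma> - y powr - \<sigma>)"
proof -
  obtain B where B: "0 \<le> B" "\<And>z x. z \<in> {a..b} \<Longrightarrow> x0 \<le> x \<Longrightarrow> x powr - z \<le> B * x powr - \<sigma>"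
    "\<And>z x. z \<in> {a..b} \<Longrightarrow> x0 \<le> x \<Longrightarrow> x powr - z * \<bar>ln x\<bar> \<le> B * x powr - \<sigma>"
    using powr_uniform_bounds[OF assms(1,3)] by blast
  \<comment> \<open>The first entry serves the values. The second places the derivative bound
    \<open>B * (1 + \<bar>b\<bar>)\<close> below \<open>C * \<sigma>\<close>, the form that
    \<open>powr_decrement_dominates\<close> expects.\<close>
  define C where "C = max B (B * (1 + \<bar>b\<bar>) / \<sigma>)"
  have C: "B \<le> C" "B * (1 + \<bar>b\<bar>) \<le> C * \<sigma>"
  proof -
    show "B \<le> C" by (simp add: C_def)
    have "B * (1 + \<bar>b\<bar>) / \<sigma> \<le> C" by (simp add: C_def)
    then show "B * (1 + \<bar>b\<bar>) \<le> C * \<sigma>" using assms by (simp add: pos_divide_le_eq)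
  qed
  show thesis
  proof (rule that)
    show "0 \<le> C" using B(1) C(1) by simp
    fix \<theta> \<tau> assume th: "\<theta> \<in> {a..b}" "\<tau> \<in> {a..b}"
    show "\<bar>powr_quotient \<theta> \<tau> x\<bar> \<le> C * x powr - \<sigma>" if x: "x0 \<le> x" for x
    proof -
      have x': "0 < x" using x assms by simp
      have "\<exists>z\<in>{a..b}. powr_quotient \<theta> \<tau> x = - (x powr - z * ln x)"
      proof (cases "\<theta> = \<tau>")
        case False
        have "\<exists>z\<in>{a..b}. (x powr - \<theta> - x powr - \<tau>) / (\<theta> - \<tau>) = - (x powr - z * ln x)"
          by (rule difference_quotient_eq_deriv[OF th False]) (use x' in \<open>auto intro!: derivative_eq_intros\<close>)
        then show ?thesis using False by (simp add: powr_quotient_def)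
      qed (use th in \<open>auto simp: powr_quotient_def\<close>)
      then obtain z where z: "z \<in> {a..b}" "powr_quotient \<theta> \<tau> x = - (x powr - z * ln x)" by blast
      have "\<bar>powr_quotient \<theta> \<tau> x\<bar> \<le> B * x powr - \<sigma>"
        using B(3)[OF z(1) x] by (simp add: z(2) abs_mult)
      also have "\<dots> \<le> C * x powr - \<sigma>" using C(1) by (intro mult_right_mono) auto
      finally show ?thesis .
    qed
    fix x y assume xy: "x0 \<le> x" "x \<le> y"
    \<comment> \<open>The mixed derivative of \<open>x powr - z\<close> in z and x.\<close>
    let ?\<phi> = "\<lambda>z x. z * x powr (- z - 1) * ln x - x powr (- z - 1)"
    define g' where "g' x = (if \<theta> = \<tau> then ?\<phi> \<tau> x
      else (- \<theta> * x powr (- \<theta> - 1) - - \<tau> * x powr (- \<tau> - 1)) / (\<theta> - \<tau>))" for x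
    show "\<bar>powr_quotient \<theta> \<tau> x - powr_quotient \<theta> \<tau> y\<bar> \<le> C * (x powr - \<sigma> - y powr - \<sigma>)"
    proof (rule powr_decrement_dominates[OF _ _ assms(1) xy])
      fix x assume x: "x0 \<le> x"
      have x': "0 < x" using x assms by simp
      show "(powr_quotient \<theta> \<tau> has_real_derivative g' x) (at x)"
      proof (cases "\<theta> = \<tau>")
        case True
        have "((\<lambda>x. - (x powr - \<tau> * ln x)) has_real_derivative ?\<phi> \<tau> x) (at x)"
          using x' by (auto intro!: derivative_eq_intros simp: powr_diff powr_minus field_simps)
        moreover have "powr_quotient \<theta> \<tau> = (\<lambda>x. - (x powr - \<tau> * ln x))"
          using True by (simp add: powr_quotient_def fun_eq_iff)
        ultimately show ?thesis using True by (simp add: g'_def)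
      next
        case False
        have "((\<lambda>x. (x powr - \<theta> - x powr - \<tau>) / (\<theta> - \<tau>)) has_real_derivative g' x) (at x)"
          unfolding g'_def using x' False
          by (auto intro!: derivative_eq_intros)
        moreover have "powr_quotient \<theta> \<tau> = (\<lambda>x. (x powr - \<theta> - x powr - \<tau>) / (\<theta> - \<tau>))"
          using False by (simp add: powr_quotient_def fun_eq_iff)
        ultimately show ?thesis by simp
      qed
      have "\<exists>z\<in>{a..b}. g' x = ?\<phi> z x"
      proof (cases "\<theta> = \<tau>")
        case False
        have "\<exists>z\<in>{a..b}. (- \<theta> * x powr (- \<theta> - 1) - - \<tau> * x powr (- \<tau> - 1)) / (\<theta> - \<tau>) = ?\<phi> z x"
          by (rule difference_quotient_eq_deriv[OF th False, where f = "\<lambda>z. - z * x powr (- z - 1)"])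
             (use x' in \<open>auto intro!: derivative_eq_intros\<close>)
        then show ?thesis using False by (simp add: g'_def)
      qed (use th in \<open>auto simp: g'_def\<close>)
      then obtain z where z: "z \<in> {a..b}" "g' x = ?\<phi> z x" by blast
      have eq: "x powr (- r - 1) = x powr - r * x powr - 1" for r
        using x' by (simp add: powr_diff)
      have zb: "\<bar>z\<bar> \<le> \<bar>b\<bar>" using z assms by auto
      have "\<bar>g' x\<bar> \<le> \<bar>z * x powr (- z - 1) * ln x\<bar> + \<bar>x powr (- z - 1)\<bar>"
        unfolding z(2) by (rule abs_triangle_ineq4)
      also have "\<dots> = (\<bar>z\<bar> * (x powr - z * \<bar>ln x\<bar>) + x powr - z) * x powr - 1"
        unfolding eq by (simp add: abs_mult algebra_simps)
      also have "\<dots> \<le> (\<bar>b\<bar> * (B * x powr - \<sigma>) + B * x powr - \<sigma>) * x powr - 1"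
        using mult_mono[OF zb B(3)[OF z(1) x]] B(2)[OF z(1) x]
        by (intro mult_right_mono[OF add_mono]) auto
      also have "\<dots> = (B * (1 + \<bar>b\<bar>)) * x powr (- \<sigma> - 1)"
        unfolding eq by (simp add: algebra_simps add_divide_distrib)
      also have "\<dots> \<le> (C * \<sigma>) * x powr (- \<sigma> - 1)" using C(2) by (intro mult_right_mono) auto
      finally show "\<bar>g' x\<bar> \<le> C * (\<sigma> * x powr (- \<sigma> - 1))" by (simp add: mult.assoc)
    qed
  qed
qed

lemma (in abel_weights) slowly_varying_powr_quotient:
  assumes "0 < \<sigma>" "\<sigma> < a"
  obtains B where "0 \<le> B"
    "\<And>\<theta> \<tau>. \<theta> \<in> {a..b} \<Longrightarrow> \<tau> \<in> {a..b} \<Longrightarrow> slowly_varying B (\<lambda>i. powr_quotient \<theta> \<tau> (G i))"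
proof -
  obtain B where B: "0 \<le> B"
    "\<And>\<theta> \<tau> x. \<theta> \<in> {a..b} \<Longrightarrow> \<tau> \<in> {a..b} \<Longrightarrow> G 0 \<le> x \<Longrightarrow> \<bar>powr_quotient \<theta> \<tau> x\<bar> \<le> B * x powr - \<sigma>"
    "\<And>\<theta> \<tau> x y. \<theta> \<in> {a..b} \<Longrightarrow> \<tau> \<in> {a..b} \<Longrightarrow> G 0 \<le> x \<Longrightarrow> x \<le> y \<Longrightarrow>
       \<bar>powr_quotient \<theta> \<tau> x - powr_quotient \<theta> \<tau> y\<bar> \<le> B * (x powr - \<sigma> - y powr - \<sigma>)"
    using powr_quotient_bounds[OF G_pos[of 0] assms, of b] by metis
  have "slowly_varying B (\<lambda>i. powr_quotient \<theta> \<tau> (G i))" if "\<theta> \<in> {a..b}" "\<tau> \<in> {a..b}" for \<theta> \<tau>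
    unfolding slowly_varying_def using B(2,3)[OF that] G_mono[of 0] mono_G by auto
  with B(1) show thesis by (rule that)
qed

lemma powr_quotient_tendsto:
  assumes "0 < x" and lim: "\<theta> \<longlonglongrightarrow> \<theta>'" and ne: "\<And>n. \<theta> n \<noteq> \<tau>"
  shows "(\<lambda>n. powr_quotient (\<theta> n) \<tau> x) \<longlonglongrightarrow> powr_quotient \<theta>' \<tau> x"
proof (cases "\<theta>' = \<tau>")
  case True
  have "((\<lambda>z. x powr - z) has_real_derivative - (x powr - \<tau> * ln x)) (at \<tau>)"
    using assms(1) by (auto intro!: derivative_eq_intros)
  then have "((\<lambda>z. (x powr - z - x powr - \<tau>) / (z - \<tau>)) \<longlongrightarrow> - (x powr - \<tau> * ln x)) (at \<tau>)"
    by (simp add: has_field_derivative_iff)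
  moreover have "filterlim \<theta> (at \<tau>) sequentially"
    using lim ne True by (simp add: filterlim_at)
  ultimately have "(\<lambda>n. (x powr - \<theta> n - x powr - \<tau>) / (\<theta> n - \<tau>)) \<longlonglongrightarrow> - (x powr - \<tau> * ln x)"
    by (rule filterlim_compose)
  then show ?thesis using ne True by (simp add: powr_quotient_def)
next
  case False
  have "(\<lambda>n. (x powr - \<theta> n - x powr - \<tau>) / (\<theta> n - \<tau>)) \<longlonglongrightarrow> (x powr - \<theta>' - x powr - \<tau>) / (\<theta>' - \<tau>)"
    using False assms(1) by (intro tendsto_intros lim) auto
  then show ?thesis using ne False by (simp add: powr_quotient_def)
qed

section \<open>Eventual injectivity of the absolute value of the limiting coefficient\<close>

lemma inj_on_abs_if_deriv_pos:
  fixes h h' :: "real \<Rightarrow> real"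
  assumes "\<forall>\<^sub>F x in at_top. (h has_real_derivative h' x) (at x) \<and> 0 < h' x" and lim: "(h \<longlongrightarrow> 0) at_top"
  shows "\<exists>x0. inj_on (\<lambda>x. \<bar>h x\<bar>) {x0..}"
proof -
  obtain x0 where x0: "\<And>x. x0 \<le> x \<Longrightarrow> (h has_real_derivative h' x) (at x) \<and> 0 < h' x"
    using assms(1) unfolding eventually_at_top_linorder by blast
  have mono: "h x < h y" if "x0 \<le> x" "x < y" for x y
    by (rule DERIV_pos_imp_increasing[OF that(2)]) (use x0 that in \<open>meson order_trans\<close>)
  \<comment> \<open>An increasing function with limit 0 stays negative, so its absolute value is
    strictly decreasing.\<close>
  have neg: "h x < 0" if x: "x0 \<le> x" for x
  proof -
    have "h (x + 1) \<le> 0"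
      by (rule tendsto_lowerbound[OF lim eventually_at_top_linorderI[of "x + 1"]])
         (use mono[of "x + 1"] x in \<open>auto simp: le_less\<close>)
    then show ?thesis using mono[of x "x + 1"] x by simp
  qed
  show ?thesis
  proof (intro exI inj_onI)
    fix x y assume "x \<in> {x0..}" "y \<in> {x0..}" "\<bar>h x\<bar> = \<bar>h y\<bar>"
    then show "x = y" using neg[of x] neg[of y] mono[of x y] mono[of y x]
      by (cases x y rule: linorder_cases) auto
  qed
qed

text \<open>For large x the term with the smaller exponent governs the sign of the derivative.
  Changing the overall sign or exchanging the two terms reduces everything to a negative leading
  coefficient.\<close>

lemma inj_on_abs_powr_combination:
  fixes A B p q :: real
  assumes "A \<noteq> 0" "p \<noteq> q" "0 < p" "0 < q"
  shows "\<exists>x0. inj_on (\<lambda>x. \<bar>A * x powr - p + B * x powr - q\<bar>) {x0..}"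
proof -
  have main: "\<exists>x0. inj_on (\<lambda>x. \<bar>A * x powr - p + B * x powr - q\<bar>) {x0..}"
    if A: "A < 0" and B: "B = 0 \<or> p < q" and pq: "0 < p" "0 < q" for A B p q :: real
  proof (rule inj_on_abs_if_deriv_pos)
    let ?h' = "\<lambda>x. x powr (- p - 1) * (- A * p - B * q * x powr (p - q))"
    have "((\<lambda>x. - A * p - B * q * x powr (p - q)) \<longlongrightarrow> - A * p) at_top"
    proof (cases "B = 0")
      case False
      then have "((\<lambda>x. x powr (p - q)) \<longlongrightarrow> 0) at_top"
        using B by (intro tendsto_neg_powr filterlim_ident) auto
      from tendsto_diff[OF tendsto_const tendsto_mult[OF tendsto_const this], of "- A * p" "B * q"]
      show ?thesis by simp
    qed simp
    moreover have "0 < - A * p" using A pq by (simp add: mult_neg_pos)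
    ultimately have "\<forall>\<^sub>F x in at_top. 0 < - A * p - B * q * x powr (p - q)"
      by (intro order_tendstoD(1)) auto
    then show "\<forall>\<^sub>F x in at_top. ((\<lambda>x. A * x powr - p + B * x powr - q) has_real_derivative ?h' x) (at x) \<and> 0 < ?h' x"
      using eventually_gt_at_top[of 0]
    proof eventually_elim
      case (elim x)
      have "((\<lambda>x. A * x powr - p + B * x powr - q) has_real_derivative ?h' x) (at x)"
        using elim(2) by (auto intro!: derivative_eq_intros simp: algebra_simps powr_add[symmetric])
      then show ?case using elim by simp
    qed
    have "((\<lambda>x. A * x powr - p + B * x powr - q) \<longlongrightarrow> A * 0 + B * 0) at_top"
      using pq by (intro tendsto_intros tendsto_neg_powr filterlim_ident) auto
    then show "((\<lambda>x. A * x powr - p + B * x powr - q) \<longlongrightarrow> 0) at_top" by simp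
  qed
  have pm: "\<exists>x0. inj_on (\<lambda>x. \<bar>A * x powr - p + B * x powr - q\<bar>) {x0..}"
    if "A \<noteq> 0" "B = 0 \<or> p < q" "0 < p" "0 < q" for A B p q :: real
  proof (cases "A < 0")
    case False
    have "\<bar>- A * x powr - p + - B * x powr - q\<bar> = \<bar>A * x powr - p + B * x powr - q\<bar>" for x
      using abs_minus_cancel[of "A * x powr - p + B * x powr - q"] by simp
    with main[of "- A" "- B" p q] False that show ?thesis by simp
  qed (use main that in blast)
  show ?thesis
  proof (cases "B = 0 \<or> p < q")
    case False
    then show ?thesis using pm[of B A q p] assms by (simp add: add.commute)
  qed (use pm assms in blast)
qed

lemma inj_on_abs_powr_ln_combination:
  fixes A B q :: real
  assumes "A \<noteq> 0" "0 < q"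
  shows "\<exists>x0. inj_on (\<lambda>x. \<bar>A * (x powr - q * ln x) + B * x powr - q\<bar>) {x0..}"
proof -
  have main: "\<exists>x0. inj_on (\<lambda>x. \<bar>A * (x powr - q * ln x) + B * x powr - q\<bar>) {x0..}" if A: "A < 0" for A B :: real
  proof (rule inj_on_abs_if_deriv_pos)
    let ?h' = "\<lambda>x. x powr (- q - 1) * (A - B * q + (- A * q) * ln x)"
    have "0 < - A * q" using A assms by (simp add: mult_neg_pos)
    then have "filterlim (\<lambda>x. A - B * q + (- A * q) * ln x) at_top at_top"
      by (intro filterlim_tendsto_add_at_top[OF tendsto_const] filterlim_tendsto_pos_mult_at_top[OF tendsto_const _ ln_at_top])
    then have "\<forall>\<^sub>F x in at_top. 0 < A - B * q + (- A * q) * ln x"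
      unfolding filterlim_at_top_dense by blast
    then show "\<forall>\<^sub>F x in at_top. ((\<lambda>x. A * (x powr - q * ln x) + B * x powr - q) has_real_derivative ?h' x) (at x) \<and> 0 < ?h' x"
      using eventually_gt_at_top[of 0]
    proof eventually_elim
      case (elim x)
      have eq: "x powr (- q - 1) = x powr - q / x" using elim by (simp add: powr_diff)
      have "((\<lambda>x. A * (x powr - q * ln x) + B * x powr - q) has_real_derivative ?h' x) (at x)"
        using elim by (auto intro!: derivative_eq_intros simp: eq algebra_simps add_divide_distrib diff_divide_distrib)
      then show ?case using elim by simp
    qed
    have "((\<lambda>x. x powr - q * ln x) \<longlongrightarrow> 0) at_top"
      using lim_ln_over_power assms
      by real_asymp
    then have "((\<lambda>x. A * (x powr - q * ln x) + B * x powr - q) \<longlongrightarrow> A * 0 + B * 0) at_top"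
      using assms by (intro tendsto_intros tendsto_neg_powr filterlim_ident) auto
    then show "((\<lambda>x. A * (x powr - q * ln x) + B * x powr - q) \<longlongrightarrow> 0) at_top" by simp
  qed
  show ?thesis
  proof (cases "A < 0")
    case False
    have "\<bar>- A * (x powr - q * ln x) + - B * x powr - q\<bar> = \<bar>A * (x powr - q * ln x) + B * x powr - q\<bar>" for x
      using abs_minus_cancel[of "A * (x powr - q * ln x) + B * x powr - q"] by simp
    with main[of "- A" "- B"] False assms show ?thesis by simp
  qed (rule main)
qed

text \<open>With distinct exponents the expression combines two powers; on the diagonal it is a
  power times a logarithm plus that power. Injectivity will give the terms of the limiting series
  distinct absolute values, since the arrival times are distinct.\<close>

lemma inj_on_abs_powr_quotient:
  fixes A B \<theta> \<tau> :: real
  assumes "A \<noteq> 0" "0 < \<theta>" "0 < \<tau>"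
  shows "\<exists>x0. inj_on (\<lambda>x. \<bar>A * powr_quotient \<theta> \<tau> x + B * x powr - \<tau>\<bar>) {x0..}"
proof (cases "\<theta> = \<tau>")
  case True
  then show ?thesis
    using inj_on_abs_powr_ln_combination[of "- A" \<tau> B] assms by (simp add: powr_quotient_def)
next
  case False
  let ?c = "A / (\<theta> - \<tau>)"
  have "A * powr_quotient \<theta> \<tau> x + B * x powr - \<tau> = ?c * x powr - \<theta> + (B - ?c) * x powr - \<tau>" for x
    using False by (simp add: powr_quotient_def diff_divide_distrib right_diff_distrib left_diff_distrib)
  then show ?thesis
    using inj_on_abs_powr_combination[of ?c \<theta> \<tau> "B - ?c"] assms False by simp
qed

lemma powr_quotient_mult:
  assumes "\<theta> \<noteq> \<tau>"
  shows "c * x powr - \<theta> - c * x powr - \<tau> = (\<theta> - \<tau>) * (c * powr_quotient \<theta> \<tau> x)"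
proof -
  have "(\<theta> - \<tau>) * powr_quotient \<theta> \<tau> x = x powr - \<theta> - x powr - \<tau>"
    using assms by (simp add: powr_quotient_def)
  then show ?thesis by (metis mult.left_commute right_diff_distrib)
qed

subsection \<open>Almost sure estimates\<close>

lemma nn_integral_abs_powr:
  assumes "0 \<le> q" "q < 1"
  shows "(\<integral>\<^sup>+x. ennreal (\<bar>x\<bar> powr - q) * indicator {-1..1::real} x \<partial>lborel) \<le> ennreal (2 / (1 - q))"
proof -
  let ?g = "\<lambda>x::real. ennreal (\<bar>x\<bar> powr - q)"
  have pos: "(\<integral>\<^sup>+x. ?g x * indicator {0..1::real} x \<partial>lborel) = ennreal (1 / (1 - q))"
  proof -
    have "((\<lambda>x. x powr - q) has_integral (1 / (1 - q))) {0..1}"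
      using has_integral_powr_from_0[of "- q" 1] assms by simp
    then have "((\<lambda>x. \<bar>x\<bar> powr - q) has_integral (1 / (1 - q))) {0..1}"
      by (rule has_integral_eq[rotated]) simp
    from nn_integral_has_integral_lebesgue'[OF _ this] show ?thesis by simp
  qed
  have neg: "(\<integral>\<^sup>+x. ?g x * indicator {-1..0::real} x \<partial>lborel) = (\<integral>\<^sup>+x. ?g x * indicator {0..1::real} x \<partial>lborel)"
    by (subst nn_integral_real_affine[where c = "-1" and t = 0])
       (auto intro!: nn_integral_cong split: split_indicator)
  have "(\<integral>\<^sup>+x. ?g x * indicator {-1..1::real} x \<partial>lborel)
      \<le> (\<integral>\<^sup>+x. ?g x * indicator {-1..0::real} x + ?g x * indicator {0..1::real} x \<partial>lborel)"
    by (intro nn_integral_mono) (auto split: split_indicator)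
  also have "\<dots> = ennreal (1 / (1 - q)) + ennreal (1 / (1 - q))"
    unfolding pos[symmetric] neg[symmetric] by (subst nn_integral_add) (auto simp: neg)
  also have "\<dots> = ennreal (2 / (1 - q))"
    using assms by (simp flip: ennreal_plus)
  finally show ?thesis .
qed

abbreviation (input) seq_borel :: "(nat \<Rightarrow> real) measure" where
  "seq_borel \<equiv> \<Pi>\<^sub>M i\<in>UNIV. borel"

text \<open>A Markov inequality on a single path: each index counted on the left contributes at
  least \<open>real n powr (- 1 - e) * r powr - q\<close> to the series.\<close>

lemma card_le_of_neg_powr_sum:
  fixes v :: "nat \<Rightarrow> real"
  assumes e: "0 \<le> e" and q: "0 \<le> q" and v: "\<And>i. v i \<noteq> u"
    and sum: "summable (\<lambda>i. real (Suc i) powr (- 1 - e) * \<bar>v i - u\<bar> powr - q)" and r: "0 < r"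
  shows "real (card {i. i < n \<and> \<bar>v i - u\<bar> \<le> r})
    \<le> (\<Sum>i. real (Suc i) powr (- 1 - e) * \<bar>v i - u\<bar> powr - q) * real n powr (1 + e) * r powr q"
proof -
  let ?B = "{i. i < n \<and> \<bar>v i - u\<bar> \<le> r}"
  let ?f = "\<lambda>i. real (Suc i) powr (- 1 - e) * \<bar>v i - u\<bar> powr - q"
  have "1 \<le> real n powr (1 + e) * r powr q * ?f i" if "i \<in> ?B" for i
  proof -
    have i: "i < n" "\<bar>v i - u\<bar> \<le> r" "0 < \<bar>v i - u\<bar>" using that v[of i] by auto
    have "1 * 1 \<le> (real n powr (1 + e) * real (Suc i) powr - (1 + e)) * (r powr q * \<bar>v i - u\<bar> powr - q)"
    proof (rule mult_mono)
      have "real (Suc i) powr (1 + e) \<le> real n powr (1 + e)"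
        using i e by (intro powr_mono2) auto
      then show "1 \<le> real n powr (1 + e) * real (Suc i) powr - (1 + e)"
        unfolding powr_minus_divide by simp
      have "\<bar>v i - u\<bar> powr q \<le> r powr q"
        using i q by (intro powr_mono2) auto
      then show "1 \<le> r powr q * \<bar>v i - u\<bar> powr - q"
        using i(3) by (simp add: powr_minus_divide)
    qed auto
    then show ?thesis by (simp add: mult_ac)
  qed
  then have "(\<Sum>i\<in>?B. 1) \<le> (\<Sum>i\<in>?B. real n powr (1 + e) * r powr q * ?f i)"
    by (intro sum_mono) auto
  also have "\<dots> = real n powr (1 + e) * r powr q * (\<Sum>i\<in>?B. ?f i)"
    by (simp add: sum_distrib_left)
  also have "\<dots> \<le> real n powr (1 + e) * r powr q * suminf ?f"
    by (intro mult_left_mono sum_le_suminf[OF sum]) auto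
  finally show ?thesis by (simp add: mult_ac)
qed

context multistable_series
begin

section \<open>Exponential moments and linear growth of the arrival times\<close>

definition interarrival :: "nat \<Rightarrow> 'a \<Rightarrow> real" where
  "interarrival i \<omega> = (case i of 0 \<Rightarrow> \<Gamma> 0 \<omega> | Suc j \<Rightarrow> \<Gamma> (Suc j) \<omega> - \<Gamma> j \<omega>)"

lemma interarrival_indep_vars: "indep_vars (\<lambda>_. borel) interarrival UNIV"
  using interarrival_indep unfolding interarrival_def[abs_def] .

lemma interarrival_distributed: "distributed M lborel (interarrival i) (exponential_density 1)"
  using interarrival_exponential unfolding interarrival_def[abs_def] .

lemma interarrival_measurable [measurable]: "interarrival i \<in> borel_measurable M"
  using interarrival_indep_vars by (simp add: indep_vars_def)

lemma V_measurable [measurable]: "V i \<in> borel_measurable M"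
  using V_indep by (simp add: indep_vars_def)

lemma sign_measurable [measurable]: "\<epsilon> i \<in> borel_measurable M"
  using sign_indep by (simp add: indep_vars_def)

lemma arrival_eq_sum: "\<Gamma> n \<omega> = (\<Sum>i\<le>n. interarrival i \<omega>)"
proof (induction n)
  case (Suc n)
  have "interarrival (Suc n) \<omega> = \<Gamma> (Suc n) \<omega> - \<Gamma> n \<omega>" by (simp add: interarrival_def)
  with Suc show ?case by simp
qed (simp add: interarrival_def)

lemma arrival_measurable [measurable]: "\<Gamma> n \<in> borel_measurable M"
proof -
  have "(\<lambda>\<omega>. \<Sum>i\<le>n. interarrival i \<omega>) \<in> borel_measurable M"
    by (intro borel_measurable_sum interarrival_measurable)
  then show ?thesis by (simp add: arrival_eq_sum[symmetric])
qed

text \<open>Exponential tilting: multiplied by \<open>exp (s * x)\<close>, the unit-rate density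
  becomes \<open>1 / (1 - s)\<close> times the density of rate \<open>1 - s\<close>.\<close>

lemma interarrival_exp_moment:
  assumes "s < 1"
  shows "(\<integral>\<^sup>+\<omega>. ennreal (exp (s * interarrival i \<omega>)) \<partial>M) = ennreal (1 / (1 - s))"
proof -
  interpret E: prob_space "density lborel (exponential_density (1 - s))"
    using assms by (intro prob_space_exponential_density) simp
  have "(\<integral>\<^sup>+\<omega>. ennreal (exp (s * interarrival i \<omega>)) \<partial>M)
      = (\<integral>\<^sup>+x. ennreal (exponential_density 1 x) * ennreal (exp (s * x)) \<partial>lborel)"
    by (rule distributed_nn_integral[symmetric, OF interarrival_distributed]) measurable
  also have "\<dots> = (\<integral>\<^sup>+x. ennreal (1 / (1 - s)) * ennreal (exponential_density (1 - s) x) \<partial>lborel)"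
  proof (rule nn_integral_cong)
    fix x :: real
    have e: "exp (s * x) * exp (- x) = exp (- (x * (1 - s)))"
      by (simp add: exp_add[symmetric] algebra_simps)
    have "exponential_density 1 x * exp (s * x) = 1 / (1 - s) * exponential_density (1 - s) x"
      using assms e by (simp add: exponential_density_def mult.commute)
    moreover have "0 \<le> exponential_density 1 x" "0 \<le> exponential_density (1 - s) x"
      using assms by (auto simp: exponential_density_def)
    ultimately show "ennreal (exponential_density 1 x) * ennreal (exp (s * x))
        = ennreal (1 / (1 - s)) * ennreal (exponential_density (1 - s) x)"
      using assms by (simp add: ennreal_mult[symmetric])
  qed
  also have "\<dots> = ennreal (1 / (1 - s)) * emeasure (density lborel (exponential_density (1 - s))) UNIV"
    by (simp add: nn_integral_cmult emeasure_density)
  also have "emeasure (density lborel (exponential_density (1 - s))) UNIV = 1"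
    using E.emeasure_space_1 by simp
  finally show ?thesis by simp
qed

lemma arrival_exp_moment:
  assumes "s < 1"
  shows "(\<integral>\<^sup>+\<omega>. ennreal (exp (s * \<Gamma> n \<omega>)) \<partial>M) = ennreal ((1 / (1 - s)) ^ Suc n)"
proof -
  have ind: "indep_vars (\<lambda>_. borel) (\<lambda>i \<omega>. ennreal (exp (s * interarrival i \<omega>))) {..n}"
    by (rule indep_vars_compose2[OF indep_vars_subset[OF interarrival_indep_vars]]) auto
  have "(\<integral>\<^sup>+\<omega>. ennreal (exp (s * \<Gamma> n \<omega>)) \<partial>M) = (\<integral>\<^sup>+\<omega>. (\<Prod>i\<le>n. ennreal (exp (s * interarrival i \<omega>))) \<partial>M)"
    by (intro nn_integral_cong) (simp add: arrival_eq_sum sum_distrib_left exp_sum prod_ennreal)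
  also have "\<dots> = (\<Prod>i\<le>n. \<integral>\<^sup>+\<omega>. ennreal (exp (s * interarrival i \<omega>)) \<partial>M)"
    by (rule indep_vars_nn_integral[OF _ ind]) auto
  also have "\<dots> = ennreal ((1 / (1 - s)) ^ Suc n)"
    unfolding interarrival_exp_moment[OF assms] using assms by (simp add: ennreal_power del: power_Suc)
  finally show ?thesis .
qed

text \<open>The Chernoff bound at s = -1. Per summand the threshold costs \<open>exp (1/2)\<close>
  and the moment gains 1/2; since \<open>exp (1/2) < 2\<close>, the tails are summable.\<close>

lemma AE_arrival_lower: "AE \<omega> in M. \<forall>\<^sub>F n in sequentially. real (Suc n) / 2 \<le> \<Gamma> n \<omega>"
proof -
  have P: "prob {\<omega> \<in> space M. \<Gamma> n \<omega> \<le> real (Suc n) / 2} \<le> (exp (1/2) / 2) ^ Suc n" for n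
  proof -
    have "ennreal (prob {\<omega> \<in> space M. \<Gamma> n \<omega> \<le> real (Suc n) / 2})
        \<le> ennreal (exp (1 * (real (Suc n) / 2))) * (\<integral>\<^sup>+\<omega>. ennreal (exp (-1 * \<Gamma> n \<omega>)) * indicator (space M) \<omega> \<partial>M)"
      unfolding emeasure_eq_measure[symmetric] by (rule Chernoff_ineq_nn_integral_le) auto
    also have "(\<integral>\<^sup>+\<omega>. ennreal (exp (-1 * \<Gamma> n \<omega>)) * indicator (space M) \<omega> \<partial>M) = ennreal ((1 / 2) ^ Suc n)"
      using arrival_exp_moment[of "-1" n] by (simp cong: nn_integral_cong_simp)
    also have "exp (1 * (real (Suc n) / 2)) = exp (real (Suc n) * (1/2))" by simp
    also have "\<dots> = exp (1/2) ^ Suc n" by (rule exp_of_nat_mult)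
    also have "ennreal (exp (1/2) ^ Suc n) * ennreal ((1/2) ^ Suc n) = ennreal ((exp (1/2) * (1/2)) ^ Suc n)"
      unfolding power_mult_distrib by (rule ennreal_mult[symmetric]) auto
    finally have "prob {\<omega> \<in> space M. \<Gamma> n \<omega> \<le> real (Suc n) / 2} \<le> (exp (1/2) * (1/2)) ^ Suc n"
      by (subst (asm) ennreal_le_iff) auto
    then show ?thesis by simp
  qed
  have "exp (1/2 :: real) < 2"
  proof -
    have "exp (1/2 :: real) ^ 2 < 2 ^ 2"
      using exp_le by (simp add: exp_of_nat_mult[symmetric])
    then show ?thesis by (rule power_less_imp_less_base) simp
  qed
  then have "summable (\<lambda>n. (exp (1/2) / 2 :: real) ^ Suc n)"
    using summable_geometric[of "exp (1/2) / 2 :: real"] by (simp add: summable_mult)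
  then have "summable (\<lambda>n. prob {\<omega> \<in> space M. \<Gamma> n \<omega> \<le> real (Suc n) / 2})"
    by (rule summable_comparison_test'[of _ 0]) (use P in simp)
  then have "AE \<omega> in M. \<forall>\<^sub>F n in sequentially. \<omega> \<in> space M - {\<omega> \<in> space M. \<Gamma> n \<omega> \<le> real (Suc n) / 2}"
    by (intro borel_cantelli_AE1) (auto simp: emeasure_eq_measure)
  then show ?thesis
    by (auto elim!: eventually_mono)
qed

text \<open>The Chernoff bound at s = 1/2, where the moment is finite. Per summand the moment costs
  2 and the threshold gains \<open>exp (-2)\<close>; their product is at most 1/2.\<close>

lemma AE_arrival_upper: "AE \<omega> in M. \<forall>\<^sub>F n in sequentially. \<Gamma> n \<omega> \<le> 4 * real (Suc n)"
proof -
  have P: "prob {\<omega> \<in> space M. \<Gamma> n \<omega> \<ge> 4 * real (Suc n)} \<le> (1 / 2) ^ Suc n" for n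
  proof -
    have "ennreal (prob {\<omega> \<in> space M. \<Gamma> n \<omega> \<ge> 4 * real (Suc n)})
        \<le> ennreal (exp (- (1/2) * (4 * real (Suc n)))) * (\<integral>\<^sup>+\<omega>. ennreal (exp ((1/2) * \<Gamma> n \<omega>)) * indicator (space M) \<omega> \<partial>M)"
      unfolding emeasure_eq_measure[symmetric] by (rule Chernoff_ineq_nn_integral_ge) auto
    also have "(\<integral>\<^sup>+\<omega>. ennreal (exp ((1/2) * \<Gamma> n \<omega>)) * indicator (space M) \<omega> \<partial>M) = ennreal (2 ^ Suc n)"
      using arrival_exp_moment[of "1/2" n] by (simp cong: nn_integral_cong_simp)
    also have "exp (- (1/2) * (4 * real (Suc n))) = exp (real (Suc n) * -2)" by (simp add: field_simps)
    also have "\<dots> = exp (-2) ^ Suc n" by (rule exp_of_nat_mult)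
    also have "ennreal (exp (-2) ^ Suc n) * ennreal (2 ^ Suc n) = ennreal ((exp (-2) * 2) ^ Suc n)"
      unfolding power_mult_distrib by (rule ennreal_mult[symmetric]) auto
    finally have "prob {\<omega> \<in> space M. \<Gamma> n \<omega> \<ge> 4 * real (Suc n)} \<le> (exp (-2) * 2) ^ Suc n"
      by (subst (asm) ennreal_le_iff) auto
    also have "\<dots> \<le> (1 / 2) ^ Suc n"
    proof (rule power_mono)
      have "2 \<le> exp (1::real)" using exp_ge_add_one_self[of 1] by simp
      then have "2 * 2 \<le> exp (1::real) * exp 1" by (intro mult_mono) auto
      then have "4 \<le> exp (2::real)" by (simp flip: exp_add)
      then show "exp (-2) * 2 \<le> (1 / 2 :: real)" by (simp add: exp_minus field_simps)
    qed simp
    finally show ?thesis .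
  qed
  have "summable (\<lambda>n. (1 / 2 :: real) ^ Suc n)"
    using summable_geometric[of "1/2 :: real"] by (simp add: summable_mult)
  then have "summable (\<lambda>n. prob {\<omega> \<in> space M. \<Gamma> n \<omega> \<ge> 4 * real (Suc n)})"
    by (rule summable_comparison_test'[of _ 0]) (use P in simp)
  then have "AE \<omega> in M. \<forall>\<^sub>F n in sequentially. \<omega> \<in> space M - {\<omega> \<in> space M. \<Gamma> n \<omega> \<ge> 4 * real (Suc n)}"
    by (intro borel_cantelli_AE1) (auto simp: emeasure_eq_measure)
  then show ?thesis
    by (auto elim!: eventually_mono)
qed

lemma AE_interarrival_pos: "AE \<omega> in M. \<forall>i. 0 < interarrival i \<omega>"
proof (subst AE_all_countable, rule allI)
  fix i
  have "prob {\<omega> \<in> space M. interarrival i \<omega> \<le> 0} = 0"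
    using exponential_distributedD_le[OF interarrival_distributed[of i], of 0] by simp
  then have "AE \<omega> in M. \<not> interarrival i \<omega> \<le> 0"
    by (subst AE_iff_measurable[OF _ refl]) (auto simp: emeasure_eq_measure)
  then show "AE \<omega> in M. 0 < interarrival i \<omega>" by (simp add: not_le)
qed

lemma AE_arrival_strict_mono: "AE \<omega> in M. 0 < \<Gamma> 0 \<omega> \<and> strict_mono (\<lambda>n. \<Gamma> n \<omega>)"
  using AE_interarrival_pos
proof eventually_elim
  case (elim \<omega>)
  have "\<Gamma> n \<omega> < \<Gamma> (Suc n) \<omega>" for n
    using elim[rule_format, of "Suc n"] by (simp add: interarrival_def)
  then show ?case
    using elim[rule_format, of 0] by (simp add: strict_mono_Suc_iff interarrival_def)
qed

text \<open>Positivity of \<open>\<Gamma> 0\<close> and monotonicity extend the eventual bounds to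
  all indices, at the price of constants that depend on the path.\<close>

lemma AE_arrival_linear:
  "AE \<omega> in M. (\<exists>\<kappa>>0. \<forall>n. \<kappa> * real (Suc n) \<le> \<Gamma> n \<omega>) \<and> (\<exists>K>0. \<forall>n. \<Gamma> n \<omega> \<le> K * real (Suc n))"
  using AE_arrival_lower AE_arrival_upper AE_arrival_strict_mono
proof eventually_elim
  case (elim \<omega>)
  from eventually_conj[OF elim(1,2)]
  obtain N where "\<forall>n\<ge>N. real (Suc n) / 2 \<le> \<Gamma> n \<omega> \<and> \<Gamma> n \<omega> \<le> 4 * real (Suc n)"
    unfolding eventually_sequentially by blast
  then have N: "\<And>n. N \<le> n \<Longrightarrow> real (Suc n) / 2 \<le> \<Gamma> n \<omega>" "\<And>n. N \<le> n \<Longrightarrow> \<Gamma> n \<omega> \<le> 4 * real (Suc n)"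
    by blast+
  have mono: "\<Gamma> m \<omega> \<le> \<Gamma> n \<omega>" if "m \<le> n" for m n
    using elim(3) that by (auto dest: strict_mono_leD)
  have pos: "0 < \<Gamma> 0 \<omega>" using elim(3) by simp
  define \<kappa> where "\<kappa> = min (1/2) (\<Gamma> 0 \<omega> / real (Suc N))"
  define K where "K = max 4 (\<Gamma> N \<omega>)"
  have \<kappa>_le: "\<kappa> \<le> 1/2" "\<kappa> \<le> \<Gamma> 0 \<omega> / real (Suc N)"
    unfolding \<kappa>_def by (rule min.cobounded1, rule min.cobounded2)
  have "0 < \<kappa>" using pos by (simp add: \<kappa>_def)
  note \<kappa> = this \<kappa>_le
  have K: "4 \<le> K" "\<Gamma> N \<omega> \<le> K" unfolding K_def by (rule max.cobounded1, rule max.cobounded2)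
  have "\<kappa> * real (Suc n) \<le> \<Gamma> n \<omega>" for n
  proof (cases "N \<le> n")
    case True
    have "\<kappa> * real (Suc n) \<le> 1/2 * real (Suc n)" using \<kappa> by (intro mult_right_mono) auto
    with N(1)[OF True] show ?thesis by linarith
  next
    case False
    have "\<kappa> * real (Suc n) \<le> (\<Gamma> 0 \<omega> / real (Suc N)) * real (Suc N)"
      using False \<kappa> pos by (intro mult_mono) auto
    also have "\<dots> = \<Gamma> 0 \<omega>" by simp
    finally show ?thesis using mono[of 0 n] by simp
  qed
  moreover have "\<Gamma> n \<omega> \<le> K * real (Suc n)" for n
  proof (cases "N \<le> n")
    case True
    have "4 * real (Suc n) \<le> K * real (Suc n)" using K by (intro mult_right_mono) auto
    with N(2)[OF True] show ?thesis by linarith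
  next
    case False
    have "K * 1 \<le> K * real (Suc n)" using K by (intro mult_left_mono) auto
    with mono[of n N] False K show ?thesis by linarith
  qed
  moreover have "0 < K" using K by simp
  ultimately show ?case using \<open>0 < \<kappa>\<close> by blast
qed

section \<open>Signs and uniform positions\<close>

lemma sign_AE: "AE \<omega> in M. \<forall>i. \<epsilon> i \<omega> = 1 \<or> \<epsilon> i \<omega> = -1"
proof (subst AE_all_countable, rule allI)
  fix i
  have "prob ({\<omega> \<in> space M. \<epsilon> i \<omega> = 1} \<union> {\<omega> \<in> space M. \<epsilon> i \<omega> = -1}) = 1"
    using sign_pos[of i] sign_neg[of i] by (subst finite_measure_Union) auto
  from prob_eq_1[THEN iffD1, OF _ this]
  show "AE \<omega> in M. \<epsilon> i \<omega> = 1 \<or> \<epsilon> i \<omega> = -1" by auto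
qed

lemma V_prob:
  assumes "B \<in> sets borel"
  shows "prob {\<omega> \<in> space M. V i \<omega> \<in> B} = measure lborel ({0..1} \<inter> B)"
proof -
  have "prob {\<omega> \<in> space M. V i \<omega> \<in> B} = measure (distr M lborel (V i)) B"
    using assms by (subst measure_distr) (auto intro: arg_cong[where f=prob])
  also have "\<dots> = measure lborel ({0..1} \<inter> B)"
    unfolding V_uniform using assms by (subst measure_uniform_measure) auto
  finally show ?thesis .
qed

lemma V_AE: "AE \<omega> in M. \<forall>i. 0 < V i \<omega> \<and> V i \<omega> \<le> 1 \<and> V i \<omega> \<noteq> u"
proof (subst AE_all_countable, rule allI)
  fix i
  have "prob {\<omega> \<in> space M. V i \<omega> \<in> {0<..1} - {u}} = measure lborel ({0..1} \<inter> ({0<..1} - {u}))"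
    by (rule V_prob) simp
  also have "{0..1} \<inter> ({0<..1} - {u}) = {0..1} - {0, u}" by auto
  also have "measure lborel ({0..1} - {0, u}) = measure lborel {0..1::real}"
    by (intro measure_Diff_null_set) (auto intro: finite_imp_null_set_lborel)
  finally have "prob {\<omega> \<in> space M. V i \<omega> \<in> {0<..1} - {u}} = 1" by simp
  from prob_eq_1[THEN iffD1, OF _ this]
  show "AE \<omega> in M. 0 < V i \<omega> \<and> V i \<omega> \<le> 1 \<and> V i \<omega> \<noteq> u" by auto
qed

lemma V_neg_moment:
  assumes q: "0 \<le> q" "q < 1" and u: "u \<in> {0..1}"
  shows "(\<integral>\<^sup>+\<omega>. ennreal (\<bar>V i \<omega> - u\<bar> powr - q) \<partial>M) \<le> ennreal (2 / (1 - q))"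
proof -
  let ?g = "\<lambda>x::real. ennreal (\<bar>x - u\<bar> powr - q)"
  have "(\<integral>\<^sup>+\<omega>. ?g (V i \<omega>) \<partial>M) = (\<integral>\<^sup>+x. ?g x \<partial>distr M lborel (V i))"
    by (subst nn_integral_distr) auto
  also have "\<dots> = (\<integral>\<^sup>+x. ?g x * indicator {0..1::real} x \<partial>lborel)"
    unfolding V_uniform by (subst nn_integral_uniform_measure) (auto simp: divide_ennreal_def)
  also have "\<dots> = (\<integral>\<^sup>+x. ennreal (\<bar>x\<bar> powr - q) * indicator {0..1::real} (u + x) \<partial>lborel)"
    by (subst nn_integral_real_affine[where c = 1 and t = u]) auto
  also have "\<dots> \<le> (\<integral>\<^sup>+x. ennreal (\<bar>x\<bar> powr - q) * indicator {-1..1::real} x \<partial>lborel)"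
    using u by (intro nn_integral_mono mult_left_mono) (auto split: split_indicator)
  also have "\<dots> \<le> ennreal (2 / (1 - q))"
    using q by (rule nn_integral_abs_powr)
  finally show ?thesis .
qed

text \<open>The series has finite expectation: \<open>q < 1\<close> bounds the negative moments and
  \<open>0 < e\<close> makes the weights summable.\<close>

lemma AE_summable_neg_powr:
  assumes q: "0 \<le> q" "q < 1" and u: "u \<in> {0..1}" and e: "0 < e"
  shows "AE \<omega> in M. summable (\<lambda>i. real (Suc i) powr (- 1 - e) * \<bar>V i \<omega> - u\<bar> powr - q)"
proof -
  define c where "c = 2 / (1 - q)"
  have c: "0 \<le> c" using q by (simp add: c_def)
  let ?f = "\<lambda>i \<omega>. real (Suc i) powr (- 1 - e) * \<bar>V i \<omega> - u\<bar> powr - q"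
  have sum: "summable (\<lambda>i. real (Suc i) powr (- 1 - e))"
    using e by (subst summable_Suc_iff) (simp add: summable_real_powr_iff)
  have "(\<integral>\<^sup>+\<omega>. (\<Sum>i. ennreal (?f i \<omega>)) \<partial>M) = (\<Sum>i. \<integral>\<^sup>+\<omega>. ennreal (?f i \<omega>) \<partial>M)"
    by (rule nn_integral_suminf) measurable
  also have "\<dots> = (\<Sum>i. ennreal (real (Suc i) powr (- 1 - e)) * (\<integral>\<^sup>+\<omega>. ennreal (\<bar>V i \<omega> - u\<bar> powr - q) \<partial>M))"
    by (simp add: ennreal_mult nn_integral_cmult del: of_nat_Suc)
  also have "\<dots> \<le> (\<Sum>i. ennreal (real (Suc i) powr (- 1 - e)) * ennreal c)"
    unfolding c_def using V_neg_moment[OF q u] by (intro suminf_le mult_left_mono) auto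
  also have "\<dots> = (\<Sum>i. ennreal (real (Suc i) powr (- 1 - e) * c))"
    using c by (simp add: ennreal_mult'' del: of_nat_Suc)
  also have "\<dots> < \<infinity>"
    using summable_mult2[OF sum, of c] c by (subst suminf_ennreal2) (auto simp del: of_nat_Suc)
  finally have "(\<integral>\<^sup>+\<omega>. (\<Sum>i. ennreal (?f i \<omega>)) \<partial>M) \<noteq> \<infinity>" by simp
  then have "AE \<omega> in M. (\<Sum>i. ennreal (?f i \<omega>)) \<noteq> \<infinity>"
    by (intro nn_integral_PInf_AE) auto
  then show ?thesis
    by eventually_elim (intro summable_suminf_not_top, auto)
qed

lemma V_sign_indep:
  assumes [measurable]: "X \<in> sets seq_borel" "Y \<in> sets seq_borel"
  shows "prob {\<omega> \<in> space M. (\<lambda>i. V i \<omega>) \<in> X \<and> (\<lambda>i. \<epsilon> i \<omega>) \<in> Y}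
    = prob {\<omega> \<in> space M. (\<lambda>i. V i \<omega>) \<in> X} * prob {\<omega> \<in> space M. (\<lambda>i. \<epsilon> i \<omega>) \<in> Y}"
proof -
  let ?Z = "\<lambda>k \<omega> i. ([\<Gamma>, V, \<epsilon>] ! k) i \<omega>" and ?A = "\<lambda>k::nat. if k = 1 then X else Y"
  have "prob (\<Inter>k\<in>{1, 2}. ?Z k -` ?A k \<inter> space M) = (\<Prod>k\<in>{1, 2}. prob (?Z k -` ?A k \<inter> space M))"
    by (rule indep_varsD[OF sequences_indep]) auto
  moreover have "(\<Inter>k\<in>{1, 2}. ?Z k -` ?A k \<inter> space M) = {\<omega> \<in> space M. (\<lambda>i. V i \<omega>) \<in> X \<and> (\<lambda>i. \<epsilon> i \<omega>) \<in> Y}"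
    by auto
  moreover have "?Z 1 -` ?A 1 \<inter> space M = {\<omega> \<in> space M. (\<lambda>i. V i \<omega>) \<in> X}"
    "?Z 2 -` ?A 2 \<inter> space M = {\<omega> \<in> space M. (\<lambda>i. \<epsilon> i \<omega>) \<in> Y}" by auto
  ultimately show ?thesis by simp
qed

section \<open>Sign sums over random index sets\<close>

lemma sign_expectation: "expectation (\<epsilon> i) = 0"
proof -
  let ?P = "{\<omega> \<in> space M. \<epsilon> i \<omega> = 1}" and ?N = "{\<omega> \<in> space M. \<epsilon> i \<omega> = -1}"
  have "expectation (\<epsilon> i) = expectation (\<lambda>\<omega>. indicator ?P \<omega> - indicator ?N \<omega>)"
    using sign_AE by (intro integral_cong_AE) (auto elim!: eventually_mono split: split_indicator)
  also have "\<dots> = prob ?P - prob ?N"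
    by (subst Bochner_Integration.integral_diff) (auto simp: emeasure_eq_measure)
  finally show ?thesis by (simp add: sign_pos sign_neg)
qed

text \<open>The constant 8 turns the Hoeffding exponent into -4 ln n. The fourth power is needed
  because a union over n^2 index sets follows and the result must still be summable.\<close>

lemma sign_sum_tail:
  assumes "finite A" "1 \<le> n"
  shows "prob {\<omega> \<in> space M. sqrt (8 * ln (real n) * card A) < \<bar>\<Sum>i\<in>A. \<epsilon> i \<omega>\<bar>} \<le> 2 / real n ^ 4"
proof (cases "A = {}")
  case False
  interpret H: Hoeffding_ineq M A \<epsilon> "\<lambda>_. -1" "\<lambda>_. 1" 0
  proof unfold_locales
    show "indep_vars (\<lambda>_. borel) \<epsilon> A" using sign_indep by (rule indep_vars_subset) simp
    show "AE x in M. \<epsilon> i x \<in> {-1..1}" if "i \<in> A" for i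
      using sign_AE by eventually_elim (smt (verit, best) atLeastAtMost_iff)
    show "0 \<equiv> \<Sum>i\<in>A. expectation (\<epsilon> i)" by (simp add: sign_expectation)
  qed (use assms in auto)
  have card: "0 < card A" using False assms by (simp add: card_gt_0_iff)
  have l: "0 \<le> 8 * ln (real n) * card A" using assms by simp
  have "prob {\<omega> \<in> space M. sqrt (8 * ln (real n) * card A) < \<bar>\<Sum>i\<in>A. \<epsilon> i \<omega>\<bar>}
      \<le> prob {\<omega> \<in> space M. \<bar>(\<Sum>i\<in>A. \<epsilon> i \<omega>) - 0\<bar> \<ge> sqrt (8 * ln (real n) * card A)}"
    by (intro finite_measure_mono) auto
  also have "\<dots> \<le> 2 * exp (-2 * (sqrt (8 * ln (real n) * card A))\<^sup>2 / (\<Sum>i\<in>A. (1 - (-1))\<^sup>2))"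
    by (rule H.Hoeffding_ineq_abs_ge) (use l card in auto)
  also have "-2 * (sqrt (8 * ln (real n) * card A))\<^sup>2 / (\<Sum>i\<in>A. (1 - (-1))\<^sup>2) = - (4 * ln (real n))"
    using l card by (simp add: field_simps)
  also have "exp (- (4 * ln (real n))) = 1 / real n ^ 4"
  proof -
    have "exp (4 * ln (real n)) = exp (ln (real n)) ^ 4"
      using exp_of_nat_mult[of 4 "ln (real n)"] by simp
    then show ?thesis using assms by (simp add: exp_minus inverse_eq_divide)
  qed
  finally show ?thesis by simp
qed (use assms in simp)

text \<open>The index set is a function of the positions, hence independent of the signs. Splitting
  over its finitely many values takes the place of conditioning, and the tail bound survives because
  the probabilities of these values sum to at most 1.\<close>

lemma sign_sum_tail_random_set:
  fixes \<rho> :: "(nat \<Rightarrow> real) \<Rightarrow> nat set"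
  assumes n: "1 \<le> n" and sub: "\<And>v. \<rho> v \<subseteq> {..<n}"
    and meas: "\<And>A. A \<subseteq> {..<n} \<Longrightarrow> {v. \<rho> v = A} \<in> sets seq_borel"
  defines "E \<equiv> {\<omega> \<in> space M. sqrt (8 * ln (real n) * card (\<rho> (\<lambda>i. V i \<omega>))) < \<bar>\<Sum>i\<in>\<rho> (\<lambda>i. V i \<omega>). \<epsilon> i \<omega>\<bar>}"
  shows "E \<in> events" "prob E \<le> 2 / real n ^ 4"
proof -
  let ?R = "\<lambda>\<omega>. \<rho> (\<lambda>i. V i \<omega>)"
  have rvV: "(\<lambda>\<omega> i. V i \<omega>) \<in> measurable M seq_borel"
    by (rule measurable_PiM_single') (auto simp: space_PiM)
  have R_meas: "{\<omega> \<in> space M. ?R \<omega> = A} \<in> events" if "A \<subseteq> {..<n}" for A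
    using measurable_sets[OF rvV meas[OF that]] by (simp add: vimage_def Int_def conj_commute)
  let ?S = "\<lambda>A. {e. sqrt (8 * ln (real n) * card A) < \<bar>\<Sum>i\<in>A. e i :: real\<bar>} :: (nat \<Rightarrow> real) set"
  have S_meas: "?S A \<in> sets seq_borel" for A
  proof -
    have "{e \<in> space seq_borel. sqrt (8 * ln (real n) * card A) < \<bar>\<Sum>i\<in>A. e i :: real\<bar>} \<in> sets seq_borel"
      by measurable
    then show ?thesis by (simp add: space_PiM)
  qed
  let ?E = "\<lambda>A. {\<omega> \<in> space M. ?R \<omega> = A \<and> (\<lambda>i. \<epsilon> i \<omega>) \<in> ?S A}"
  have E_eq: "E = (\<Union>A\<in>Pow {..<n}. ?E A)"
    using sub by (auto simp: E_def)
  have [measurable]: "?E A \<in> events" if "A \<in> Pow {..<n}" for A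
  proof -
    have "?E A = {\<omega> \<in> space M. ?R \<omega> = A} \<inter> {\<omega> \<in> space M. sqrt (8 * ln (real n) * card A) < \<bar>\<Sum>i\<in>A. \<epsilon> i \<omega>\<bar>}"
      by auto
    also have "\<dots> \<in> events" using R_meas that by (intro sets.Int) auto
    finally show ?thesis .
  qed
  then show "E \<in> events" unfolding E_eq by (intro sets.finite_UN) auto
  have fin: "finite (Pow {..<n})" by simp
  have "prob E \<le> (\<Sum>A\<in>Pow {..<n}. prob (?E A))"
    unfolding E_eq using \<open>\<And>A. A \<in> Pow {..<n} \<Longrightarrow> ?E A \<in> events\<close>
    by (intro finite_measure_subadditive_finite) auto
  also have "\<dots> \<le> (\<Sum>A\<in>Pow {..<n}. prob {\<omega> \<in> space M. ?R \<omega> = A} * (2 / real n ^ 4))"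
  proof (rule sum_mono)
    fix A assume A: "A \<in> Pow {..<n}"
    have "prob (?E A) = prob {\<omega> \<in> space M. ?R \<omega> = A} * prob {\<omega> \<in> space M. sqrt (8 * ln (real n) * card A) < \<bar>\<Sum>i\<in>A. \<epsilon> i \<omega>\<bar>}"
      using V_sign_indep[OF meas S_meas, of A A] A by simp
    also have "\<dots> \<le> prob {\<omega> \<in> space M. ?R \<omega> = A} * (2 / real n ^ 4)"
      using A n finite_subset[of A "{..<n}"] by (intro mult_left_mono sign_sum_tail) auto
    finally show "prob (?E A) \<le> prob {\<omega> \<in> space M. ?R \<omega> = A} * (2 / real n ^ 4)" .
  qed
  also have "\<dots> = (\<Sum>A\<in>Pow {..<n}. prob {\<omega> \<in> space M. ?R \<omega> = A}) * (2 / real n ^ 4)"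
    by (simp only: sum_distrib_right)
  also have "(\<Sum>A\<in>Pow {..<n}. prob {\<omega> \<in> space M. ?R \<omega> = A}) = prob (\<Union>A\<in>Pow {..<n}. {\<omega> \<in> space M. ?R \<omega> = A})"
    using R_meas by (intro finite_measure_finite_Union[symmetric]) (auto simp: disjoint_family_on_def)
  also have "prob (\<Union>A\<in>Pow {..<n}. {\<omega> \<in> space M. ?R \<omega> = A}) * (2 / real n ^ 4) \<le> 1 * (2 / real n ^ 4)"
    by (intro mult_right_mono) auto
  finally show "prob E \<le> 2 / real n ^ 4" by simp
qed

text \<open>Open at the lower end and closed at the upper one: for positive positions and
  nonnegative u and t these are the indices below n at which the indicators of {0..u} and {0..t}
  differ.\<close>

definition crossed :: "real \<Rightarrow> nat \<Rightarrow> real \<Rightarrow> 'a \<Rightarrow> nat set" where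
  "crossed u n t \<omega> = {i. i < n \<and> min u t < V i \<omega> \<and> V i \<omega> \<le> max u t}"

text \<open>A nonempty crossed set consists of all indices below n whose position lies between the
  least and the greatest position in the set, so it is determined by a pair of indices. The union
  bound over pairs leaves a probability of order n^-2, uniformly in t.\<close>

lemma AE_sign_sum_crossed:
  "AE \<omega> in M. \<forall>\<^sub>F n in sequentially. \<forall>t.
     \<bar>\<Sum>i\<in>crossed u n t \<omega>. \<epsilon> i \<omega>\<bar> \<le> sqrt (8 * ln (real n) * card (crossed u n t \<omega>))"
proof -
  define \<rho> where "\<rho> n j k v = {i. i < n \<and> v j \<le> v i \<and> v i \<le> v k}" for n j k :: nat and v :: "nat \<Rightarrow> real"
  define E where "E n j k = {\<omega> \<in> space M. sqrt (8 * ln (real n) * card (\<rho> n j k (\<lambda>i. V i \<omega>)))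
      < \<bar>\<Sum>i\<in>\<rho> n j k (\<lambda>i. V i \<omega>). \<epsilon> i \<omega>\<bar>}" for n j k
  have [measurable]: "(\<lambda>v. v i) \<in> borel_measurable seq_borel" for i :: nat
    by (rule measurable_component_singleton) simp
  have [measurable]: "Measurable.pred seq_borel (\<lambda>v. v i \<le> v k)" for i k :: nat
    unfolding pred_def by (rule borel_measurable_le) measurable
  have E: "E n j k \<in> events" "prob (E n j k) \<le> 2 / real n ^ 4" if "1 \<le> n" for n j k
  proof -
    have "{v. \<rho> n j k v = A} \<in> sets seq_borel" if "A \<subseteq> {..<n}" for A
    proof -
      let ?P = "\<lambda>v :: nat \<Rightarrow> real. (\<forall>i\<in>A. v j \<le> v i \<and> v i \<le> v k) \<and> (\<forall>i\<in>{..<n} - A. \<not> (v j \<le> v i \<and> v i \<le> v k))"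
      have "finite A" using that finite_subset by blast
      then have "{v \<in> space seq_borel. ?P v} \<in> sets seq_borel"
        by measurable
      also have "{v \<in> space seq_borel. ?P v} = {v. \<rho> n j k v = A}"
        using that by (auto simp: \<rho>_def space_PiM)
      finally show ?thesis .
    qed
    then show "E n j k \<in> events" "prob (E n j k) \<le> 2 / real n ^ 4"
      unfolding E_def by (intro sign_sum_tail_random_set[OF that]; auto simp: \<rho>_def)+
  qed
  \<comment> \<open>The index is shifted since the tail bound needs at least one term; the shift is
    undone at the end.\<close>
  define Bad where "Bad n = (\<Union>(j, k)\<in>{..<Suc n} \<times> {..<Suc n}. E (Suc n) j k)" for n
  have Bad: "Bad n \<in> events" for n
    unfolding Bad_def using E(1)[of "Suc n"] by (intro sets.finite_UN) auto
  have P: "prob (Bad n) \<le> 2 * inverse (real (Suc n) ^ 2)" for n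
  proof -
    have "prob (Bad n) \<le> (\<Sum>(j, k)\<in>{..<Suc n} \<times> {..<Suc n}. prob (E (Suc n) j k))"
      unfolding Bad_def split_def using E(1)[of "Suc n"]
      by (intro finite_measure_subadditive_finite) auto
    also have "\<dots> \<le> (\<Sum>(j, k)\<in>{..<Suc n} \<times> {..<Suc n}. 2 / real (Suc n) ^ 4)"
      unfolding split_def using E(2)[of "Suc n"] by (intro sum_mono) auto
    also have "\<dots> = 2 * inverse (real (Suc n) ^ 2)"
      by (simp add: card_cartesian_product field_simps power4_eq_xxxx power2_eq_square del: of_nat_Suc mult_Suc mult_Suc_right)
    finally show ?thesis .
  qed
  have "summable (\<lambda>n. inverse (real n ^ 2))" by (rule inverse_power_summable) simp
  then have "summable (\<lambda>n. inverse (real (Suc n) ^ 2))"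
    by (subst summable_Suc_iff[of "\<lambda>n. inverse (real n ^ 2)"])
  then have "summable (\<lambda>n. 2 * inverse (real (Suc n) ^ 2))" by (rule summable_mult)
  then have "summable (\<lambda>n. prob (Bad n))"
    by (rule summable_comparison_test'[where N = 0]) (simp only: real_norm_def abs_of_nonneg[OF measure_nonneg] P)
  then have "AE \<omega> in M. \<forall>\<^sub>F n in sequentially. \<omega> \<in> space M - Bad n"
    by (intro borel_cantelli_AE1 Bad) (auto simp: emeasure_eq_measure)
  then show ?thesis
  proof eventually_elim
    case (elim \<omega>)
    have *: "\<bar>\<Sum>i\<in>crossed u (Suc n) t \<omega>. \<epsilon> i \<omega>\<bar> \<le> sqrt (8 * ln (real (Suc n)) * card (crossed u (Suc n) t \<omega>))"
      if good: "\<omega> \<in> space M - Bad n" for n t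
    proof (cases "crossed u (Suc n) t \<omega> = {}")
      case False
      let ?B = "crossed u (Suc n) t \<omega>"
      let ?v = "(\<lambda>i. V i \<omega>) ` ?B"
      have v: "finite ?v" "?v \<noteq> {}" using False by (auto simp: crossed_def)
      obtain j where j: "j \<in> ?B" "V j \<omega> = Min ?v" using Min_in[OF v] by auto
      obtain k where k: "k \<in> ?B" "V k \<omega> = Max ?v" using Max_in[OF v] by auto
      have "V j \<omega> \<le> V i \<omega> \<and> V i \<omega> \<le> V k \<omega>" if "i \<in> ?B" for i
        unfolding j(2) k(2) using v that by (auto intro: Min_le Max_ge)
      then have eq: "?B = \<rho> (Suc n) j k (\<lambda>i. V i \<omega>)"
        using j(1) k(1) unfolding crossed_def \<rho>_def by fastforce
      have "j < Suc n" "k < Suc n" using j(1) k(1) by (auto simp: crossed_def)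
      then have "\<omega> \<in> space M" "\<omega> \<notin> E (Suc n) j k" using good by (auto simp: Bad_def)
      then show ?thesis unfolding eq by (auto simp: E_def not_less simp del: of_nat_Suc)
    qed simp
    have "\<forall>\<^sub>F n in sequentially. \<forall>t.
      \<bar>\<Sum>i\<in>crossed u (Suc n) t \<omega>. \<epsilon> i \<omega>\<bar> \<le> sqrt (8 * ln (real (Suc n)) * card (crossed u (Suc n) t \<omega>))"
      using elim * by (auto elim!: eventually_mono)
    then show ?case by (subst (asm) eventually_sequentially_Suc)
  qed
qed

definition sign_increment :: "real \<Rightarrow> real \<Rightarrow> nat \<Rightarrow> 'a \<Rightarrow> real" where
  "sign_increment u t i \<omega> = \<epsilon> i \<omega> * (indicator {0..t} (V i \<omega>) - indicator {0..u} (V i \<omega>))"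

lemma AE_sign_increment_bound:
  assumes u: "u \<in> {0..1}" and p: "0 \<le> p" "p < s" and s: "1 / 2 < s"
  shows "AE \<omega> in M. \<exists>K\<ge>0. \<forall>n. \<forall>t\<in>{0..1}. \<bar>\<Sum>i<n. sign_increment u t i \<omega>\<bar> \<le> K * real n powr s * \<bar>t - u\<bar> powr p"
proof -
  \<comment> \<open>A count is \<open>0\<close> or at least \<open>1\<close>, so its square root is at most its \<open>\<rho>\<close>-th power, for any
    \<open>\<rho> \<ge> 1/2\<close>; this trades powers of \<open>n\<close> for powers of \<open>|t - u|\<close>.\<close>
  define \<rho> where "\<rho> = (max p (1/2) + s) / 2"
  have \<rho>: "1 / 2 < \<rho>" "p < \<rho>" "\<rho> < s" using p s by (auto simp: \<rho>_def max_def)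
  \<comment> \<open>The count near u is bounded by a \<open>q\<close>-th power of the distance,
    whose \<open>\<rho>\<close>-th power is the \<open>p\<close>-th; \<open>p < \<rho>\<close> gives
    \<open>q < 1\<close>, where negative moments are finite. The constant \<open>e\<close> below is
    chosen so that \<open>e\<close> from the logarithm and \<open>(1 + e) * \<rho>\<close> from the
    count add up to \<open>s\<close>.\<close>
  define q where "q = p / \<rho>"
  have q: "0 \<le> q" "q < 1" "q * \<rho> = p" using \<rho> p by (auto simp: q_def)
  define e where "e = (s - \<rho>) / (1 + \<rho>)"
  have e: "0 < e" "e + (1 + e) * \<rho> = s"
  proof -
    have "e * (1 + \<rho>) = s - \<rho>" using \<rho> by (simp add: e_def)
    then show "e + (1 + e) * \<rho> = s" by (simp add: algebra_simps)
  qed (use \<rho> in \<open>simp add: e_def\<close>)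
  show ?thesis
    using V_AE[of u] sign_AE AE_sign_sum_crossed[of u] AE_summable_neg_powr[OF q(1,2) u e(1)]
  proof eventually_elim
    case (elim \<omega>)
    let ?B = "\<lambda>n t. crossed u n t \<omega>"
    let ?S = "\<Sum>i. real (Suc i) powr (- 1 - e) * \<bar>V i \<omega> - u\<bar> powr - q"
    have S0: "0 \<le> ?S" using elim(4) by (intro suminf_nonneg) auto
    have V0: "0 < V i \<omega>" "V i \<omega> \<noteq> u" for i using elim(1) by auto
    have sgn: "\<bar>\<epsilon> i \<omega>\<bar> = 1" for i using elim(2)[rule_format, of i] by auto
    have fin: "finite (?B n t)" for n t by (simp add: crossed_def)
    have T_eq: "\<bar>\<Sum>i<n. sign_increment u t i \<omega>\<bar> = \<bar>\<Sum>i\<in>?B n t. \<epsilon> i \<omega>\<bar>" if "t \<in> {0..1}" for n t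
    proof -
      define \<sigma> :: real where "\<sigma> = (if u \<le> t then 1 else -1)"
      have "sign_increment u t i \<omega> = \<sigma> * (if i \<in> ?B n t then \<epsilon> i \<omega> else 0)" if "i < n" for i
        using V0[of i] that unfolding sign_increment_def crossed_def \<sigma>_def by (auto simp: indicator_def min_def max_def)
      then have "(\<Sum>i<n. sign_increment u t i \<omega>) = \<sigma> * (\<Sum>i<n. if i \<in> ?B n t then \<epsilon> i \<omega> else 0)"
        by (simp add: sum_distrib_left)
      also have "(\<Sum>i<n. if i \<in> ?B n t then \<epsilon> i \<omega> else 0) = (\<Sum>i\<in>?B n t. \<epsilon> i \<omega>)"
        by (rule sum.mono_neutral_cong_right) (auto simp: crossed_def)
      finally show ?thesis by (simp add: abs_mult \<sigma>_def)
    qed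
    obtain N where N: "\<And>n t. N \<le> n \<Longrightarrow> \<bar>\<Sum>i\<in>?B n t. \<epsilon> i \<omega>\<bar> \<le> sqrt (8 * ln (real n) * card (?B n t))"
      using elim(3) unfolding eventually_sequentially by blast
    \<comment> \<open>The first entry absorbs ln n into a power of n from \<open>N\<close> on; the
      second covers smaller n, where the sign sum is bounded by its number of terms.\<close>
    define C where "C = max (sqrt (8 / (2 * e))) (sqrt N)"
    have C0: "0 \<le> C" by (simp add: C_def le_max_iff_disj)
    have sign_bound: "\<bar>\<Sum>i\<in>?B n t. \<epsilon> i \<omega>\<bar> \<le> C * real n powr e * sqrt (card (?B n t))" if "1 \<le> n" for n t
    proof (cases "N \<le> n")
      case True
      have sq: "(real n powr e)\<^sup>2 = real n powr (2 * e)"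
        by (simp add: power2_eq_square powr_add[symmetric])
      have "ln (real n) \<le> real n powr (2 * e) / (2 * e)"
        using that e by (intro ln_powr_bound) auto
      then have "8 * ln (real n) \<le> 8 / (2 * e) * (real n powr e)\<^sup>2"
        unfolding sq by simp
      then have "sqrt (8 * ln (real n)) \<le> sqrt (8 / (2 * e) * (real n powr e)\<^sup>2)" by (rule real_sqrt_le_mono)
      also have "\<dots> = sqrt (8 / (2 * e)) * real n powr e" by (subst real_sqrt_mult) simp
      also have "\<dots> \<le> C * real n powr e" by (intro mult_right_mono) (auto simp: C_def)
      finally have "sqrt (8 * ln (real n)) * sqrt (card (?B n t)) \<le> C * real n powr e * sqrt (card (?B n t))"
        by (intro mult_right_mono) auto
      then show ?thesis using N[OF True, of t] by (simp add: real_sqrt_mult)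
    next
      case False
      have "\<bar>\<Sum>i\<in>?B n t. \<epsilon> i \<omega>\<bar> \<le> (\<Sum>i\<in>?B n t. \<bar>\<epsilon> i \<omega>\<bar>)" by (rule sum_abs)
      also have "\<dots> = sqrt (card (?B n t)) * sqrt (card (?B n t))" by (simp add: sgn)
      also have "\<dots> \<le> (C * real n powr e) * sqrt (card (?B n t))"
      proof (rule mult_right_mono)
        have "card (?B n t) \<le> card {..<n}" by (intro card_mono) (auto simp: crossed_def)
        then have "sqrt (card (?B n t)) \<le> sqrt N" using False by simp
        also have "\<dots> \<le> C * 1" by (simp add: C_def)
        also have "\<dots> \<le> C * real n powr e" using C0 that e by (intro mult_left_mono ge_one_powr_ge_zero) auto
        finally show "sqrt (card (?B n t)) \<le> C * real n powr e" .
      qed simp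
      finally show ?thesis .
    qed
    have main: "\<bar>\<Sum>i<n. sign_increment u t i \<omega>\<bar> \<le> C * ?S powr \<rho> * real n powr s * \<bar>t - u\<bar> powr p"
      if t: "t \<in> {0..1}" for n t
    proof (cases "n = 0 \<or> t = u")
      case True
      then show ?thesis by (auto simp: sign_increment_def)
    next
      case False
      then have n: "1 \<le> n" and r: "0 < \<bar>t - u\<bar>" by auto
      have "sqrt (card (?B n t)) \<le> card (?B n t) powr \<rho>"
      proof (cases "card (?B n t) = 0")
        case f: False
        have "sqrt (card (?B n t)) = card (?B n t) powr (1/2)" by (simp add: powr_half_sqrt)
        also have "\<dots> \<le> card (?B n t) powr \<rho>" using f \<rho> by (intro powr_mono) auto
        finally show ?thesis .
      qed simp
      also have "\<dots> \<le> (?S * real n powr (1 + e) * \<bar>t - u\<bar> powr q) powr \<rho>"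
      proof (rule powr_mono2)
        have "?B n t \<subseteq> {i. i < n \<and> \<bar>V i \<omega> - u\<bar> \<le> \<bar>t - u\<bar>}"
          by (auto simp: crossed_def min_def max_def split: if_splits)
        then have "card (?B n t) \<le> card {i. i < n \<and> \<bar>V i \<omega> - u\<bar> \<le> \<bar>t - u\<bar>}"
          by (intro card_mono) auto
        then have "real (card (?B n t)) \<le> real (card {i. i < n \<and> \<bar>V i \<omega> - u\<bar> \<le> \<bar>t - u\<bar>})" by simp
        also have "\<dots> \<le> ?S * real n powr (1 + e) * \<bar>t - u\<bar> powr q"
          by (rule card_le_of_neg_powr_sum) (use e q V0 elim(4) r in auto)
        finally show "real (card (?B n t)) \<le> ?S * real n powr (1 + e) * \<bar>t - u\<bar> powr q" .
      qed (use \<rho> in auto)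
      also have "\<dots> = ?S powr \<rho> * real n powr ((1 + e) * \<rho>) * \<bar>t - u\<bar> powr p"
        using S0 by (simp add: powr_mult powr_powr q)
      finally have "C * real n powr e * sqrt (card (?B n t))
          \<le> C * real n powr e * (?S powr \<rho> * real n powr ((1 + e) * \<rho>) * \<bar>t - u\<bar> powr p)"
        using C0 by (intro mult_left_mono) auto
      also have "\<dots> = C * ?S powr \<rho> * (real n powr e * real n powr ((1 + e) * \<rho>)) * \<bar>t - u\<bar> powr p"
        by (simp add: mult_ac)
      also have "real n powr e * real n powr ((1 + e) * \<rho>) = real n powr s"
        unfolding powr_add[symmetric] e(2) ..
      finally show ?thesis using sign_bound[OF n, of t] T_eq[OF t, of n] by simp
    qed
    show ?case using main C0 by (intro exI[of _ "C * ?S powr \<rho>"]) auto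
  qed
qed

text \<open>The divergence half of Borel-Cantelli. By independence the probability of missing every
  \<open>B i\<close> from \<open>m\<close> on is at most the exponential of minus any partial sum;
  were it positive, the partial sums would be bounded.\<close>

lemma AE_frequently_V_in:
  assumes B: "\<And>i. B i \<in> sets borel"
    and div: "\<not> summable (\<lambda>i. prob {\<omega> \<in> space M. V i \<omega> \<in> B i})"
  shows "AE \<omega> in M. \<exists>\<^sub>F i in sequentially. V i \<omega> \<in> B i"
proof -
  let ?p = "\<lambda>i. prob {\<omega> \<in> space M. V i \<omega> \<in> B i}"
  have [measurable]: "Measurable.pred M (\<lambda>\<omega>. V i \<omega> \<in> B i)" for i
    using B[of i] by measurable
  have "AE \<omega> in M. \<exists>i\<ge>m. V i \<omega> \<in> B i" for m
  proof -
    let ?N = "{\<omega> \<in> space M. \<forall>i\<ge>m. V i \<omega> \<notin> B i}"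
    have N: "?N \<in> events" by measurable
    have le: "prob ?N \<le> exp (- (\<Sum>i<n. ?p (i + m)))" for n
    proof (cases "n = 0")
      case False
      have "prob ?N \<le> prob (\<Inter>i\<in>{m..<n + m}. V i -` (- B i) \<inter> space M)"
        using False B by (intro finite_measure_mono) (auto intro!: sets.finite_INT measurable_sets[OF V_measurable])
      also have "\<dots> = (\<Prod>i\<in>{m..<n + m}. prob (V i -` (- B i) \<inter> space M))"
        using False B by (intro indep_varsD[OF V_indep]) auto
      also have "\<dots> = (\<Prod>i\<in>{m..<n + m}. 1 - ?p i)"
      proof (rule prod.cong[OF refl])
        fix i
        have "prob (space M - {\<omega> \<in> space M. V i \<omega> \<in> B i}) = 1 - ?p i" by (rule prob_compl) measurable
        also have "space M - {\<omega> \<in> space M. V i \<omega> \<in> B i} = V i -` (- B i) \<inter> space M" by auto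
        finally show "prob (V i -` (- B i) \<inter> space M) = 1 - ?p i" .
      qed
      also have "\<dots> \<le> (\<Prod>i\<in>{m..<n + m}. exp (- ?p i))"
      proof (rule prod_mono)
        fix i
        show "0 \<le> 1 - ?p i \<and> 1 - ?p i \<le> exp (- ?p i)"
          using exp_ge_add_one_self[of "- ?p i"] by simp
      qed
      also have "\<dots> = exp (- (\<Sum>i\<in>{m..<n + m}. ?p i))"
        by (subst exp_sum[symmetric]) (simp_all add: sum_negf)
      also have "(\<Sum>i\<in>{m..<n + m}. ?p i) = (\<Sum>i<n. ?p (i + m))"
        using sum.shift_bounds_nat_ivl[of ?p 0 m n] by (simp add: atLeast0LessThan)
      finally show ?thesis .
    qed simp
    have "prob ?N = 0"
    proof (rule ccontr)
      assume "prob ?N \<noteq> 0"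
      then have pos: "0 < prob ?N" by (simp add: zero_less_measure_iff)
      have "(\<Sum>i<n. ?p (i + m)) \<le> - ln (prob ?N)" for n
      proof -
        have "ln (prob ?N) \<le> ln (exp (- (\<Sum>i<n. ?p (i + m))))"
          using le[of n] pos by (subst ln_le_cancel_iff) auto
        then show ?thesis by simp
      qed
      then have "summable (\<lambda>i. ?p (i + m))" by (intro summableI_nonneg_bounded) auto
      then show False using div summable_iff_shift[of ?p m] by simp
    qed
    then have "AE \<omega> in M. \<not> (\<forall>i\<ge>m. V i \<omega> \<notin> B i)"
      by (subst AE_iff_measurable[OF N]) (auto simp: emeasure_eq_measure)
    then show ?thesis by simp
  qed
  then have "AE \<omega> in M. \<forall>m. \<exists>i\<ge>m. V i \<omega> \<in> B i"
    by (subst AE_all_countable) simp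
  then show ?thesis by (simp add: frequently_sequentially)
qed

text \<open>The i-th interval has probability \<open>\<delta> / real (Suc i)\<close>, a divergent
  harmonic series; \<open>u + \<delta> \<le> 1\<close> keeps all intervals inside the
  support.\<close>

lemma AE_frequently_V_near:
  assumes "0 \<le> u" "0 < \<delta>" "u + \<delta> \<le> 1"
  shows "AE \<omega> in M. \<exists>\<^sub>F i in sequentially. V i \<omega> \<in> {u..u + \<delta> / real (Suc i)}"
proof (rule AE_frequently_V_in)
  have "prob {\<omega> \<in> space M. V i \<omega> \<in> {u..u + \<delta> / real (Suc i)}} = \<delta> * inverse (real (Suc i))" for i
  proof -
    have le: "\<delta> / real (Suc i) \<le> \<delta>" using assms by (simp add: field_simps)
    have nn: "0 \<le> \<delta> / real (Suc i)" using assms by simp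
    have "{0..1} \<inter> {u..u + \<delta> / real (Suc i)} = {u..u + \<delta> / real (Suc i)}"
    proof -
      have "u + \<delta> / real (Suc i) \<le> 1" using le assms by linarith
      then show ?thesis using assms(1) by (auto simp del: of_nat_Suc)
    qed
    then show ?thesis using nn by (subst V_prob) (simp_all add: divide_inverse del: of_nat_Suc)
  qed
  moreover have "\<not> summable (\<lambda>i. \<delta> * inverse (real (Suc i)))"
    using not_summable_harmonic[where 'a = real] assms
    by (simp add: summable_cmult_iff summable_Suc_iff[of "\<lambda>n. inverse (real n)"] del: of_nat_Suc)
  ultimately show "\<not> summable (\<lambda>i. prob {\<omega> \<in> space M. V i \<omega> \<in> {u..u + \<delta> / real (Suc i)}})" by simp
qed simp

lemma AE_frequently_V_le:
  assumes "0 < u" "u \<le> 1"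
  shows "AE \<omega> in M. \<exists>\<^sub>F i in sequentially. V i \<omega> \<le> u"
proof -
  have "AE \<omega> in M. \<exists>\<^sub>F i in sequentially. V i \<omega> \<in> {..u}"
  proof (rule AE_frequently_V_in)
    have "{0..1} \<inter> {..u} = {0..u}" using assms by auto
    then have "prob {\<omega> \<in> space M. V i \<omega> \<in> {..u}} = u" for i
      using assms by (subst V_prob) simp_all
    then show "\<not> summable (\<lambda>i. prob {\<omega> \<in> space M. V i \<omega> \<in> {..u}})"
      using assms by (simp add: summable_const_iff)
  qed simp
  then show ?thesis by simp
qed

text \<open>With the unit interval cut into n equal cells, two independent uniform positions share a
  cell with probability n times n^-2, which tends to 0.\<close>

lemma AE_V_inj: "AE \<omega> in M. inj (\<lambda>i. V i \<omega>)"
proof -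
  have Icc_Int: "{0..1} \<inter> {a<..b} = {a<..b}" if "0 \<le> a" "b \<le> 1" for a b :: real
    using that by auto
  have ne: "AE \<omega> in M. V i \<omega> \<noteq> V j \<omega>" if "i \<noteq> j" for i j
  proof -
    let ?E = "{\<omega> \<in> space M. V i \<omega> = V j \<omega> \<and> 0 < V i \<omega> \<and> V i \<omega> \<le> 1}"
    have "prob ?E \<le> inverse (real (Suc N))" for N
    proof -
      define n where "n = Suc N"
      define I where "I m = {real m / real n <.. real (Suc m) / real n}" for m
      have n: "0 < real n" by (simp add: n_def)
      have I_prob: "prob {\<omega> \<in> space M. V k \<omega> \<in> I m} = 1 / real n" if "m < n" for k m
      proof -
        have "real (Suc m) \<le> real n" using that by simp
        then have "real (Suc m) / real n \<le> 1" using n by simp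
        moreover have "0 \<le> real m / real n" by simp
        ultimately have "{0..1} \<inter> I m = I m"
          unfolding I_def using Icc_Int[of "real m / real n" "real (Suc m) / real n"] by blast
        moreover have "real (Suc m) / real n - real m / real n = 1 / real n"
          by (simp add: diff_divide_distrib[symmetric])
        ultimately show ?thesis by (subst V_prob) (simp_all add: I_def divide_right_mono del: of_nat_Suc)
      qed
      have "?E \<subseteq> (\<Union>m<n. {\<omega> \<in> space M. V i \<omega> \<in> I m \<and> V j \<omega> \<in> I m})"
      proof
        fix \<omega> assume w: "\<omega> \<in> ?E"
        \<comment> \<open>Ceiling minus one, rather than floor, because the cells are open on the
          left.\<close>
        define m where "m = nat (\<lceil>real n * V i \<omega>\<rceil> - 1)"
        have "0 < real n * V i \<omega>" "real n * V i \<omega> \<le> real n" using w n by auto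
        then have m: "real m < real n * V i \<omega>" "real n * V i \<omega> \<le> real (Suc m)" "m < n"
          unfolding m_def by linarith+
        then have "V i \<omega> \<in> I m" using n by (simp add: I_def field_simps)
        then show "\<omega> \<in> (\<Union>m<n. {\<omega> \<in> space M. V i \<omega> \<in> I m \<and> V j \<omega> \<in> I m})"
          using w m(3) by auto
      qed
      then have "prob ?E \<le> prob (\<Union>m<n. {\<omega> \<in> space M. V i \<omega> \<in> I m \<and> V j \<omega> \<in> I m})"
        unfolding I_def by (intro finite_measure_mono) auto
      also have "\<dots> \<le> (\<Sum>m<n. prob {\<omega> \<in> space M. V i \<omega> \<in> I m \<and> V j \<omega> \<in> I m})"
        unfolding I_def by (intro finite_measure_subadditive_finite) auto
      also have "\<dots> = (\<Sum>m<n. 1 / real n * (1 / real n))"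
      proof (rule sum.cong[OF refl])
        fix m assume m: "m \<in> {..<n}"
        have "prob (\<Inter>k\<in>{i, j}. V k -` I m \<inter> space M) = (\<Prod>k\<in>{i, j}. prob (V k -` I m \<inter> space M))"
          by (rule indep_varsD[OF V_indep]) (auto simp: I_def)
        moreover have "(\<Inter>k\<in>{i, j}. V k -` I m \<inter> space M) = {\<omega> \<in> space M. V i \<omega> \<in> I m \<and> V j \<omega> \<in> I m}"
          by auto
        moreover have "V k -` I m \<inter> space M = {\<omega> \<in> space M. V k \<omega> \<in> I m}" for k by auto
        ultimately show "prob {\<omega> \<in> space M. V i \<omega> \<in> I m \<and> V j \<omega> \<in> I m} = 1 / real n * (1 / real n)"
          using I_prob m that by simp
      qed
      also have "\<dots> = inverse (real n)" using n by (simp add: field_simps)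
      finally show ?thesis by (simp add: n_def)
    qed
    moreover have "(\<lambda>N. inverse (real (Suc N))) \<longlonglongrightarrow> 0" by (rule LIMSEQ_inverse_real_of_nat)
    ultimately have "prob ?E \<le> 0" by (intro LIMSEQ_le_const) auto
    then have "prob ?E = 0" using measure_nonneg[of M ?E] by linarith
    then have "AE \<omega> in M. \<not> (V i \<omega> = V j \<omega> \<and> 0 < V i \<omega> \<and> V i \<omega> \<le> 1)"
      by (intro AE_I[where N = ?E]) (auto simp: emeasure_eq_measure)
    with V_AE[of 0] show ?thesis by eventually_elim auto
  qed
  have "AE \<omega> in M. i \<noteq> j \<longrightarrow> V i \<omega> \<noteq> V j \<omega>" for i j
    using ne[of i j] by (cases "i = j") auto
  then have "AE \<omega> in M. \<forall>i j. i \<noteq> j \<longrightarrow> V i \<omega> \<noteq> V j \<omega>"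
    by (simp add: AE_all_countable)
  then show ?thesis by eventually_elim (metis injI)
qed

section \<open>Invariance of the law under sign flips\<close>

lemma sign_distr:
  assumes "A \<in> sets borel"
  shows "prob {\<omega> \<in> space M. \<epsilon> k \<omega> \<in> A} = (indicator A 1 + indicator A (- 1)) / 2"
proof -
  let ?P = "{\<omega> \<in> space M. \<epsilon> k \<omega> = 1}" and ?N = "{\<omega> \<in> space M. \<epsilon> k \<omega> = -1}"
  have [measurable]: "A \<in> sets borel" by fact
  have "prob {\<omega> \<in> space M. \<epsilon> k \<omega> \<in> A} = expectation (indicator {\<omega> \<in> space M. \<epsilon> k \<omega> \<in> A})" by simp
  also have "\<dots> = expectation (\<lambda>\<omega>. indicator A 1 * indicator ?P \<omega> + indicator A (-1) * indicator ?N \<omega>)"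
  proof (rule integral_cong_AE)
    show "AE \<omega> in M. indicator {\<omega> \<in> space M. \<epsilon> k \<omega> \<in> A} \<omega>
        = (indicator A 1 * indicator ?P \<omega> + indicator A (-1) * indicator ?N \<omega> :: real)"
      using sign_AE AE_space
    proof eventually_elim
      case (elim \<omega>)
      from elim(1)[rule_format, of k] show ?case using elim(2) by (auto simp: indicator_def)
    qed
  qed measurable
  also have "\<dots> = indicator A 1 * prob ?P + indicator A (-1) * prob ?N"
    by (subst Bochner_Integration.integral_add) (auto simp: emeasure_eq_measure)
  finally show ?thesis by (simp add: sign_pos sign_neg add_divide_distrib)
qed

definition flip :: "nat \<Rightarrow> (nat \<Rightarrow> real) \<Rightarrow> nat \<Rightarrow> real" where
  "flip k e i = (if i = k then - e i else e i)"

lemma flip_measurable [measurable]: "flip k \<in> measurable seq_borel seq_borel"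
proof (rule measurable_PiM_single')
  have [measurable]: "(\<lambda>v. v i) \<in> borel_measurable seq_borel" for i :: nat
    by (rule measurable_component_singleton) simp
  show "(\<lambda>e. flip k e i) \<in> borel_measurable seq_borel" for i
    unfolding flip_def by (cases "i = k") auto
qed (auto simp: space_PiM)

text \<open>Independence makes the law of the sign sequence a product measure, and by symmetry
  flipping one coordinate leaves each marginal unchanged.\<close>

lemma flip_sign_distr:
  "distr M seq_borel (\<lambda>\<omega>. flip k (\<lambda>i. \<epsilon> i \<omega>)) = distr M seq_borel (\<lambda>\<omega> i. \<epsilon> i \<omega>)"
proof -
  let ?e = "\<lambda>i \<omega>. flip k (\<lambda>i. \<epsilon> i \<omega>) i"
  have rv: "?e i \<in> borel_measurable M" for i
    unfolding flip_def by (cases "i = k") auto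
  have "indep_vars (\<lambda>_. borel) (\<lambda>i \<omega>. (if i = k then uminus else id) (\<epsilon> i \<omega>)) UNIV"
    by (rule indep_vars_compose2[OF sign_indep]) auto
  moreover have "(\<lambda>i \<omega>. (if i = k then uminus else id) (\<epsilon> i \<omega>)) = ?e"
    by (auto simp: flip_def fun_eq_iff)
  ultimately have "indep_vars (\<lambda>_. borel) ?e UNIV" by simp
  then have 1: "distr M seq_borel (\<lambda>\<omega>. \<lambda>i\<in>UNIV. ?e i \<omega>) = (\<Pi>\<^sub>M i\<in>UNIV. distr M borel (?e i))"
    using rv by (subst (asm) indep_vars_iff_distr_eq_PiM) auto
  have 2: "distr M seq_borel (\<lambda>\<omega>. \<lambda>i\<in>UNIV. \<epsilon> i \<omega>) = (\<Pi>\<^sub>M i\<in>UNIV. distr M borel (\<epsilon> i))"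
    using sign_indep by (subst (asm) indep_vars_iff_distr_eq_PiM) auto
  have 3: "distr M borel (?e i) = distr M borel (\<epsilon> i)" for i
  proof (cases "i = k")
    case True
    show ?thesis
    proof (rule measure_eqI)
      fix A assume "A \<in> sets (distr M borel (?e i))"
      then have A: "A \<in> sets borel" by simp
      then have A': "uminus -` A \<in> sets (borel :: real measure)"
        using measurable_sets[of "uminus :: real \<Rightarrow> real" borel borel A] by simp
      have "emeasure (distr M borel (?e i)) A = ennreal (prob {\<omega> \<in> space M. \<epsilon> i \<omega> \<in> uminus -` A})"
        using A rv[of i] True by (subst emeasure_distr) (auto simp: emeasure_eq_measure flip_def intro!: arg_cong[where f=prob])
      also have "\<dots> = ennreal (prob {\<omega> \<in> space M. \<epsilon> i \<omega> \<in> A})"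
        unfolding sign_distr[OF A] sign_distr[OF A'] by (simp add: indicator_def add.commute)
      also have "\<dots> = emeasure (distr M borel (\<epsilon> i)) A"
        using A by (subst emeasure_distr) (auto simp: emeasure_eq_measure intro!: arg_cong[where f=prob])
      finally show "emeasure (distr M borel (?e i)) A = emeasure (distr M borel (\<epsilon> i)) A" .
    qed simp
  qed (simp add: flip_def)
  show ?thesis using 1 2 unfolding 3 restrict_UNIV by simp
qed

text \<open>The events of interest involve arrival times, positions and signs together. As the three
  sequences are independent, their joint law is a product in which the flip acts on the last factor
  alone.\<close>

lemma prob_flip:
  assumes P: "{z \<in> space (\<Pi>\<^sub>M k\<in>{0, 1, 2::nat}. seq_borel). P (z 0) (z 1) (z 2)}
    \<in> sets (\<Pi>\<^sub>M k\<in>{0, 1, 2::nat}. seq_borel)" (is "?A \<in> sets ?N")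
  shows "prob {\<omega> \<in> space M. P (\<lambda>i. \<Gamma> i \<omega>) (\<lambda>i. V i \<omega>) (flip k (\<lambda>i. \<epsilon> i \<omega>))}
    = prob {\<omega> \<in> space M. P (\<lambda>i. \<Gamma> i \<omega>) (\<lambda>i. V i \<omega>) (\<lambda>i. \<epsilon> i \<omega>)}"
    and "{\<omega> \<in> space M. P (\<lambda>i. \<Gamma> i \<omega>) (\<lambda>i. V i \<omega>) (flip k (\<lambda>i. \<epsilon> i \<omega>))} \<in> events"
    and "{\<omega> \<in> space M. P (\<lambda>i. \<Gamma> i \<omega>) (\<lambda>i. V i \<omega>) (\<lambda>i. \<epsilon> i \<omega>)} \<in> events"
proof -
  let ?S = "seq_borel"
  let ?Z = "\<lambda>(k::nat) \<omega> i. ([\<Gamma>, V, \<epsilon>] ! k) i \<omega>"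
  define Z' where "Z' j \<omega> = (if j = 2 then flip k else id) (?Z j \<omega>)" for j \<omega>
  have rv: "?Z j \<in> measurable M ?S" if "j \<in> {0, 1, 2}" for j
    using sequences_indep that unfolding indep_vars_def by blast
  have rv': "Z' j \<in> measurable M ?S" if "j \<in> {0, 1, 2}" for j
    unfolding Z'_def using rv[OF that] by (cases "j = 2") auto
  have "indep_vars (\<lambda>_. ?S) Z' {0, 1, 2}"
    unfolding Z'_def by (rule indep_vars_compose2[OF sequences_indep]) auto
  then have 1: "distr M ?N (\<lambda>\<omega>. \<lambda>j\<in>{0,1,2}. Z' j \<omega>) = (\<Pi>\<^sub>M j\<in>{0,1,2}. distr M ?S (Z' j))"
    using rv' by (subst (asm) indep_vars_iff_distr_eq_PiM') auto
  have 2: "distr M ?N (\<lambda>\<omega>. \<lambda>j\<in>{0,1,2}. ?Z j \<omega>) = (\<Pi>\<^sub>M j\<in>{0,1,2}. distr M ?S (?Z j))"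
    using sequences_indep rv by (subst (asm) indep_vars_iff_distr_eq_PiM') auto
  have "distr M ?S (Z' j) = distr M ?S (?Z j)" for j
    using flip_sign_distr[of k] by (cases "j = 2") (simp_all add: Z'_def[abs_def])
  then have eq: "distr M ?N (\<lambda>\<omega>. \<lambda>j\<in>{0,1,2}. Z' j \<omega>) = distr M ?N (\<lambda>\<omega>. \<lambda>j\<in>{0,1,2}. ?Z j \<omega>)"
    unfolding 1 2 by simp
  have m: "(\<lambda>\<omega>. \<lambda>j\<in>{0,1,2}. Z' j \<omega>) \<in> measurable M ?N" "(\<lambda>\<omega>. \<lambda>j\<in>{0,1,2}. ?Z j \<omega>) \<in> measurable M ?N"
    using rv rv' by (auto intro!: measurable_restrict)
  have A': "(\<lambda>\<omega>. \<lambda>j\<in>{0,1,2}. Z' j \<omega>) -` ?A \<inter> space M = {\<omega> \<in> space M. P (\<lambda>i. \<Gamma> i \<omega>) (\<lambda>i. V i \<omega>) (flip k (\<lambda>i. \<epsilon> i \<omega>))}"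
    using measurable_space[OF m(1)] by (auto simp: Z'_def)
  have A: "(\<lambda>\<omega>. \<lambda>j\<in>{0,1,2}. ?Z j \<omega>) -` ?A \<inter> space M = {\<omega> \<in> space M. P (\<lambda>i. \<Gamma> i \<omega>) (\<lambda>i. V i \<omega>) (\<lambda>i. \<epsilon> i \<omega>)}"
    using measurable_space[OF m(2)] by auto
  show "{\<omega> \<in> space M. P (\<lambda>i. \<Gamma> i \<omega>) (\<lambda>i. V i \<omega>) (flip k (\<lambda>i. \<epsilon> i \<omega>))} \<in> events"
    using measurable_sets[OF m(1) P] unfolding A' .
  show "{\<omega> \<in> space M. P (\<lambda>i. \<Gamma> i \<omega>) (\<lambda>i. V i \<omega>) (\<lambda>i. \<epsilon> i \<omega>)} \<in> events"
    using measurable_sets[OF m(2) P] unfolding A .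
  show "prob {\<omega> \<in> space M. P (\<lambda>i. \<Gamma> i \<omega>) (\<lambda>i. V i \<omega>) (flip k (\<lambda>i. \<epsilon> i \<omega>))}
    = prob {\<omega> \<in> space M. P (\<lambda>i. \<Gamma> i \<omega>) (\<lambda>i. V i \<omega>) (\<lambda>i. \<epsilon> i \<omega>)}"
    using arg_cong[OF eq, of "\<lambda>Q. measure Q ?A"] unfolding measure_distr[OF m(1) P] measure_distr[OF m(2) P] A A' .
qed

definition signed :: "real \<Rightarrow> nat \<Rightarrow> 'a \<Rightarrow> real" where
  "signed t i \<omega> = \<epsilon> i \<omega> * indicator {0..t} (V i \<omega>)"

text \<open>
  Flipping the sign of the \<open>k\<close>-th term preserves the law. If the flipped sum vanishes, the original
  sum is twice its \<open>k\<close>-th term, which can happen for at most one \<open>k\<close> because the terms have distinct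
  absolute values. So the flipped events are disjoint and their probabilities are summable, although
  each is as likely as the vanishing of the original sum together with \<open>V\<^sub>k \<le> u\<close>.
\<close>
lemma AE_signed_series_nonzero:
  fixes h :: "real \<Rightarrow> real"
  assumes u: "0 < u" "u \<le> 1" and h [measurable]: "h \<in> borel_measurable borel"
    and inj: "inj_on (\<lambda>x. \<bar>h x\<bar>) {x0..}"
    and sum: "AE \<omega> in M. summable (\<lambda>i. signed u i \<omega> * h (\<Gamma> i \<omega>))"
  shows "AE \<omega> in M. (\<Sum>i. signed u i \<omega> * h (\<Gamma> i \<omega>)) \<noteq> 0"
proof -
  \<comment> \<open>The last two conditions say that the k-th term is present and that its arrival
    time lies where the absolute value of \<open>h\<close> is injective. Almost surely both hold for
    infinitely many k, so a vanishing sum would put \<omega> in infinitely many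
    \<open>G k\<close>.\<close>
  define P where "P k g v e \<longleftrightarrow> (\<Sum>i. e i * indicator {0..u} (v i) * h (g i)) = 0 \<and> v k \<in> {0..u} \<and> x0 \<le> g k"
    for k :: nat and g v e :: "nat \<Rightarrow> real"
  define G where "G k = {\<omega> \<in> space M. P k (\<lambda>i. \<Gamma> i \<omega>) (\<lambda>i. V i \<omega>) (\<lambda>i. \<epsilon> i \<omega>)}" for k
  define F where "F k = {\<omega> \<in> space M. P k (\<lambda>i. \<Gamma> i \<omega>) (\<lambda>i. V i \<omega>) (flip k (\<lambda>i. \<epsilon> i \<omega>))}" for k
  have meas: "{z \<in> space (\<Pi>\<^sub>M k\<in>{0, 1, 2::nat}. seq_borel). P k (z 0) (z 1) (z 2)}
    \<in> sets (\<Pi>\<^sub>M k\<in>{0, 1, 2::nat}. seq_borel)" for k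
  proof -
    let ?N = "\<Pi>\<^sub>M k\<in>{0, 1, 2::nat}. seq_borel"
    have [measurable]: "(\<lambda>z. z j i) \<in> borel_measurable ?N" if "j \<in> {0, 1, 2}" for i j
      using measurable_compose[OF measurable_component_singleton[OF that] measurable_component_singleton[of i UNIV]] by simp
    have "Measurable.pred ?N (\<lambda>z. P k (z 0) (z 1) (z 2))"
      unfolding P_def by measurable
    then show ?thesis unfolding pred_def .
  qed
  have G: "G k \<in> events" and F: "F k \<in> events" and FG: "prob (F k) = prob (G k)" for k
    unfolding G_def F_def using prob_flip[where P = "P k", OF meas] by auto
  have "AE \<omega> in M. \<forall>j k. j \<noteq> k \<longrightarrow> \<not> (\<omega> \<in> F j \<and> \<omega> \<in> F k)"
    using sum sign_AE AE_arrival_strict_mono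
  proof eventually_elim
    case (elim \<omega>)
    let ?a = "\<lambda>i. signed u i \<omega> * h (\<Gamma> i \<omega>)"
    have F_D: "suminf ?a = 2 * ?a k \<and> \<bar>?a k\<bar> = \<bar>h (\<Gamma> k \<omega>)\<bar> \<and> x0 \<le> \<Gamma> k \<omega>" if "\<omega> \<in> F k" for k
    proof -
      have "(\<lambda>i. ?a i - (if i = k then 2 * ?a i else 0)) sums (suminf ?a - 2 * ?a k)"
        using summable_sums[OF elim(1)] by (intro sums_diff sums_single)
      moreover have "?a i - (if i = k then 2 * ?a i else 0)
          = flip k (\<lambda>i. \<epsilon> i \<omega>) i * indicator {0..u} (V i \<omega>) * h (\<Gamma> i \<omega>)" for i
        by (simp add: flip_def signed_def)
      ultimately have "(\<Sum>i. flip k (\<lambda>i. \<epsilon> i \<omega>) i * indicator {0..u} (V i \<omega>) * h (\<Gamma> i \<omega>)) = suminf ?a - 2 * ?a k"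
        by (simp add: sums_unique[symmetric])
      moreover have "\<bar>\<epsilon> k \<omega>\<bar> = 1" using elim(2)[rule_format, of k] by auto
      ultimately show ?thesis using that by (auto simp: F_def P_def signed_def abs_mult)
    qed
    show ?case
    proof (intro allI impI notI)
      fix j k assume jk: "j \<noteq> k" "\<omega> \<in> F j \<and> \<omega> \<in> F k"
      then have "\<bar>h (\<Gamma> j \<omega>)\<bar> = \<bar>h (\<Gamma> k \<omega>)\<bar>" "x0 \<le> \<Gamma> j \<omega>" "x0 \<le> \<Gamma> k \<omega>"
        using F_D[of j] F_D[of k] by auto
      then have "\<Gamma> j \<omega> = \<Gamma> k \<omega>" using inj by (auto dest: inj_onD)
      then show False using elim(3) jk(1) by (auto dest: strict_mono_eq)
    qed
  qed
  \<comment> \<open>The events are disjoint only outside a null set; removing it permits countable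
    additivity and changes no probability.\<close>
  then obtain N where N: "N \<in> null_sets M" "{\<omega> \<in> space M. \<not> (\<forall>j k. j \<noteq> k \<longrightarrow> \<not> (\<omega> \<in> F j \<and> \<omega> \<in> F k))} \<subseteq> N"
    by (auto simp: eventually_ae_filter)
  have "disjoint_family (\<lambda>k. F k - N)"
    using N(2) unfolding disjoint_family_on_def by (auto simp: F_def)
  then have "(\<lambda>k. prob (F k - N)) sums prob (\<Union>k. F k - N)"
    using F N by (intro finite_measure_UNION) auto
  moreover have "prob (F k - N) = prob (F k)" for k
    using N(1) F by (intro measure_Diff_null_set) auto
  ultimately have "summable (\<lambda>k. prob (G k))"
    by (simp add: FG sums_iff)
  then have "AE \<omega> in M. \<forall>\<^sub>F k in sequentially. \<omega> \<in> space M - G k"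
    by (intro borel_cantelli_AE1 G) (auto simp: emeasure_eq_measure)
  then show ?thesis
    using AE_frequently_V_le[OF u] AE_arrival_linear V_AE[of u]
  proof eventually_elim
    case (elim \<omega>)
    obtain \<kappa> where \<kappa>: "0 < \<kappa>" "\<And>n. \<kappa> * real (Suc n) \<le> \<Gamma> n \<omega>" using elim(3) by blast
    have "\<forall>\<^sub>F n in sequentially. x0 \<le> \<Gamma> n \<omega>"
    proof -
      have "\<forall>\<^sub>F n in sequentially. x0 / \<kappa> \<le> real n"
        using filterlim_real_sequentially by (simp add: filterlim_at_top)
      then show ?thesis
      proof eventually_elim
        case (elim n)
        then have "x0 \<le> \<kappa> * real n" using \<kappa>(1) by (simp add: field_simps)
        also have "\<dots> \<le> \<kappa> * real (Suc n)" using \<kappa>(1) by (intro mult_left_mono) auto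
        finally show ?case using \<kappa>(2)[of n] by simp
      qed
    qed
    then have "\<forall>\<^sub>F k in sequentially. V k \<omega> \<le> u \<longrightarrow> (V k \<omega> \<le> u \<and> x0 \<le> \<Gamma> k \<omega> \<and> \<omega> \<in> space M - G k)"
      using elim(1) by eventually_elim blast
    from frequently_mp[OF this elim(2)]
    obtain k where "V k \<omega> \<le> u" "x0 \<le> \<Gamma> k \<omega>" "\<omega> \<in> space M - G k"
      by (auto dest: frequently_ex)
    then show ?case using elim(4)[rule_format, of k] by (auto simp: G_def P_def signed_def)
  qed
qed

subsection \<open>The stable series\<close>

definition levy_series :: "real \<Rightarrow> real \<Rightarrow> 'a \<Rightarrow> real" where
  "levy_series \<theta> t \<omega> = (\<Sum>i. signed t i \<omega> * \<Gamma> i \<omega> powr - \<theta>)"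

lemma multistable_levy_motion_eq:
  "multistable_levy_motion \<alpha> \<Gamma> V \<epsilon> t \<omega> = stable_const (\<alpha> t) powr (1 / \<alpha> t) * levy_series (1 / \<alpha> t) t \<omega>"
  unfolding multistable_levy_motion_def multistable_field_def levy_series_def signed_def
  by (simp add: mult_ac)

text \<open>Increments from time 0 with \<open>p = 0\<close>. Clipping t to the unit interval loses
  nothing, because the positions lie in (0, 1].\<close>

lemma AE_partial_sums_bound:
  assumes "1 / 2 < s"
  shows "AE \<omega> in M. \<exists>K\<ge>0. \<forall>n t. \<bar>\<Sum>i<n. signed t i \<omega>\<bar> \<le> K * real n powr s"
proof -
  have "AE \<omega> in M. \<exists>K\<ge>0. \<forall>n. \<forall>t\<in>{0..1}. \<bar>\<Sum>i<n. sign_increment 0 t i \<omega>\<bar> \<le> K * real n powr s * \<bar>t - 0\<bar> powr 0"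
    using assms by (intro AE_sign_increment_bound) auto
  then show ?thesis
    using V_AE[of 0]
  proof eventually_elim
    case (elim \<omega>)
    then obtain K where K: "0 \<le> K"
      "\<And>n t. t \<in> {0..1} \<Longrightarrow> \<bar>\<Sum>i<n. sign_increment 0 t i \<omega>\<bar> \<le> K * real n powr s * \<bar>t - 0\<bar> powr 0" by blast
    have V: "0 < V i \<omega>" "V i \<omega> \<le> 1" for i using elim(2) by auto
    have "\<bar>\<Sum>i<n. signed t i \<omega>\<bar> \<le> K * real n powr s" for n t
    proof -
      define t' where "t' = max 0 (min 1 t)"
      have "signed t i \<omega> = sign_increment 0 t' i \<omega>" for i
        using V[of i] by (auto simp: signed_def sign_increment_def t'_def indicator_def)
      then have "\<bar>\<Sum>i<n. signed t i \<omega>\<bar> \<le> K * real n powr s * \<bar>t' - 0\<bar> powr 0"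
        using K(2)[of t' n] by (simp add: t'_def)
      \<comment> \<open>Only an inequality, since \<open>0 powr 0\<close> is 0.\<close>
      also have "\<dots> \<le> K * real n powr s * 1" using K(1) by (intro mult_left_mono) auto
      finally show ?thesis by simp
    qed
    then show ?case using K(1) by blast
  qed
qed

text \<open>\<open>K\<close> and \<open>\<kappa>\<close> are fixed before \<open>\<sigma>\<close>,
  as neither the growth of the arrival times nor the partial sums involve the decay exponent. One
  null set thus serves all exponents and all times.\<close>

lemma AE_abel_summation:
  assumes "1 / 2 < s"
  shows "AE \<omega> in M. \<exists>K\<ge>0. \<exists>\<kappa>. \<forall>\<sigma>>s. abel_weights (\<lambda>i. \<Gamma> i \<omega>) \<kappa> s \<sigma> \<and>
    (\<forall>t. abel_weights.partial_sums_bounded s K (\<lambda>i. signed t i \<omega>))"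
  using AE_arrival_strict_mono AE_arrival_linear AE_partial_sums_bound[OF assms]
proof eventually_elim
  case (elim \<omega>)
  obtain K where K: "0 \<le> K" "\<And>n t. \<bar>\<Sum>i<n. signed t i \<omega>\<bar> \<le> K * real n powr s" using elim(3) by blast
  obtain \<kappa> where "0 < \<kappa>" "\<forall>n. \<kappa> * real (Suc n) \<le> \<Gamma> n \<omega>" using elim(2) by blast
  moreover have "\<Gamma> i \<omega> \<le> \<Gamma> (Suc i) \<omega>" for i
    using strict_mono_leD[OF conjunct2[OF elim(1)], of i "Suc i"] by simp
  ultimately have W: "abel_weights (\<lambda>i. \<Gamma> i \<omega>) \<kappa> s \<sigma>" if "s < \<sigma>" for \<sigma>
    using that assms by unfold_locales auto
  then have "abel_weights.partial_sums_bounded s K (\<lambda>i. signed t i \<omega>)" for t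
    using abel_weights.partial_sums_bounded_def[OF W[of "s + 1"]] K by simp
  with K(1) W show ?case by blast
qed

lemma AE_levy_series_summable:
  assumes "1 / 2 < a"
  shows "AE \<omega> in M. \<forall>\<theta>\<ge>a. \<forall>t. summable (\<lambda>i. signed t i \<omega> * \<Gamma> i \<omega> powr - \<theta>)"
proof -
  obtain s where s: "1 / 2 < s" "s < a" using assms dense by blast
  show ?thesis
    using AE_abel_summation[OF s(1)]
  proof (eventually_elim, intro allI impI)
    fix \<omega> \<theta> t
    assume asm: "\<exists>K\<ge>0. \<exists>\<kappa>. \<forall>\<sigma>>s. abel_weights (\<lambda>i. \<Gamma> i \<omega>) \<kappa> s \<sigma> \<and>
      (\<forall>t. abel_weights.partial_sums_bounded s K (\<lambda>i. signed t i \<omega>))" and "a \<le> \<theta>"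
    then have "s < \<theta>" using s by simp
    with asm obtain K \<kappa> where W: "abel_weights (\<lambda>i. \<Gamma> i \<omega>) \<kappa> s \<theta>"
      and a: "\<And>t. abel_weights.partial_sums_bounded s K (\<lambda>i. signed t i \<omega>)" by blast
    from W interpret abel_weights "\<lambda>i. \<Gamma> i \<omega>" \<kappa> s \<theta> .
    show "summable (\<lambda>i. signed t i \<omega> * \<Gamma> i \<omega> powr - \<theta>)"
      using abel_sums(1)[OF a slowly_varying_powr] by (rule sums_summable)
  qed
qed

text \<open>Abel summation of the signed increments, whose partial-sum constant carries the power of
  the time increment. The growth exponent \<open>s\<close> has to lie above both p and 1/2 and below
  \<theta>.\<close>

lemma AE_levy_series_holder:
  assumes \<theta>: "1 / 2 < \<theta>" and p: "0 \<le> p" "p < \<theta>" and u: "u \<in> {0..1}"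
  shows "AE \<omega> in M. \<exists>C\<ge>0. \<forall>t\<in>{0..1}. \<bar>levy_series \<theta> t \<omega> - levy_series \<theta> u \<omega>\<bar> \<le> C * \<bar>t - u\<bar> powr p"
proof -
  obtain s where s: "max p (1 / 2) < s" "s < \<theta>" using assms dense[of "max p (1/2)" \<theta>] by auto
  then have s': "p < s" "1 / 2 < s" by auto
  show ?thesis
    using AE_sign_increment_bound[OF u p(1) s'] AE_abel_summation[OF s'(2)] AE_levy_series_summable[OF \<theta>]
  proof eventually_elim
    case (elim \<omega>)
    obtain K where K: "0 \<le> K" "\<And>n t. t \<in> {0..1} \<Longrightarrow> \<bar>\<Sum>i<n. sign_increment u t i \<omega>\<bar> \<le> K * real n powr s * \<bar>t - u\<bar> powr p"
      using elim(1) by blast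
    obtain \<kappa> where "abel_weights (\<lambda>i. \<Gamma> i \<omega>) \<kappa> s \<theta>" using elim(2) s by blast
    then interpret abel_weights "\<lambda>i. \<Gamma> i \<omega>" \<kappa> s \<theta> .
    have W: "0 \<le> suminf weight" using summable_weight weight_nonneg by (intro suminf_nonneg) auto
    have "\<bar>levy_series \<theta> t \<omega> - levy_series \<theta> u \<omega>\<bar> \<le> K * suminf weight * \<bar>t - u\<bar> powr p" if t: "t \<in> {0..1}" for t
    proof -
      have "partial_sums_bounded (K * \<bar>t - u\<bar> powr p) (\<lambda>i. sign_increment u t i \<omega>)"
        using K(2)[OF t] by (simp add: partial_sums_bounded_def mult_ac)
      from abel_sums(2)[OF this slowly_varying_powr]
      have "\<bar>\<Sum>i. sign_increment u t i \<omega> * \<Gamma> i \<omega> powr - \<theta>\<bar> \<le> K * suminf weight * \<bar>t - u\<bar> powr p"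
        by (simp add: mult_ac)
      moreover have "levy_series \<theta> t \<omega> - levy_series \<theta> u \<omega> = (\<Sum>i. sign_increment u t i \<omega> * \<Gamma> i \<omega> powr - \<theta>)"
        using elim(3)[rule_format, OF order_refl] unfolding levy_series_def
        by (subst suminf_diff) (auto simp: sign_increment_def signed_def algebra_simps)
      ultimately show ?thesis by simp
    qed
    then show ?case using K(1) W by (intro exI[of _ "K * suminf weight"]) auto
  qed
qed

lemma levy_series_diff_eq:
  assumes "summable (\<lambda>i. signed t i \<omega> * \<Gamma> i \<omega> powr - \<theta>)" "summable (\<lambda>i. signed t i \<omega> * \<Gamma> i \<omega> powr - \<tau>)"
    and "\<theta> \<noteq> \<tau>" "summable (\<lambda>i. signed t i \<omega> * powr_quotient \<theta> \<tau> (\<Gamma> i \<omega>))"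
  shows "levy_series \<theta> t \<omega> - levy_series \<tau> t \<omega> = (\<theta> - \<tau>) * (\<Sum>i. signed t i \<omega> * powr_quotient \<theta> \<tau> (\<Gamma> i \<omega>))"
proof -
  have "levy_series \<theta> t \<omega> - levy_series \<tau> t \<omega> = (\<Sum>i. signed t i \<omega> * \<Gamma> i \<omega> powr - \<theta> - signed t i \<omega> * \<Gamma> i \<omega> powr - \<tau>)"
    unfolding levy_series_def using assms(1,2) by (rule suminf_diff)
  also have "\<dots> = (\<Sum>i. (\<theta> - \<tau>) * (signed t i \<omega> * powr_quotient \<theta> \<tau> (\<Gamma> i \<omega>)))"
    using assms(3) by (intro suminf_cong powr_quotient_mult)
  also have "\<dots> = (\<theta> - \<tau>) * (\<Sum>i. signed t i \<omega> * powr_quotient \<theta> \<tau> (\<Gamma> i \<omega>))"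
    using assms(4) by (rule suminf_mult)
  finally show ?thesis .
qed

text \<open>Divided by the difference of exponents, the increment is a series in
  \<open>powr_quotient\<close>, slowly varying with a constant uniform in both exponents; the Abel
  bound is the Lipschitz constant.\<close>

lemma AE_levy_series_lipschitz:
  assumes "1 / 2 < a"
  shows "AE \<omega> in M. \<exists>C\<ge>0. \<forall>t. \<forall>\<theta>\<in>{a..b}. \<forall>\<tau>\<in>{a..b}.
    \<bar>levy_series \<theta> t \<omega> - levy_series \<tau> t \<omega>\<bar> \<le> C * \<bar>\<theta> - \<tau>\<bar>"
proof -
  obtain \<sigma> where \<sigma>: "1 / 2 < \<sigma>" "\<sigma> < a" using assms dense by blast
  obtain s where s: "1 / 2 < s" "s < \<sigma>" using \<sigma>(1) dense by blast
  show ?thesis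
    using AE_levy_series_summable[OF assms] AE_abel_summation[OF s(1)]
  proof eventually_elim
    case (elim \<omega>)
    obtain K \<kappa> where K: "0 \<le> K" and W: "abel_weights (\<lambda>i. \<Gamma> i \<omega>) \<kappa> s \<sigma>"
      and a: "\<And>t. abel_weights.partial_sums_bounded s K (\<lambda>i. signed t i \<omega>)" using elim(2) s by blast
    from W interpret abel_weights "\<lambda>i. \<Gamma> i \<omega>" \<kappa> s \<sigma> .
    have W0: "0 \<le> suminf weight" using summable_weight weight_nonneg by (intro suminf_nonneg) auto
    have "0 < \<sigma>" using \<sigma> by simp
    then obtain B where B: "0 \<le> B" "\<And>\<theta> \<tau>. \<theta> \<in> {a..b} \<Longrightarrow> \<tau> \<in> {a..b} \<Longrightarrow> slowly_varying B (\<lambda>i. powr_quotient \<theta> \<tau> (\<Gamma> i \<omega>))"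
      using slowly_varying_powr_quotient[OF _ \<sigma>(2), of b] by blast
    have "\<bar>levy_series \<theta> t \<omega> - levy_series \<tau> t \<omega>\<bar> \<le> K * B * suminf weight * \<bar>\<theta> - \<tau>\<bar>"
      if \<theta>: "\<theta> \<in> {a..b}" "\<tau> \<in> {a..b}" for t \<theta> \<tau>
    proof (cases "\<theta> = \<tau>")
      case False
      note abel = abel_sums[OF a[of t] B(2)[OF \<theta>]]
      have "\<bar>levy_series \<theta> t \<omega> - levy_series \<tau> t \<omega>\<bar> = \<bar>\<theta> - \<tau>\<bar> * \<bar>\<Sum>i. signed t i \<omega> * powr_quotient \<theta> \<tau> (\<Gamma> i \<omega>)\<bar>"
        using elim(1) \<theta> False sums_summable[OF abel(1)] by (subst levy_series_diff_eq) (auto simp: abs_mult)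
      also have "\<dots> \<le> \<bar>\<theta> - \<tau>\<bar> * (K * B * suminf weight)"
        by (intro mult_left_mono abel(2)) auto
      finally show ?thesis by (simp add: mult.commute)
    qed simp
    then show ?case using K B(1) W0 by (intro exI[of _ "K * B * suminf weight"]) auto
  qed
qed

text \<open>Time and exponent move together here. For each i the indicator is eventually constant,
  because almost surely no position equals u, and the quotients converge pointwise; uniform Abel
  bounds allow the limit inside the sum.\<close>

lemma AE_powr_quotient_series_tendsto:
  assumes a: "1 / 2 < a" and t: "t \<longlonglongrightarrow> u" and \<theta>: "\<theta> \<longlonglongrightarrow> \<theta>'" "\<And>n. \<theta> n \<in> {a..b}" "\<theta>' \<in> {a..b}" "\<tau> \<in> {a..b}"
    and ne: "\<And>n. \<theta> n \<noteq> \<tau>"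
  shows "AE \<omega> in M. summable (\<lambda>i. signed u i \<omega> * powr_quotient \<theta>' \<tau> (\<Gamma> i \<omega>)) \<and>
    (\<lambda>n. (levy_series (\<theta> n) (t n) \<omega> - levy_series \<tau> (t n) \<omega>) / (\<theta> n - \<tau>)) \<longlonglongrightarrow>
      (\<Sum>i. signed u i \<omega> * powr_quotient \<theta>' \<tau> (\<Gamma> i \<omega>))"
proof -
  obtain \<sigma> where \<sigma>: "1 / 2 < \<sigma>" "\<sigma> < a" using a dense by blast
  obtain s where s: "1 / 2 < s" "s < \<sigma>" using \<sigma>(1) dense by blast
  show ?thesis
    using AE_levy_series_summable[OF a] AE_abel_summation[OF s(1)] V_AE[of u]
  proof eventually_elim
    case (elim \<omega>)
    obtain K \<kappa> where W: "abel_weights (\<lambda>i. \<Gamma> i \<omega>) \<kappa> s \<sigma>"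
      and K: "\<And>t. abel_weights.partial_sums_bounded s K (\<lambda>i. signed t i \<omega>)" using elim(2) s by blast
    from W interpret abel_weights "\<lambda>i. \<Gamma> i \<omega>" \<kappa> s \<sigma> .
    have "0 < \<sigma>" using \<sigma> by simp
    then obtain B where "0 \<le> B" "\<And>\<theta> \<tau>. \<theta> \<in> {a..b} \<Longrightarrow> \<tau> \<in> {a..b} \<Longrightarrow> slowly_varying B (\<lambda>i. powr_quotient \<theta> \<tau> (\<Gamma> i \<omega>))"
      using slowly_varying_powr_quotient[OF _ \<sigma>(2), of b] by blast
    note B = this(2)[OF _ \<theta>(4)]
    have "(\<lambda>n. \<Sum>i. signed (t n) i \<omega> * powr_quotient (\<theta> n) \<tau> (\<Gamma> i \<omega>)) \<longlonglongrightarrow> (\<Sum>i. signed u i \<omega> * powr_quotient \<theta>' \<tau> (\<Gamma> i \<omega>))"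
    proof (rule abel_tannery[OF _ K B[OF \<theta>(2)]])
      show "(\<lambda>n. powr_quotient (\<theta> n) \<tau> (\<Gamma> i \<omega>)) \<longlonglongrightarrow> powr_quotient \<theta>' \<tau> (\<Gamma> i \<omega>)" for i
        using G_pos \<theta>(1) ne by (rule powr_quotient_tendsto)
      show "(\<lambda>n. signed (t n) i \<omega>) \<longlonglongrightarrow> signed u i \<omega>" for i
      proof -
        have V: "0 < V i \<omega>" "V i \<omega> \<noteq> u" using elim(3) by auto
        have "\<forall>\<^sub>F n in sequentially. (V i \<omega> \<le> t n) = (V i \<omega> \<le> u)"
        proof (cases "V i \<omega> < u")
          case True
          with order_tendstoD(1)[OF t] have "\<forall>\<^sub>F n in sequentially. V i \<omega> < t n" by blast
          then show ?thesis by (rule eventually_mono) (use True in auto)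
        next
          case False
          then have "u < V i \<omega>" using V by simp
          with order_tendstoD(2)[OF t] have "\<forall>\<^sub>F n in sequentially. t n < V i \<omega>" by blast
          then show ?thesis by (rule eventually_mono) (use \<open>u < V i \<omega>\<close> in auto)
        qed
        then have "\<forall>\<^sub>F n in sequentially. signed (t n) i \<omega> = signed u i \<omega>"
          by (rule eventually_mono) (use V in \<open>simp add: signed_def indicator_def\<close>)
        then show ?thesis by (rule tendsto_eventually)
      qed
    qed simp
    moreover have "(levy_series (\<theta> n) (t n) \<omega> - levy_series \<tau> (t n) \<omega>) / (\<theta> n - \<tau>)
        = (\<Sum>i. signed (t n) i \<omega> * powr_quotient (\<theta> n) \<tau> (\<Gamma> i \<omega>))" for n
      using elim(1) \<theta>(2)[of n] \<theta>(4) ne[of n] sums_summable[OF abel_sums(1)[OF K[of "t n"] B[OF \<theta>(2)]]]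
      by (subst levy_series_diff_eq) auto
    ultimately show ?case
      using sums_summable[OF abel_sums(1)[OF K[of u] B[OF \<theta>(3)]]] by simp
  qed
qed

text \<open>As t increases to \<open>V k\<close>, the indicator of {0..t} tends at each position to
  that of {0..<V k}. Positions being distinct, only the k-th term is lost.\<close>

lemma AE_levy_series_left_limit:
  assumes "1 / 2 < \<theta>"
  shows "AE \<omega> in M. \<forall>k. ((\<lambda>t. levy_series \<theta> t \<omega>) \<longlongrightarrow> levy_series \<theta> (V k \<omega>) \<omega> - \<epsilon> k \<omega> * \<Gamma> k \<omega> powr - \<theta>) (at_left (V k \<omega>))"
proof -
  obtain s where s: "1 / 2 < s" "s < \<theta>" using assms dense by blast
  show ?thesis
    using AE_levy_series_summable[OF assms] AE_abel_summation[OF s(1)] V_AE[of 0] AE_V_inj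
  proof eventually_elim
    case (elim \<omega>)
    obtain K \<kappa> where W: "abel_weights (\<lambda>i. \<Gamma> i \<omega>) \<kappa> s \<theta>"
      and K: "\<And>t. abel_weights.partial_sums_bounded s K (\<lambda>i. signed t i \<omega>)" using elim(2) s by blast
    from W interpret abel_weights "\<lambda>i. \<Gamma> i \<omega>" \<kappa> s \<theta> .
    have V: "0 < V i \<omega>" for i using elim(3) by auto
    have signed_left: "signed (V k \<omega>) i \<omega> - (if i = k then \<epsilon> i \<omega> else 0) = \<epsilon> i \<omega> * indicator {0..<V k \<omega>} (V i \<omega>)" for i k
    proof (cases "i = k")
      case True
      then show ?thesis using V[of k] by (simp add: signed_def indicator_def)
    next
      case False
      then have "V i \<omega> \<noteq> V k \<omega>" using elim(4) by (auto dest: injD)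
      then show ?thesis using False by (auto simp: signed_def indicator_def)
    qed
    show ?case
    proof
      fix k
      have "((\<lambda>t. \<Sum>i. signed t i \<omega> * \<Gamma> i \<omega> powr - \<theta>)
          \<longlongrightarrow> (\<Sum>i. (signed (V k \<omega>) i \<omega> - (if i = k then \<epsilon> i \<omega> else 0)) * \<Gamma> i \<omega> powr - \<theta>)) (at_left (V k \<omega>))"
      proof (rule abel_tannery[OF _ K slowly_varying_powr])
        fix i
        have "\<forall>\<^sub>F t in at_left (V k \<omega>). t \<in> {if V i \<omega> < V k \<omega> then V i \<omega> else 0<..<V k \<omega>}"
          using V by (intro eventually_at_left_real) auto
        then have "\<forall>\<^sub>F t in at_left (V k \<omega>). signed t i \<omega> = signed (V k \<omega>) i \<omega> - (if i = k then \<epsilon> i \<omega> else 0)"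
          unfolding signed_left by (rule eventually_mono) (auto simp: signed_def indicator_def split: if_splits)
        then show "((\<lambda>t. signed t i \<omega>) \<longlongrightarrow> signed (V k \<omega>) i \<omega> - (if i = k then \<epsilon> i \<omega> else 0)) (at_left (V k \<omega>))"
          by (rule tendsto_eventually)
      qed auto
      moreover have "(\<lambda>i. signed (V k \<omega>) i \<omega> * \<Gamma> i \<omega> powr - \<theta> - (if i = k then \<epsilon> i \<omega> * \<Gamma> i \<omega> powr - \<theta> else 0))
          sums (levy_series \<theta> (V k \<omega>) \<omega> - \<epsilon> k \<omega> * \<Gamma> k \<omega> powr - \<theta>)"
        unfolding levy_series_def using summable_sums[OF elim(1)[rule_format, OF order_refl]] by (intro sums_diff sums_single)
      moreover have "signed (V k \<omega>) i \<omega> * \<Gamma> i \<omega> powr - \<theta> - (if i = k then \<epsilon> i \<omega> * \<Gamma> i \<omega> powr - \<theta> else 0)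
          = (signed (V k \<omega>) i \<omega> - (if i = k then \<epsilon> i \<omega> else 0)) * \<Gamma> i \<omega> powr - \<theta>" for i
        by (simp add: left_diff_distrib)
      ultimately show "((\<lambda>t. levy_series \<theta> t \<omega>) \<longlongrightarrow> levy_series \<theta> (V k \<omega>) \<omega> - \<epsilon> k \<omega> * \<Gamma> k \<omega> powr - \<theta>) (at_left (V k \<omega>))"
        by (simp add: levy_series_def sums_unique[symmetric])
    qed
  qed
qed

text \<open>A bound with constant L would place the value and the left limit at a jump time
  \<open>V i\<close> within \<open>L * (V i - u) powr \<theta>\<close> of the value at u, so the
  jump is at most twice that. Jumps at distance at most \<open>\<delta> m / real (Suc i)\<close>,
  with \<open>\<delta> m\<close> tending to 0, refute every L; hence the exponent \<theta> itself is
  excluded, not only larger ones.\<close>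

lemma AE_levy_series_not_holder:
  assumes \<theta>: "1 / 2 < \<theta>" and u: "0 \<le> u" "u < 1"
  shows "AE \<omega> in M. \<forall>K. \<not> (\<forall>\<^sub>F t in at_right u. \<bar>levy_series \<theta> t \<omega> - levy_series \<theta> u \<omega>\<bar> \<le> K * (t - u) powr \<theta>)"
proof -
  define \<delta> where "\<delta> m = (1 - u) / real (Suc m)" for m
  have \<delta>_nonneg: "0 \<le> \<delta> m" for m using u by (simp add: \<delta>_def)
  have "AE \<omega> in M. \<exists>\<^sub>F i in sequentially. V i \<omega> \<in> {u..u + \<delta> m / real (Suc i)}" for m
  proof (rule AE_frequently_V_near)
    have "(1 - u) / real (Suc m) \<le> (1 - u) / 1" using u by (intro divide_left_mono) auto
    then show "u + \<delta> m \<le> 1" unfolding \<delta>_def by simp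
  qed (use u in \<open>auto simp: \<delta>_def\<close>)
  then have "AE \<omega> in M. \<forall>m. \<exists>\<^sub>F i in sequentially. V i \<omega> \<in> {u..u + \<delta> m / real (Suc i)}"
    unfolding AE_all_countable by blast
  then show ?thesis
    using AE_levy_series_left_limit[OF \<theta>] V_AE[of u] sign_AE AE_arrival_linear AE_arrival_strict_mono
  proof eventually_elim
    case (elim \<omega>)
    let ?Z = "\<lambda>t. levy_series \<theta> t \<omega>"
    obtain K1 where K1: "0 < K1" "\<And>n. \<Gamma> n \<omega> \<le> K1 * real (Suc n)" using elim(5) by blast
    have \<Gamma>_pos: "0 < \<Gamma> i \<omega>" for i
      using elim(6) strict_mono_leD[of "\<lambda>n. \<Gamma> n \<omega>" 0 i] by simp
    show ?case
    proof (rule allI, rule notI)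
      fix K assume "\<forall>\<^sub>F t in at_right u. \<bar>?Z t - ?Z u\<bar> \<le> K * (t - u) powr \<theta>"
      then obtain r where r: "u < r" "\<And>t. u < t \<Longrightarrow> t < r \<Longrightarrow> \<bar>?Z t - ?Z u\<bar> \<le> K * (t - u) powr \<theta>"
        unfolding eventually_at_right_field by blast
      define L where "L = \<bar>K\<bar>"
      have L: "\<bar>?Z t - ?Z u\<bar> \<le> L * (t - u) powr \<theta>" if "u < t" "t < r" for t
      proof -
        have "K * (t - u) powr \<theta> \<le> L * (t - u) powr \<theta>" unfolding L_def by (intro mult_right_mono) auto
        then show ?thesis using r(2)[OF that] by simp
      qed
      have "K1 powr - \<theta> \<le> 2 * L * \<delta> m powr \<theta>" for m
      proof -
        have "(\<lambda>i. u + \<delta> m / real (Suc i)) \<longlonglongrightarrow> u + 0"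
          using tendsto_mult[OF tendsto_const LIMSEQ_inverse_real_of_nat, of "\<delta> m"]
          by (intro tendsto_intros) (simp add: divide_inverse)
        then have "\<forall>\<^sub>F i in sequentially. u + \<delta> m / real (Suc i) < r"
          using r(1) by (intro order_tendstoD(2)) auto
        then have "\<forall>\<^sub>F i in sequentially. V i \<omega> \<in> {u..u + \<delta> m / real (Suc i)} \<longrightarrow>
            V i \<omega> \<in> {u..u + \<delta> m / real (Suc i)} \<and> u + \<delta> m / real (Suc i) < r"
          by eventually_elim blast
        from frequently_mp[OF this elim(1)[rule_format]]
        obtain i where i: "V i \<omega> \<in> {u..u + \<delta> m / real (Suc i)}" "u + \<delta> m / real (Suc i) < r"
          by (auto dest: frequently_ex)
        have Vi: "u < V i \<omega>" "V i \<omega> < r" "V i \<omega> - u \<le> \<delta> m / real (Suc i)"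
          using i elim(3)[rule_format, of i] by auto
        have "((\<lambda>t. \<bar>?Z (V i \<omega>) - ?Z t\<bar>) \<longlongrightarrow> \<bar>?Z (V i \<omega>) - (?Z (V i \<omega>) - \<epsilon> i \<omega> * \<Gamma> i \<omega> powr - \<theta>)\<bar>) (at_left (V i \<omega>))"
          using elim(2) by (intro tendsto_intros) auto
        then have "\<bar>?Z (V i \<omega>) - (?Z (V i \<omega>) - \<epsilon> i \<omega> * \<Gamma> i \<omega> powr - \<theta>)\<bar> \<le> 2 * L * (V i \<omega> - u) powr \<theta>"
        proof (rule tendsto_upperbound)
          have "\<forall>\<^sub>F t in at_left (V i \<omega>). t \<in> {u<..<V i \<omega>}" using Vi(1) by (rule eventually_at_left_real)
          then show "\<forall>\<^sub>F t in at_left (V i \<omega>). \<bar>?Z (V i \<omega>) - ?Z t\<bar> \<le> 2 * L * (V i \<omega> - u) powr \<theta>"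
          proof eventually_elim
            case (elim t)
            have "\<bar>?Z t - ?Z u\<bar> \<le> L * (t - u) powr \<theta>" using elim Vi by (intro L) auto
            also have "\<dots> \<le> L * (V i \<omega> - u) powr \<theta>"
              using elim \<theta> by (intro mult_left_mono powr_mono2) (auto simp: L_def)
            finally show ?case using L[OF Vi(1,2)] by linarith
          qed
        qed simp
        moreover have "\<bar>\<epsilon> i \<omega>\<bar> = 1" using elim(4)[rule_format, of i] by auto
        ultimately have "\<Gamma> i \<omega> powr - \<theta> \<le> 2 * L * (V i \<omega> - u) powr \<theta>"
          by (simp add: abs_mult)
        also have "\<dots> \<le> 2 * L * (\<delta> m / real (Suc i)) powr \<theta>"
          using Vi \<theta> by (intro mult_left_mono powr_mono2) (auto simp: L_def)
        finally have "\<Gamma> i \<omega> powr - \<theta> \<le> 2 * L * (\<delta> m / real (Suc i)) powr \<theta>" .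
        moreover have "(K1 * real (Suc i)) powr - \<theta> \<le> \<Gamma> i \<omega> powr - \<theta>"
          using \<Gamma>_pos K1(2) \<theta> by (intro powr_mono2') auto
        ultimately have "(K1 * real (Suc i)) powr - \<theta> \<le> 2 * L * (\<delta> m / real (Suc i)) powr \<theta>" by linarith
        then have le: "(K1 * real (Suc i)) powr - \<theta> * real (Suc i) powr \<theta>
            \<le> 2 * L * ((\<delta> m / real (Suc i)) powr \<theta> * real (Suc i) powr \<theta>)"
          unfolding mult.assoc[symmetric] by (intro mult_right_mono) auto
        have e1: "(K1 * real (Suc i)) powr - \<theta> * real (Suc i) powr \<theta> = K1 powr - \<theta>"
          using K1(1) by (simp add: powr_mult powr_minus del: of_nat_Suc)
        have e2: "(\<delta> m / real (Suc i)) powr \<theta> * real (Suc i) powr \<theta> = \<delta> m powr \<theta>"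
          using \<delta>_nonneg by (simp add: powr_divide del: of_nat_Suc)
        show ?thesis using le unfolding e1 e2 .
      qed
      moreover have "(\<lambda>m. 2 * L * \<delta> m powr \<theta>) \<longlonglongrightarrow> 2 * L * 0"
      proof (intro tendsto_mult tendsto_const)
        have "\<delta> \<longlonglongrightarrow> (1 - u) * 0"
          unfolding \<delta>_def[abs_def] divide_inverse
          by (intro tendsto_mult tendsto_const LIMSEQ_inverse_real_of_nat)
        then show "(\<lambda>m. \<delta> m powr \<theta>) \<longlonglongrightarrow> 0"
          using \<theta> \<delta>_nonneg by (intro tendsto_zero_powrI[where b = \<theta>]) auto
      qed
      ultimately have "K1 powr - \<theta> \<le> 2 * L * 0" by (intro LIMSEQ_le_const) auto
      then show False using K1(1) by simp
    qed
  qed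
qed

end

subsection \<open>Pointwise exponents\<close>

definition holder_at :: "(real \<Rightarrow> real) \<Rightarrow> real \<Rightarrow> real \<Rightarrow> bool" where
  "holder_at f u \<gamma> \<longleftrightarrow> ((\<lambda>r. \<bar>f (u + r) - f u\<bar> / \<bar>r\<bar> powr \<gamma>) \<longlongrightarrow> 0) (at 0)"

lemma pointwise_holder_exponent_eq: "pointwise_holder_exponent f u = Sup (ereal ` {\<gamma>. holder_at f u \<gamma>})"
  unfolding pointwise_holder_exponent_def holder_at_def ..

lemma holder_at_imp_le_exponent: "holder_at f u \<gamma> \<Longrightarrow> ereal \<gamma> \<le> pointwise_holder_exponent f u"
  unfolding pointwise_holder_exponent_eq by (intro Sup_upper) auto

lemma exponent_le: "(\<And>\<gamma>. holder_at f u \<gamma> \<Longrightarrow> ereal \<gamma> \<le> b) \<Longrightarrow> pointwise_holder_exponent f u \<le> b"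
  unfolding pointwise_holder_exponent_eq by (intro Sup_least) auto

lemma abs_powr_tendsto_0:
  fixes p :: real
  assumes "0 < p"
  shows "((\<lambda>r. \<bar>r\<bar> powr p) \<longlongrightarrow> 0) (at (0::real))"
proof (rule tendsto_zero_powrI)
  show "((\<lambda>r::real. \<bar>r\<bar>) \<longlongrightarrow> 0) (at 0)" by (intro tendsto_rabs_zero tendsto_ident_at)
qed (use assms in \<open>auto intro!: tendsto_const\<close>)

lemma LIMSEQ_null_abs_le:
  fixes f g :: "nat \<Rightarrow> real"
  assumes "g \<longlonglongrightarrow> 0" "\<And>n. \<bar>f n\<bar> \<le> g n"
  shows "f \<longlonglongrightarrow> 0"
  by (rule Lim_null_comparison[OF _ assms(1)]) (simp add: assms(2))

lemma eventually_abs_less_at_0: "0 < e \<Longrightarrow> \<forall>\<^sub>F r in at (0::real). r \<noteq> 0 \<and> \<bar>r\<bar> < e"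
  unfolding eventually_at by (intro exI[of _ e]) auto

lemma holder_at_of_bound:
  assumes "\<forall>\<^sub>F r in at 0. \<bar>f (u + r) - f u\<bar> \<le> C * \<bar>r\<bar> powr p" "\<gamma> < p"
  shows "holder_at f u \<gamma>"
  unfolding holder_at_def
proof (rule Lim_null_comparison)
  show "\<forall>\<^sub>F r in at 0. norm (\<bar>f (u + r) - f u\<bar> / \<bar>r\<bar> powr \<gamma>) \<le> C * \<bar>r\<bar> powr (p - \<gamma>)"
    using assms(1) eventually_abs_less_at_0[OF zero_less_one]
  proof eventually_elim
    case (elim r)
    then have "\<bar>f (u + r) - f u\<bar> / \<bar>r\<bar> powr \<gamma> \<le> C * \<bar>r\<bar> powr p / \<bar>r\<bar> powr \<gamma>"
      by (intro divide_right_mono) auto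
    then show ?case by (simp add: powr_diff)
  qed
  show "((\<lambda>r. C * \<bar>r\<bar> powr (p - \<gamma>)) \<longlongrightarrow> 0) (at 0)"
    using tendsto_mult[OF tendsto_const abs_powr_tendsto_0, of "p - \<gamma>" C] assms(2) by simp
qed

lemma holder_at_bound:
  assumes "holder_at f u \<gamma>"
  shows "\<forall>\<^sub>F r in at 0. \<bar>f (u + r) - f u\<bar> \<le> \<bar>r\<bar> powr \<gamma>"
proof -
  have "\<forall>\<^sub>F r in at 0. \<bar>f (u + r) - f u\<bar> / \<bar>r\<bar> powr \<gamma> < 1"
    using assms unfolding holder_at_def by (rule order_tendstoD) simp
  then show ?thesis using eventually_abs_less_at_0[OF zero_less_one]
  proof eventually_elim
    case (elim r)
    then show ?case by (simp add: divide_less_eq)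
  qed
qed

lemma holder_at_mono:
  assumes "holder_at f u \<gamma>" "\<gamma>' \<le> \<gamma>"
  shows "holder_at f u \<gamma>'"
proof (cases "\<gamma>' = \<gamma>")
  case False
  have "\<forall>\<^sub>F r in at 0. \<bar>f (u + r) - f u\<bar> \<le> 1 * \<bar>r\<bar> powr \<gamma>" using holder_at_bound[OF assms(1)] by simp
  then show ?thesis by (rule holder_at_of_bound) (use assms False in simp)
qed (use assms in simp)

text \<open>The side condition \<open>P\<close> is carried along so that the sequence can be kept
  where the range of \<alpha> is known.\<close>

lemma not_holder_at_sequence:
  assumes "\<not> holder_at f u \<gamma>" and P: "\<forall>\<^sub>F r in at 0. P r"
  obtains \<delta> r where "0 < \<delta>" "r \<longlonglongrightarrow> 0" "\<And>n. r n \<noteq> 0" "\<And>n. P (r n)"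
    "\<And>n. \<delta> * \<bar>r n\<bar> powr \<gamma> \<le> \<bar>f (u + r n) - f u\<bar>"
proof -
  obtain \<delta> where \<delta>: "0 < \<delta>" "\<not> (\<forall>\<^sub>F r in at 0. \<bar>f (u + r) - f u\<bar> / \<bar>r\<bar> powr \<gamma> < \<delta>)"
    using assms unfolding holder_at_def tendsto_iff by (auto simp: dist_real_def)
  have "\<exists>r. r \<noteq> 0 \<and> \<bar>r\<bar> < 1 / real (Suc n) \<and> P r \<and> \<delta> * \<bar>r\<bar> powr \<gamma> \<le> \<bar>f (u + r) - f u\<bar>" for n
  proof (rule ccontr)
    assume none: "\<not> ?thesis"
    have "0 < 1 / real (Suc n)" by simp
    from eventually_abs_less_at_0[OF this] P
    have "\<forall>\<^sub>F r in at 0. \<bar>f (u + r) - f u\<bar> / \<bar>r\<bar> powr \<gamma> < \<delta>"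
    proof eventually_elim
      case (elim r)
      then have "\<bar>f (u + r) - f u\<bar> < \<delta> * \<bar>r\<bar> powr \<gamma>" using none by force
      then show ?case using elim by (simp add: divide_less_eq)
    qed
    then show False using \<delta>(2) by blast
  qed
  then obtain r where r: "\<And>n. r n \<noteq> 0" "\<And>n. \<bar>r n\<bar> < 1 / real (Suc n)" "\<And>n. P (r n)"
    "\<And>n. \<delta> * \<bar>r n\<bar> powr \<gamma> \<le> \<bar>f (u + r n) - f u\<bar>" by metis
  have "r \<longlonglongrightarrow> 0"
  proof (rule Lim_null_comparison)
    show "\<forall>\<^sub>F n in sequentially. norm (r n) \<le> inverse (real (Suc n))"
      using r(2) by (intro always_eventually allI) (simp add: inverse_eq_divide less_imp_le del: of_nat_Suc)
  qed (rule LIMSEQ_inverse_real_of_nat)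
  then show thesis using that[of \<delta> r] \<delta>(1) r by blast
qed

section \<open>The multistable motion near a fixed time\<close>

locale multistable_setting = multistable_series M \<Gamma> V \<epsilon>
  for M :: "'a measure" and \<Gamma> V \<epsilon> :: "nat \<Rightarrow> 'a \<Rightarrow> real" +
  fixes \<alpha> :: "real \<Rightarrow> real" and c d u :: real
  assumes c_pos: "0 < c" and d_less: "d < 2" and \<alpha>: "\<alpha> \<in> {0..1} \<rightarrow> {c..d}" and u: "0 < u" "u < 1"
begin

definition stable_scale :: "real \<Rightarrow> real" where
  "stable_scale \<eta> = stable_const \<eta> powr (1 / \<eta>)"

abbreviation (input) Y :: "'a \<Rightarrow> real \<Rightarrow> real" where
  "Y \<omega> t \<equiv> multistable_levy_motion \<alpha> \<Gamma> V \<epsilon> t \<omega>"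

abbreviation (input) \<tau> :: real where
  "\<tau> \<equiv> 1 / \<alpha> u"

lemma \<alpha>_range: "t \<in> {0..1} \<Longrightarrow> \<alpha> t \<in> {c..d}"
  using \<alpha> by auto

lemma \<alpha>_u: "\<alpha> u \<in> {c..d}"
  using u by (intro \<alpha>_range) auto

lemma inverse_range: "\<eta> \<in> {c..d} \<Longrightarrow> 1 / \<eta> \<in> {1 / d..1 / c}"
  using c_pos by (auto simp: frac_le)

lemma half_less: "1 / 2 < 1 / d"
  using \<alpha>_u c_pos d_less by (simp add: field_simps)

lemma \<tau>: "1 / 2 < \<tau>" "0 < \<tau>" "\<tau> \<in> {1 / d..1 / c}"
proof -
  show "\<tau> \<in> {1 / d..1 / c}" using \<alpha>_u by (rule inverse_range)
  then show "1 / 2 < \<tau>" using half_less by auto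
  then show "0 < \<tau>" by linarith
qed

lemma scale_pos: "\<eta> \<in> {c..d} \<Longrightarrow> 0 < stable_scale \<eta>"
  using stable_const_pos[of \<eta>] c_pos d_less by (auto simp: stable_scale_def)

lemma scale_lipschitz: "\<exists>L. L-lipschitz_on {c..d} stable_scale"
  using stable_const_powr_lipschitz[OF c_pos d_less] unfolding stable_scale_def[abs_def] .

lemma Y_eq: "Y \<omega> t = stable_scale (\<alpha> t) * levy_series (1 / \<alpha> t) t \<omega>"
  by (simp add: multistable_levy_motion_eq stable_scale_def)

lemma eventually_in_unit: "\<forall>\<^sub>F r in at 0. u + r \<in> {0..1}"
proof -
  have "((\<lambda>r. u + r) \<longlongrightarrow> u + 0) (at 0)" by (intro tendsto_intros)
  then have "\<forall>\<^sub>F r in at 0. u + r \<in> {0<..<1}"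
    by (rule topological_tendstoD) (use u in auto)
  then show ?thesis by (rule eventually_mono) auto
qed

text \<open>On {c..d} the product of two values lies between \<open>c\<^sup>2\<close> and 4, so
  passing between \<alpha> and its reciprocal costs only constants.\<close>

lemma inverse_diff:
  assumes "\<eta> \<in> {c..d}" "\<eta>' \<in> {c..d}"
  shows "\<bar>1 / \<eta> - 1 / \<eta>'\<bar> \<le> \<bar>\<eta> - \<eta>'\<bar> / c\<^sup>2" "\<bar>\<eta> - \<eta>'\<bar> / 4 \<le> \<bar>1 / \<eta> - 1 / \<eta>'\<bar>"
proof -
  have pos: "0 < \<eta>" "0 < \<eta>'" using assms c_pos by auto
  have eq: "\<bar>1 / \<eta> - 1 / \<eta>'\<bar> = \<bar>\<eta> - \<eta>'\<bar> / (\<eta> * \<eta>')"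
    using pos by (simp add: diff_frac_eq abs_mult abs_minus_commute)
  have "c * c \<le> \<eta> * \<eta>'" using assms c_pos by (intro mult_mono) auto
  then show "\<bar>1 / \<eta> - 1 / \<eta>'\<bar> \<le> \<bar>\<eta> - \<eta>'\<bar> / c\<^sup>2"
    unfolding eq power2_eq_square using c_pos pos by (intro divide_left_mono) auto
  have "\<eta> * \<eta>' \<le> 2 * 2" using assms c_pos d_less by (intro mult_mono) auto
  then show "\<bar>\<eta> - \<eta>'\<bar> / 4 \<le> \<bar>1 / \<eta> - 1 / \<eta>'\<bar>"
    unfolding eq using pos by (intro divide_left_mono) auto
qed

lemma AE_frozen_comparison:
  "AE \<omega> in M. \<exists>C\<ge>0. \<forall>t\<in>{0..1}. \<bar>Y \<omega> t - stable_scale (\<alpha> u) * levy_series \<tau> t \<omega>\<bar> \<le> C * \<bar>\<alpha> t - \<alpha> u\<bar>"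
proof -
  obtain L where L: "L-lipschitz_on {c..d} stable_scale" using scale_lipschitz by blast
  obtain A where A: "\<And>\<eta>. \<eta> \<in> {c..d} \<Longrightarrow> \<bar>stable_scale \<eta>\<bar> \<le> A"
    using lipschitz_on_Icc_bounded[OF scale_lipschitz] by blast
  have "u \<in> {0..1}" using u by simp
  from AE_levy_series_lipschitz[OF half_less, of "1 / c"] AE_levy_series_holder[OF \<tau>(1) order_refl \<tau>(2) this]
  show ?thesis
  proof eventually_elim
    case (elim \<omega>)
    obtain C1 where C1: "0 \<le> C1" "\<And>t \<theta>. \<theta> \<in> {1 / d..1 / c} \<Longrightarrow> \<bar>levy_series \<theta> t \<omega> - levy_series \<tau> t \<omega>\<bar> \<le> C1 * \<bar>\<theta> - \<tau>\<bar>"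
      using elim(1) \<tau>(3) by blast
    obtain C2 where C2: "0 \<le> C2" "\<And>t. t \<in> {0..1} \<Longrightarrow> \<bar>levy_series \<tau> t \<omega> - levy_series \<tau> u \<omega>\<bar> \<le> C2 * \<bar>t - u\<bar> powr 0"
      using elim(2) by blast
    define B where "B = C2 + \<bar>levy_series \<tau> u \<omega>\<bar>"
    have B: "\<bar>levy_series \<tau> t \<omega>\<bar> \<le> B" if t: "t \<in> {0..1}" for t
    proof -
      have "C2 * \<bar>t - u\<bar> powr 0 \<le> C2 * 1" using C2(1) by (intro mult_left_mono) auto
      then show ?thesis using C2(2)[OF t] unfolding B_def by linarith
    qed
    define C where "C = \<bar>A\<bar> * (C1 / c\<^sup>2) + L * B"
    have "\<bar>Y \<omega> t - stable_scale (\<alpha> u) * levy_series \<tau> t \<omega>\<bar> \<le> C * \<bar>\<alpha> t - \<alpha> u\<bar>" if t: "t \<in> {0..1}" for t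
    proof -
      let ?Z = "\<lambda>\<theta>. levy_series \<theta> t \<omega>"
      note at = \<alpha>_range[OF t]
      have "Y \<omega> t - stable_scale (\<alpha> u) * ?Z \<tau> = stable_scale (\<alpha> t) * (?Z (1 / \<alpha> t) - ?Z \<tau>) + (stable_scale (\<alpha> t) - stable_scale (\<alpha> u)) * ?Z \<tau>"
        unfolding Y_eq by (simp add: algebra_simps)
      then have "\<bar>Y \<omega> t - stable_scale (\<alpha> u) * ?Z \<tau>\<bar> \<le> \<bar>stable_scale (\<alpha> t)\<bar> * \<bar>?Z (1 / \<alpha> t) - ?Z \<tau>\<bar> + \<bar>stable_scale (\<alpha> t) - stable_scale (\<alpha> u)\<bar> * \<bar>?Z \<tau>\<bar>"
        by (metis abs_mult abs_triangle_ineq)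
      also have "\<dots> \<le> \<bar>A\<bar> * (C1 / c\<^sup>2 * \<bar>\<alpha> t - \<alpha> u\<bar>) + (L * \<bar>\<alpha> t - \<alpha> u\<bar>) * B"
      proof (intro add_mono mult_mono)
        show "\<bar>stable_scale (\<alpha> t)\<bar> \<le> \<bar>A\<bar>" using A[OF at] by simp
        have "\<bar>?Z (1 / \<alpha> t) - ?Z \<tau>\<bar> \<le> C1 * \<bar>1 / \<alpha> t - \<tau>\<bar>" using inverse_range[OF at] by (rule C1(2))
        also have "\<dots> \<le> C1 * (\<bar>\<alpha> t - \<alpha> u\<bar> / c\<^sup>2)" using C1(1) inverse_diff(1)[OF at \<alpha>_u] by (rule mult_left_mono[rotated])
        finally show "\<bar>?Z (1 / \<alpha> t) - ?Z \<tau>\<bar> \<le> C1 / c\<^sup>2 * \<bar>\<alpha> t - \<alpha> u\<bar>" by simp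
        show "\<bar>stable_scale (\<alpha> t) - stable_scale (\<alpha> u)\<bar> \<le> L * \<bar>\<alpha> t - \<alpha> u\<bar>"
          using lipschitz_onD[OF L at \<alpha>_u] by (simp add: dist_real_def)
        show "0 \<le> L * \<bar>\<alpha> t - \<alpha> u\<bar>" using lipschitz_on_nonneg[OF L] by simp
      qed (use B[OF t] in auto)
      finally show ?thesis by (simp add: C_def algebra_simps)
    qed
    moreover have "0 \<le> C" using C1(1) C2(1) lipschitz_on_nonneg[OF L] by (simp add: C_def B_def)
    ultimately show ?case by blast
  qed
qed

lemma AE_holder_at_if:
  assumes \<gamma>: "\<gamma> < \<tau>" and hol: "holder_at \<alpha> u \<gamma>"
  shows "AE \<omega> in M. holder_at (Y \<omega>) u \<gamma>"
proof -
  obtain p where p: "max 0 \<gamma> < p" "p < \<tau>" using \<gamma> \<tau>(2) dense[of "max 0 \<gamma>" \<tau>] by auto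
  have "u \<in> {0..1}" using u by simp
  from AE_frozen_comparison AE_levy_series_holder[OF \<tau>(1) _ p(2) this]
  have "AE \<omega> in M. (\<exists>C\<ge>0. \<forall>t\<in>{0..1}. \<bar>Y \<omega> t - stable_scale (\<alpha> u) * levy_series \<tau> t \<omega>\<bar> \<le> C * \<bar>\<alpha> t - \<alpha> u\<bar>) \<and>
    (\<exists>C\<ge>0. \<forall>t\<in>{0..1}. \<bar>levy_series \<tau> t \<omega> - levy_series \<tau> u \<omega>\<bar> \<le> C * \<bar>t - u\<bar> powr p)"
    using p by auto
  then show ?thesis
  proof eventually_elim
    case (elim \<omega>)
    obtain C1 where C1: "\<And>t. t \<in> {0..1} \<Longrightarrow> \<bar>Y \<omega> t - stable_scale (\<alpha> u) * levy_series \<tau> t \<omega>\<bar> \<le> C1 * \<bar>\<alpha> t - \<alpha> u\<bar>"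
      using elim by blast
    obtain C2 where C2: "\<And>t. t \<in> {0..1} \<Longrightarrow> \<bar>levy_series \<tau> t \<omega> - levy_series \<tau> u \<omega>\<bar> \<le> C2 * \<bar>t - u\<bar> powr p"
      using elim by blast
    let ?s = "stable_scale (\<alpha> u)"
    show ?case
      unfolding holder_at_def
    proof (rule Lim_null_comparison)
      show "\<forall>\<^sub>F r in at 0. norm (\<bar>Y \<omega> (u + r) - Y \<omega> u\<bar> / \<bar>r\<bar> powr \<gamma>)
          \<le> C1 * (\<bar>\<alpha> (u + r) - \<alpha> u\<bar> / \<bar>r\<bar> powr \<gamma>) + ?s * C2 * \<bar>r\<bar> powr (p - \<gamma>)"
        using eventually_in_unit eventually_abs_less_at_0[OF zero_less_one]
      proof eventually_elim
        case (elim r)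
        have "\<bar>?s * levy_series \<tau> (u + r) \<omega> - ?s * levy_series \<tau> u \<omega>\<bar> = ?s * \<bar>levy_series \<tau> (u + r) \<omega> - levy_series \<tau> u \<omega>\<bar>"
          using scale_pos[OF \<alpha>_u] by (simp add: right_diff_distrib[symmetric] abs_mult)
        also have "\<dots> \<le> ?s * (C2 * \<bar>r\<bar> powr p)"
          using C2[of "u + r"] elim scale_pos[OF \<alpha>_u] by (intro mult_left_mono) auto
        finally have "\<bar>Y \<omega> (u + r) - Y \<omega> u\<bar> \<le> C1 * \<bar>\<alpha> (u + r) - \<alpha> u\<bar> + ?s * C2 * \<bar>r\<bar> powr p"
          using C1[of "u + r"] elim(1) Y_eq[of u \<omega>] by (simp add: mult.assoc)
        then have "\<bar>Y \<omega> (u + r) - Y \<omega> u\<bar> / \<bar>r\<bar> powr \<gamma> \<le> (C1 * \<bar>\<alpha> (u + r) - \<alpha> u\<bar> + ?s * C2 * \<bar>r\<bar> powr p) / \<bar>r\<bar> powr \<gamma>"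
          by (intro divide_right_mono) auto
        also have "\<dots> = C1 * (\<bar>\<alpha> (u + r) - \<alpha> u\<bar> / \<bar>r\<bar> powr \<gamma>) + ?s * C2 * \<bar>r\<bar> powr (p - \<gamma>)"
          by (simp add: add_divide_distrib powr_diff)
        finally show ?case by simp
      qed
      have "((\<lambda>r. C1 * (\<bar>\<alpha> (u + r) - \<alpha> u\<bar> / \<bar>r\<bar> powr \<gamma>) + ?s * C2 * \<bar>r\<bar> powr (p - \<gamma>)) \<longlongrightarrow> C1 * 0 + ?s * C2 * 0) (at 0)"
        using p hol unfolding holder_at_def by (intro tendsto_intros abs_powr_tendsto_0) auto
      then show "((\<lambda>r. C1 * (\<bar>\<alpha> (u + r) - \<alpha> u\<bar> / \<bar>r\<bar> powr \<gamma>) + ?s * C2 * \<bar>r\<bar> powr (p - \<gamma>)) \<longlongrightarrow> 0) (at 0)"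
        by simp
    qed
  qed
qed

lemma AE_not_holder_at_above:
  assumes \<alpha>_bound: "\<forall>\<^sub>F r in at 0. \<bar>\<alpha> (u + r) - \<alpha> u\<bar> \<le> C * \<bar>r\<bar> powr \<tau>"
  shows "AE \<omega> in M. \<forall>\<gamma>. holder_at (Y \<omega>) u \<gamma> \<longrightarrow> \<gamma> \<le> \<tau>"
proof -
  have "0 \<le> u" using u by simp
  from AE_frozen_comparison AE_levy_series_not_holder[OF \<tau>(1) this u(2)] show ?thesis
  proof eventually_elim
    case (elim \<omega>)
    obtain C1 where C1: "0 \<le> C1" "\<And>t. t \<in> {0..1} \<Longrightarrow> \<bar>Y \<omega> t - stable_scale (\<alpha> u) * levy_series \<tau> t \<omega>\<bar> \<le> C1 * \<bar>\<alpha> t - \<alpha> u\<bar>"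
      using elim(1) by blast
    let ?s = "stable_scale (\<alpha> u)"
    have s: "0 < ?s" using \<alpha>_u by (rule scale_pos)
    show ?case
    proof (intro allI impI, rule ccontr)
      fix \<gamma> assume hol: "holder_at (Y \<omega>) u \<gamma>" and "\<not> \<gamma> \<le> \<tau>"
      then have "holder_at (Y \<omega>) u \<tau>" using holder_at_mono[OF hol] by simp
      from holder_at_bound[OF this] \<alpha>_bound eventually_in_unit
      have "\<forall>\<^sub>F r in at 0. \<bar>levy_series \<tau> (u + r) \<omega> - levy_series \<tau> u \<omega>\<bar> \<le> (1 + C1 * C) / ?s * \<bar>r\<bar> powr \<tau>"
      proof eventually_elim
        case (elim r)
        have "?s * \<bar>levy_series \<tau> (u + r) \<omega> - levy_series \<tau> u \<omega>\<bar> = \<bar>?s * levy_series \<tau> (u + r) \<omega> - ?s * levy_series \<tau> u \<omega>\<bar>"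
          using s by (simp add: right_diff_distrib[symmetric] abs_mult)
        also have "\<dots> \<le> \<bar>Y \<omega> (u + r) - Y \<omega> u\<bar> + C1 * \<bar>\<alpha> (u + r) - \<alpha> u\<bar>"
          using C1(2)[OF elim(3)] Y_eq[of u \<omega>] by linarith
        also have "\<dots> \<le> \<bar>r\<bar> powr \<tau> + C1 * (C * \<bar>r\<bar> powr \<tau>)"
          using elim(1,2) C1(1) by (intro add_mono mult_left_mono) auto
        also have "\<dots> = (1 + C1 * C) * \<bar>r\<bar> powr \<tau>" by (simp add: algebra_simps)
        finally have "?s * \<bar>levy_series \<tau> (u + r) \<omega> - levy_series \<tau> u \<omega>\<bar> \<le> (1 + C1 * C) * \<bar>r\<bar> powr \<tau>" .
        then show ?case using s by (simp add: pos_le_divide_eq mult.commute)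
      qed
      then have "\<forall>\<^sub>F r in at_right 0. \<bar>levy_series \<tau> (u + r) \<omega> - levy_series \<tau> u \<omega>\<bar> \<le> (1 + C1 * C) / ?s * \<bar>r\<bar> powr \<tau>"
        by (auto simp: eventually_at_split)
      moreover have "\<forall>\<^sub>F r in at_right (0::real). 0 < r" by (simp add: eventually_at_right_less)
      ultimately have "\<forall>\<^sub>F r in at_right 0. \<bar>levy_series \<tau> (r + u) \<omega> - levy_series \<tau> u \<omega>\<bar> \<le> (1 + C1 * C) / ?s * (r + u - u) powr \<tau>"
        by eventually_elim (simp add: add.commute)
      then have "\<forall>\<^sub>F t in at_right u. \<bar>levy_series \<tau> t \<omega> - levy_series \<tau> u \<omega>\<bar> \<le> (1 + C1 * C) / ?s * (t - u) powr \<tau>"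
        unfolding at_right_to_0[of u] eventually_filtermap .
      then show False using elim(2) by blast
    qed
  qed
qed

lemma AE_not_holder_at_if:
  assumes \<gamma>: "0 \<le> \<gamma>" "\<gamma> < \<tau>" and nhol: "\<not> holder_at \<alpha> u \<gamma>"
  shows "AE \<omega> in M. \<not> holder_at (Y \<omega>) u \<gamma>"
proof -
  obtain \<delta> r where \<delta>: "0 < \<delta>" and r: "r \<longlonglongrightarrow> 0" "\<And>n. r n \<noteq> 0" "\<And>n. u + r n \<in> {0..1}"
    and inc: "\<And>n. \<delta> * \<bar>r n\<bar> powr \<gamma> \<le> \<bar>\<alpha> (u + r n) - \<alpha> u\<bar>"
    by (rule not_holder_at_sequence[OF nhol eventually_in_unit]) blast
  obtain L where L: "L-lipschitz_on {c..d} stable_scale" using scale_lipschitz by blast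
  define \<eta> where "\<eta> n = \<alpha> (u + r n)" for n
  have \<eta>_range: "\<eta> n \<in> {c..d}" for n unfolding \<eta>_def using r(3) by (rule \<alpha>_range)
  have gap: "\<delta> / 4 * \<bar>r n\<bar> powr \<gamma> \<le> \<bar>1 / \<eta> n - \<tau>\<bar>" for n
    using inverse_diff(2)[OF \<eta>_range[of n] \<alpha>_u] inc[of n] by (simp add: \<eta>_def)
  have gap_pos: "0 < \<delta> / 4 * \<bar>r n\<bar> powr \<gamma>" for n using \<delta> r(2) by simp
  have ne: "1 / \<eta> n \<noteq> \<tau>" for n using gap[of n] gap_pos[of n] by auto
  \<comment> \<open>The difference quotient of the normalising factor with respect to the reciprocal
    of \<alpha>. It has no evident limit, but it is bounded, so it joins \<open>\<eta> n\<close> in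
    the compactness argument.\<close>
  define \<kappa> where "\<kappa> n = (stable_scale (\<eta> n) - stable_scale (\<alpha> u)) / (1 / \<eta> n - \<tau>)" for n
  have \<kappa>_range: "\<kappa> n \<in> {- (4 * L)..4 * L}" for n
  proof -
    have "\<bar>stable_scale (\<eta> n) - stable_scale (\<alpha> u)\<bar> \<le> L * \<bar>\<eta> n - \<alpha> u\<bar>"
      using lipschitz_onD[OF L \<eta>_range \<alpha>_u] by (simp add: dist_real_def)
    also have "\<dots> \<le> L * (4 * \<bar>1 / \<eta> n - \<tau>\<bar>)"
      using inverse_diff(2)[OF \<eta>_range \<alpha>_u, of n] lipschitz_on_nonneg[OF L] by (intro mult_left_mono) auto
    finally have "\<bar>\<kappa> n\<bar> \<le> 4 * L"
      using ne[of n] by (simp add: \<kappa>_def abs_divide pos_divide_le_eq)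
    then show ?thesis by auto
  qed
  have "seq_compact ({c..d} \<times> {- (4 * L)..4 * L})"
    unfolding compact_eq_seq_compact_metric[symmetric] by (intro compact_Times compact_Icc)
  moreover have "\<forall>n. (\<eta> n, \<kappa> n) \<in> {c..d} \<times> {- (4 * L)..4 * L}" using \<eta>_range \<kappa>_range by auto
  ultimately obtain l \<phi> where l: "l \<in> {c..d} \<times> {- (4 * L)..4 * L}" and \<phi>: "strict_mono \<phi>"
    and lim: "((\<lambda>n. (\<eta> n, \<kappa> n)) \<circ> \<phi>) \<longlonglongrightarrow> l"
    by (rule seq_compactE)
  \<comment> \<open>\<open>\<eta>'\<close> may differ from \<open>\<alpha> u\<close>, since \<alpha>
    is not assumed continuous. Neither limit depends on \<omega>.\<close>
  define \<eta>' \<kappa>' where "\<eta>' = fst l" and "\<kappa>' = snd l"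
  have \<eta>': "\<eta>' \<in> {c..d}" using l by (auto simp: \<eta>'_def)
  have \<eta>_lim: "(\<lambda>n. \<eta> (\<phi> n)) \<longlonglongrightarrow> \<eta>'" and \<kappa>_lim: "(\<lambda>n. \<kappa> (\<phi> n)) \<longlonglongrightarrow> \<kappa>'"
    using tendsto_fst[OF lim] tendsto_snd[OF lim] by (simp_all add: o_def \<eta>'_def \<kappa>'_def)
  have r_lim: "(\<lambda>n. r (\<phi> n)) \<longlonglongrightarrow> 0" using LIMSEQ_subseq_LIMSEQ[OF r(1) \<phi>] by (simp add: o_def)
  have t_lim: "(\<lambda>n. u + r (\<phi> n)) \<longlonglongrightarrow> u" using tendsto_add[OF tendsto_const r_lim, of u] by simp
  have \<theta>_lim: "(\<lambda>n. 1 / \<eta> (\<phi> n)) \<longlonglongrightarrow> 1 / \<eta>'" using \<eta>_lim \<eta>' c_pos by (intro tendsto_intros) auto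
  have scale_lim: "(\<lambda>n. stable_scale (\<eta> (\<phi> n))) \<longlonglongrightarrow> stable_scale \<eta>'"
    using continuous_on_tendsto_compose[OF lipschitz_on_continuous_on[OF L] \<eta>_lim \<eta>'] \<eta>_range by simp
  obtain p where p: "\<gamma> < p" "p < \<tau>" using \<gamma>(2) dense by blast
  then have "0 \<le> p" using \<gamma>(1) by simp
  \<comment> \<open>The limit of the difference quotient of one term of Y: the first summand comes
    from the exponent, the second from the normalising factor. Positivity of
    \<open>stable_scale \<eta>'\<close> gives eventual injectivity whatever the value of
    \<open>\<kappa>'\<close>.\<close>
  define h where "h x = stable_scale \<eta>' * powr_quotient (1 / \<eta>') \<tau> x + \<kappa>' * x powr - \<tau>" for x
  let ?D = "\<lambda>\<omega>. \<Sum>i. signed u i \<omega> * powr_quotient (1 / \<eta>') \<tau> (\<Gamma> i \<omega>)"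
  have quot: "AE \<omega> in M. summable (\<lambda>i. signed u i \<omega> * powr_quotient (1 / \<eta>') \<tau> (\<Gamma> i \<omega>)) \<and>
    (\<lambda>n. (levy_series (1 / \<eta> (\<phi> n)) (u + r (\<phi> n)) \<omega> - levy_series \<tau> (u + r (\<phi> n)) \<omega>) / (1 / \<eta> (\<phi> n) - \<tau>)) \<longlonglongrightarrow> ?D \<omega>"
    by (rule AE_powr_quotient_series_tendsto[OF half_less t_lim \<theta>_lim inverse_range[OF \<eta>_range] inverse_range[OF \<eta>'] \<tau>(3) ne])
  have split: "AE \<omega> in M. summable (\<lambda>i. signed u i \<omega> * h (\<Gamma> i \<omega>)) \<and>
    (\<Sum>i. signed u i \<omega> * h (\<Gamma> i \<omega>)) = stable_scale \<eta>' * ?D \<omega> + \<kappa>' * levy_series \<tau> u \<omega>"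
    using quot AE_levy_series_summable[OF \<tau>(1)]
  proof eventually_elim
    case (elim \<omega>)
    have "(\<lambda>i. stable_scale \<eta>' * (signed u i \<omega> * powr_quotient (1 / \<eta>') \<tau> (\<Gamma> i \<omega>))
        + \<kappa>' * (signed u i \<omega> * \<Gamma> i \<omega> powr - \<tau>))
        sums (stable_scale \<eta>' * ?D \<omega> + \<kappa>' * levy_series \<tau> u \<omega>)"
      unfolding levy_series_def
      by (intro sums_add sums_mult summable_sums elim(1)[THEN conjunct1] elim(2)[rule_format, OF order_refl])
    moreover have "stable_scale \<eta>' * (signed u i \<omega> * powr_quotient (1 / \<eta>') \<tau> (\<Gamma> i \<omega>))
        + \<kappa>' * (signed u i \<omega> * \<Gamma> i \<omega> powr - \<tau>) = signed u i \<omega> * h (\<Gamma> i \<omega>)" for i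
      by (simp add: h_def algebra_simps)
    ultimately show ?case by (simp add: sums_iff)
  qed
  have "\<exists>x0. inj_on (\<lambda>x. \<bar>h x\<bar>) {x0..}"
    unfolding h_def using scale_pos[OF \<eta>'] \<eta>' c_pos \<tau>(2) by (intro inj_on_abs_powr_quotient) auto
  then obtain x0 where x0: "inj_on (\<lambda>x. \<bar>h x\<bar>) {x0..}" by blast
  have h_meas: "h \<in> borel_measurable borel"
    unfolding h_def[abs_def] powr_quotient_def by measurable
  have "AE \<omega> in M. (\<Sum>i. signed u i \<omega> * h (\<Gamma> i \<omega>)) \<noteq> 0"
    by (rule AE_signed_series_nonzero[OF u(1) less_imp_le[OF u(2)] h_meas x0]) (use split in auto)
  moreover have "u \<in> {0..1}" using u by simp
  note AE_levy_series_holder[OF \<tau>(1) \<open>0 \<le> p\<close> p(2) this]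
  ultimately show ?thesis
    using quot split
  proof eventually_elim
    case (elim \<omega>)
    let ?Z = "\<lambda>\<theta> t. levy_series \<theta> t \<omega>"
    let ?t = "\<lambda>n. u + r (\<phi> n)" and ?\<Delta> = "\<lambda>n. 1 / \<eta> (\<phi> n) - \<tau>"
    obtain C where C: "0 \<le> C" "\<And>t. t \<in> {0..1} \<Longrightarrow> \<bar>?Z \<tau> t - ?Z \<tau> u\<bar> \<le> C * \<bar>t - u\<bar> powr p"
      using elim(2) by blast
    have C': "\<bar>?Z \<tau> (?t n) - ?Z \<tau> u\<bar> \<le> C * \<bar>r (\<phi> n)\<bar> powr p" for n using C(2)[OF r(3)[of "\<phi> n"]] by simp
    have rpow: "(\<lambda>n. \<bar>r (\<phi> n)\<bar> powr q) \<longlonglongrightarrow> 0" if "0 < q" for q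
      using filterlim_compose[OF abs_powr_tendsto_0[OF that], of "\<lambda>n. r (\<phi> n)"] r_lim r(2) by (simp add: filterlim_at)
    have gap': "\<delta> / 4 * \<bar>r (\<phi> n)\<bar> powr \<gamma> \<le> \<bar>?\<Delta> n\<bar>" "0 < \<bar>?\<Delta> n\<bar>" for n using gap[of "\<phi> n"] ne[of "\<phi> n"] by auto
    have by_gap: "\<bar>x / ?\<Delta> n\<bar> \<le> 4 / \<delta> * (\<bar>x\<bar> / \<bar>r (\<phi> n)\<bar> powr \<gamma>)" for x n
    proof -
      have "\<bar>x\<bar> / \<bar>?\<Delta> n\<bar> \<le> \<bar>x\<bar> / (\<delta> / 4 * \<bar>r (\<phi> n)\<bar> powr \<gamma>)"
        using gap'[of n] gap_pos[of "\<phi> n"] by (intro divide_left_mono) (auto simp: zero_less_mult_iff \<delta>)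
      then show ?thesis by (simp add: abs_divide mult.commute)
    qed
    show ?case
    proof
      assume hol: "holder_at (Y \<omega>) u \<gamma>"
      have "filterlim (\<lambda>n. r (\<phi> n)) (at 0) sequentially" using r_lim r(2) by (simp add: filterlim_at)
      then have "(\<lambda>n. \<bar>Y \<omega> (?t n) - Y \<omega> u\<bar> / \<bar>r (\<phi> n)\<bar> powr \<gamma>) \<longlonglongrightarrow> 0"
        using hol unfolding holder_at_def by (rule filterlim_compose[rotated])
      from tendsto_mult[OF tendsto_const this, of "4 / \<delta>"]
      have "(\<lambda>n. 4 / \<delta> * (\<bar>Y \<omega> (?t n) - Y \<omega> u\<bar> / \<bar>r (\<phi> n)\<bar> powr \<gamma>)) \<longlonglongrightarrow> 0" by simp
      then have Y_lim: "(\<lambda>n. (Y \<omega> (?t n) - Y \<omega> u) / ?\<Delta> n) \<longlonglongrightarrow> 0"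
        using by_gap by (rule LIMSEQ_null_abs_le)
      have "(\<lambda>n. 4 / \<delta> * (C * \<bar>r (\<phi> n)\<bar> powr (p - \<gamma>))) \<longlonglongrightarrow> 4 / \<delta> * (C * 0)"
        using p by (intro tendsto_mult tendsto_const rpow) auto
      then have "(\<lambda>n. 4 / \<delta> * (C * \<bar>r (\<phi> n)\<bar> powr (p - \<gamma>))) \<longlonglongrightarrow> 0" by simp
      moreover have "\<bar>(?Z \<tau> (?t n) - ?Z \<tau> u) / ?\<Delta> n\<bar> \<le> 4 / \<delta> * (C * \<bar>r (\<phi> n)\<bar> powr (p - \<gamma>))" for n
      proof -
        have "\<bar>?Z \<tau> (?t n) - ?Z \<tau> u\<bar> / \<bar>r (\<phi> n)\<bar> powr \<gamma> \<le> C * \<bar>r (\<phi> n)\<bar> powr p / \<bar>r (\<phi> n)\<bar> powr \<gamma>"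
          using C'[of n] by (intro divide_right_mono) auto
        also have "\<dots> = C * \<bar>r (\<phi> n)\<bar> powr (p - \<gamma>)" by (simp add: powr_diff)
        finally have "4 / \<delta> * (\<bar>?Z \<tau> (?t n) - ?Z \<tau> u\<bar> / \<bar>r (\<phi> n)\<bar> powr \<gamma>) \<le> 4 / \<delta> * (C * \<bar>r (\<phi> n)\<bar> powr (p - \<gamma>))"
          using \<delta> by (intro mult_left_mono) auto
        with by_gap show ?thesis by (rule order_trans)
      qed
      ultimately have Z_inc: "(\<lambda>n. (?Z \<tau> (?t n) - ?Z \<tau> u) / ?\<Delta> n) \<longlonglongrightarrow> 0"
        by (rule LIMSEQ_null_abs_le)
      have "(\<lambda>n. C * \<bar>r (\<phi> n)\<bar> powr p) \<longlonglongrightarrow> C * 0"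
        using p \<gamma> by (intro tendsto_mult tendsto_const rpow) auto
      then have "(\<lambda>n. C * \<bar>r (\<phi> n)\<bar> powr p) \<longlonglongrightarrow> 0" by simp
      then have "(\<lambda>n. ?Z \<tau> (?t n) - ?Z \<tau> u) \<longlonglongrightarrow> 0"
        using C' by (rule LIMSEQ_null_abs_le)
      then have Z_lim: "(\<lambda>n. ?Z \<tau> (?t n)) \<longlonglongrightarrow> ?Z \<tau> u" by (simp add: LIM_zero_iff)
      \<comment> \<open>The three summands change the exponent, the normalising factor and the time,
        in this order; only the last tends to 0 on its own.\<close>
      have decomp: "(Y \<omega> (?t n) - Y \<omega> u) / ?\<Delta> n = stable_scale (\<eta> (\<phi> n)) * ((?Z (1 / \<eta> (\<phi> n)) (?t n) - ?Z \<tau> (?t n)) / ?\<Delta> n)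
          + \<kappa> (\<phi> n) * ?Z \<tau> (?t n) + stable_scale (\<alpha> u) * ((?Z \<tau> (?t n) - ?Z \<tau> u) / ?\<Delta> n)" for n
      proof -
        have "Y \<omega> (?t n) - Y \<omega> u = stable_scale (\<eta> (\<phi> n)) * (?Z (1 / \<eta> (\<phi> n)) (?t n) - ?Z \<tau> (?t n))
            + (stable_scale (\<eta> (\<phi> n)) - stable_scale (\<alpha> u)) * ?Z \<tau> (?t n) + stable_scale (\<alpha> u) * (?Z \<tau> (?t n) - ?Z \<tau> u)"
          unfolding Y_eq \<eta>_def by (simp add: algebra_simps)
        then show ?thesis by (simp only: \<kappa>_def add_divide_distrib times_divide_eq_right times_divide_eq_left)
      qed
      have "(\<lambda>n. (Y \<omega> (?t n) - Y \<omega> u) / ?\<Delta> n) \<longlonglongrightarrow> stable_scale \<eta>' * ?D \<omega> + \<kappa>' * ?Z \<tau> u + stable_scale (\<alpha> u) * 0"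
        unfolding decomp using elim(3) by (intro tendsto_intros scale_lim \<kappa>_lim Z_lim Z_inc) auto
      with Y_lim have "stable_scale \<eta>' * ?D \<omega> + \<kappa>' * ?Z \<tau> u + stable_scale (\<alpha> u) * 0 = 0" by (blast intro: LIMSEQ_unique)
      then show False using elim(1,4) by simp
    qed
  qed
qed

section \<open>From Holder conditions to exponents\<close>

lemma \<alpha>_exponent_nonneg: "0 \<le> pointwise_holder_exponent \<alpha> u"
proof (rule ccontr)
  assume "\<not> ?thesis"
  then obtain z where z: "pointwise_holder_exponent \<alpha> u < ereal z" "z < 0"
    using ereal_dense2[of "pointwise_holder_exponent \<alpha> u" 0] by (auto simp: not_le)
  \<comment> \<open>Boundedness of \<alpha>, read as a bound with exponent 0, admits every negative
    exponent.\<close>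
  have "\<forall>\<^sub>F r in at 0. \<bar>\<alpha> (u + r) - \<alpha> u\<bar> \<le> (d - c) * \<bar>r\<bar> powr 0"
    using eventually_in_unit eventually_abs_less_at_0[OF zero_less_one]
    by eventually_elim (use \<alpha>_range \<alpha>_u in \<open>force simp: abs_le_iff\<close>)
  then have "holder_at \<alpha> u z" using z(2) by (rule holder_at_of_bound)
  from holder_at_imp_le_exponent[OF this] z(1) show False by simp
qed

text \<open>The null set of each Holder statement depends on the exponent; a sequence increasing to
  b suffices because the pointwise exponent is a supremum.\<close>

lemma AE_exponent_ge:
  assumes "b \<le> \<tau>" and "\<And>\<gamma>. \<gamma> < b \<Longrightarrow> holder_at \<alpha> u \<gamma>"
  shows "AE \<omega> in M. ereal b \<le> pointwise_holder_exponent (Y \<omega>) u"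
proof -
  have "AE \<omega> in M. holder_at (Y \<omega>) u (b - inverse (real (Suc n)))" for n
  proof -
    have "b - inverse (real (Suc n)) < b" by simp
    from AE_holder_at_if[OF less_le_trans[OF this assms(1)] assms(2)[OF this]] show ?thesis .
  qed
  then have "AE \<omega> in M. \<forall>n. holder_at (Y \<omega>) u (b - inverse (real (Suc n)))"
    by (simp add: AE_all_countable)
  then show ?thesis
  proof eventually_elim
    case (elim \<omega>)
    have "(\<lambda>n. b - inverse (real (Suc n))) \<longlonglongrightarrow> b - 0"
      by (intro tendsto_diff tendsto_const LIMSEQ_inverse_real_of_nat)
    then have "(\<lambda>n. ereal (b - inverse (real (Suc n)))) \<longlonglongrightarrow> ereal b" by simp
    then show ?case using elim holder_at_imp_le_exponent by (blast intro: LIMSEQ_le_const2)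
  qed
qed

lemma AE_exponent_eq_inverse:
  assumes "\<forall>\<^sub>F r in at 0. \<bar>\<alpha> (u + r) - \<alpha> u\<bar> \<le> C * \<bar>r\<bar> powr \<tau>"
  shows "AE \<omega> in M. pointwise_holder_exponent (Y \<omega>) u = ereal \<tau>"
proof -
  have "AE \<omega> in M. ereal \<tau> \<le> pointwise_holder_exponent (Y \<omega>) u"
    using holder_at_of_bound[OF assms] by (intro AE_exponent_ge) auto
  then show ?thesis
    using AE_not_holder_at_above[OF assms]
    by eventually_elim (auto intro!: antisym exponent_le)
qed

text \<open>Holder conditions pass to smaller exponents, so \<alpha> satisfies all of those below h
  and none above. The failures are transferred to Y only for exponents below \<tau>, and a sequence
  decreasing to h inside that gap is enough.\<close>

lemma AE_exponent_eq_of_less: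
  assumes less: "pointwise_holder_exponent \<alpha> u < ereal \<tau>"
  shows "AE \<omega> in M. pointwise_holder_exponent (Y \<omega>) u = pointwise_holder_exponent \<alpha> u"
proof -
  obtain h where h: "pointwise_holder_exponent \<alpha> u = ereal h" "0 \<le> h" "h < \<tau>"
    using less \<alpha>_exponent_nonneg by (cases "pointwise_holder_exponent \<alpha> u") auto
  have hol: "holder_at \<alpha> u \<gamma>" if "\<gamma> < h" for \<gamma>
  proof -
    have "ereal \<gamma> < Sup (ereal ` {\<gamma>. holder_at \<alpha> u \<gamma>})"
      using h(1) that by (simp add: pointwise_holder_exponent_eq)
    then obtain \<gamma>' where "\<gamma> < \<gamma>'" "holder_at \<alpha> u \<gamma>'" by (auto simp: less_Sup_iff)
    then show ?thesis using holder_at_mono[of \<alpha> u \<gamma>' \<gamma>] by simp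
  qed
  have nhol: "\<not> holder_at \<alpha> u \<gamma>" if "h < \<gamma>" for \<gamma>
    using holder_at_imp_le_exponent[of \<alpha> u \<gamma>] h(1) that by auto
  \<comment> \<open>The double successor keeps \<open>g 0\<close> strictly below \<tau>.\<close>
  define g where "g n = h + (\<tau> - h) * inverse (real (Suc (Suc n)))" for n
  have g: "h < g n" "g n < \<tau>" for n
  proof -
    show "h < g n" using h by (simp add: g_def del: of_nat_Suc)
    have "inverse (real (Suc (Suc n))) < 1" by (subst inverse_less_1_iff) simp
    then have "(\<tau> - h) * inverse (real (Suc (Suc n))) < (\<tau> - h) * 1" using h by (intro mult_strict_left_mono) auto
    from add_strict_left_mono[OF this, of h] show "g n < \<tau>" by (simp add: g_def del: of_nat_Suc)
  qed
  have "AE \<omega> in M. \<not> holder_at (Y \<omega>) u (g n)" for n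
    using g[of n] h nhol by (intro AE_not_holder_at_if) auto
  then have "AE \<omega> in M. \<forall>n. \<not> holder_at (Y \<omega>) u (g n)" by (simp add: AE_all_countable)
  moreover have "AE \<omega> in M. ereal h \<le> pointwise_holder_exponent (Y \<omega>) u"
    using h hol by (intro AE_exponent_ge) auto
  ultimately show ?thesis
  proof eventually_elim
    case (elim \<omega>)
    have "g \<longlonglongrightarrow> h + (\<tau> - h) * 0"
      unfolding g_def[abs_def] by (intro tendsto_intros LIMSEQ_Suc[OF LIMSEQ_inverse_real_of_nat])
    then have lim: "(\<lambda>n. ereal (g n)) \<longlonglongrightarrow> ereal h" by simp
    have "pointwise_holder_exponent (Y \<omega>) u \<le> ereal (g n)" for n
    proof (rule exponent_le)
      fix \<gamma> assume "holder_at (Y \<omega>) u \<gamma>"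
      then have "\<not> g n \<le> \<gamma>" using elim(1) holder_at_mono[of "Y \<omega>" u \<gamma> "g n"] by blast
      then show "ereal \<gamma> \<le> ereal (g n)" by simp
    qed
    then have "pointwise_holder_exponent (Y \<omega>) u \<le> ereal h" by (intro LIMSEQ_le_const[OF lim]) blast
    then show ?case using elim(2) h(1) by simp
  qed
qed

lemma AE_exponent_eq_min:
  assumes "ereal \<tau> \<noteq> pointwise_holder_exponent \<alpha> u"
  shows "AE \<omega> in M. pointwise_holder_exponent (Y \<omega>) u = min (ereal \<tau>) (pointwise_holder_exponent \<alpha> u)"
proof (cases "pointwise_holder_exponent \<alpha> u < ereal \<tau>")
  case True
  then show ?thesis using AE_exponent_eq_of_less by (simp add: min_def)
next
  case False
  then have "ereal \<tau> < Sup (ereal ` {\<gamma>. holder_at \<alpha> u \<gamma>})"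
    using assms by (simp add: pointwise_holder_exponent_eq)
  then obtain \<gamma> where \<gamma>: "\<tau> < \<gamma>" "holder_at \<alpha> u \<gamma>" by (auto simp: less_Sup_iff)
  then have "holder_at \<alpha> u \<tau>" using holder_at_mono[of \<alpha> u \<gamma> \<tau>] by simp
  from holder_at_bound[OF this]
  have "\<forall>\<^sub>F r in at 0. \<bar>\<alpha> (u + r) - \<alpha> u\<bar> \<le> 1 * \<bar>r\<bar> powr \<tau>" by simp
  from AE_exponent_eq_inverse[OF this] show ?thesis using False by (simp add: min_def not_less)
qed

text \<open>Here \<tau> is at most 1, so the linear bound from differentiability is also a bound by
  a multiple of |r|^\<tau> for |r| < 1.\<close>

lemma AE_exponent_eq_inverse_of_differentiable:
  assumes "(\<alpha> has_real_derivative D) (at u)" "1 \<le> \<alpha> u"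
  shows "AE \<omega> in M. pointwise_holder_exponent (Y \<omega>) u = ereal \<tau>"
proof (rule AE_exponent_eq_inverse)
  have "((\<lambda>r. \<bar>(\<alpha> (u + r) - \<alpha> u) / r\<bar>) \<longlongrightarrow> \<bar>D\<bar>) (at 0)"
    using assms(1) by (intro tendsto_rabs) (simp add: DERIV_def)
  then have "\<forall>\<^sub>F r in at 0. \<bar>(\<alpha> (u + r) - \<alpha> u) / r\<bar> < \<bar>D\<bar> + 1"
    by (rule order_tendstoD) simp
  then show "\<forall>\<^sub>F r in at 0. \<bar>\<alpha> (u + r) - \<alpha> u\<bar> \<le> (\<bar>D\<bar> + 1) * \<bar>r\<bar> powr \<tau>"
    using eventually_abs_less_at_0[OF zero_less_one]
  proof eventually_elim
    case (elim r)
    then have "\<bar>\<alpha> (u + r) - \<alpha> u\<bar> \<le> (\<bar>D\<bar> + 1) * \<bar>r\<bar>" by (simp add: abs_divide divide_less_eq)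
    also have "\<bar>r\<bar> = \<bar>r\<bar> powr 1" using elim by simp
    also have "\<dots> \<le> \<bar>r\<bar> powr \<tau>" using elim assms(2) by (intro powr_mono') auto
    finally show ?case by (simp add: mult_left_mono)
  qed
qed

end

theorem theorem7:
  fixes M :: "'a measure"
    and \<Gamma> V \<epsilon> :: "nat \<Rightarrow> 'a \<Rightarrow> real"
    and \<alpha> :: "real \<Rightarrow> real"
    and c d u :: real
    and U :: "real set"
  assumes "multistable_series M \<Gamma> V \<epsilon>"
    and "{c..d} \<subseteq> {0<..<2}"
    and "\<alpha> \<in> {0..1} \<rightarrow> {c..d}"
    and "open U" and "is_interval U" and "U \<subseteq> {0<..<1}"
    and "u \<in> U"
  shows "(0 < \<alpha> u \<and> \<alpha> u < 1 \<and> ereal (1 / \<alpha> u) \<noteq> pointwise_holder_exponent \<alpha> u \<longrightarrow>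
            (AE \<omega> in M. pointwise_holder_exponent (\<lambda>t. multistable_levy_motion \<alpha> \<Gamma> V \<epsilon> t \<omega>) u =
               min (ereal (1 / \<alpha> u)) (pointwise_holder_exponent \<alpha> u))) \<and>
         (1 \<le> \<alpha> u \<and> \<alpha> u < 2 \<and> \<alpha> C1_differentiable_on U \<longrightarrow>
            (AE \<omega> in M. pointwise_holder_exponent (\<lambda>t. multistable_levy_motion \<alpha> \<Gamma> V \<epsilon> t \<omega>) u =
               ereal (1 / \<alpha> u)))"
proof -
  have u: "0 < u" "u < 1" using assms by auto
  then have "\<alpha> u \<in> {c..d}" using assms(3) by auto
  \<comment> \<open>The interval is nonempty because it contains \<open>\<alpha> u\<close>; only
    then does its inclusion in (0, 2) bound the endpoints.\<close>
  then have "c \<in> {c..d}" "d \<in> {c..d}" by auto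
  then have "0 < c" "d < 2" using assms(2) by auto
  then interpret multistable_setting M \<Gamma> V \<epsilon> \<alpha> c d u
    using assms(1,3) u by (intro multistable_setting.intro multistable_setting_axioms.intro)
  show ?thesis
  proof (intro conjI impI)
    assume "1 \<le> \<alpha> u \<and> \<alpha> u < 2 \<and> \<alpha> C1_differentiable_on U"
    moreover from this obtain D where "(\<alpha> has_real_derivative D) (at u)"
      using assms(7) unfolding C1_differentiable_on_def has_real_derivative_iff_has_vector_derivative by blast
    ultimately show "AE \<omega> in M. pointwise_holder_exponent (\<lambda>t. multistable_levy_motion \<alpha> \<Gamma> V \<epsilon> t \<omega>) u = ereal (1 / \<alpha> u)"
      by (intro AE_exponent_eq_inverse_of_differentiable) auto
  qed (use AE_exponent_eq_min in auto)
qed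

end
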